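(* Let $q$ be an odd prime power and $n\ge1$. Let $\mathcal{K}=\{K_1,\ldots,K_s\}$ be a dual pseudo-arc in $H=\mathrm{PG}(3n-1,q)$ with $s>m_2'(q^n)$. Let $\mathcal{G}$ be the associated orthogonal array of strength $3$ on $q^n$ levels with $s$ constraints and index $1$. Suppose that for some $1\le i\le s$ the partial spread $\mathcal{S}_i=\{K_j\cap K_i: j\ne i\}$ of $K_i\cong\mathrm{PG}(2n-1,q)$ extends to a Desarguesian spread of $K_i$. Then $\mathcal{G}$ can be extended, in a unique way, to an orthogonal array of strength $3$ on $q^n$ levels with $q^n+1$ constraints and index $1$. This extension forms a Miquelian Laguerre plane.
   Context: A dual pseudo-arc in $\mathrm{PG}(3n-1,q)$ is a set of $(2n-1)$-dimensional subspaces any three of which have empty intersection. $m_2'(r)$ is the size of the second largest complete arc in $\mathrm{PG}(2,r)$; here an arc is a set of points no three collinear, and it is complete if it is not contained in a larger arc. A Desarguesian spread of $\mathrm{PG}(2n-1,q)$ is the set of $(n-1)$-spaces obtained by field reduction from the points of $\mathrm{PG}(1,q^n)$. Embed $H$ as a hyperplane in $\mathrm{PG}(3n,q)$ and define the incidence structure $\mathcal{G}$, with incidence given by containment, as follows: - points: the $2n$-spaces of $\mathrm{PG}(3n,q)$ not in $H$ that contain an element of $\mathcal{K}$; - lines: the elements of $\mathcal{K}$; - circles: the points of $\mathrm{PG}(3n,q)$ not in $H$. Identifying each circle with the tuple of its points on the $s$ lines, $\mathcal{G}$ is an orthogonal array of strength $3$ on $q^n$ levels, $s$ constraints and index $1$.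 An orthogonal array of strength $t$, on $m$ levels, $k$ constraints and index $\lambda$ is a $k\times \lambda m^t$ array over an $m$-set such that in every $t$ rows, each $t$-tuple appears as a column exactly $\lambda$ times. A Laguerre plane is an incidence structure of points, lines and circles such that: - every point lies on a unique line; - a circle and a line meet in a unique point; - three points, no two on a line, lie on a unique circle; - for a point $P$ on a circle $C$ and a point $Q$ not on $C$ and not on the line through $P$, there is a unique circle through $P$ and $Q$ meeting $C$ only in $P$. A Laguerre plane of order $m$ is the same as an orthogonal array of strength $3$ on $m$ levels, $m+1$ constraints and index $1$ (lines correspond to constraints, points on a line to levels, circles to columns). A Laguerre plane is Miquelian if, for any eight distinct points $A,\dots,H$, the conditions $(ABCD),(ABEF),(BCFG),(CDGH),(ADEH)$ imply $(EFGH)$, where $(PQRS)$ means that the four points lie on a common circle. Equivalently, it is the classical Laguerre plane given by the plane sections of a quadratic cone.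
   Formalization: Miquel's condition is required only when no two of E, F, G, H lie on a line, since for merely distinct points it fails in classical planes; m_2'(q^n) is assumed to exist (q^n not 3 or 5); "unique" means up to the order of new constraints and renaming of levels in them. *)

theory Defs
  imports "HOL-Analysis.Analysis"
begin

section \<open>Projective spaces and arcs\<close>

text \<open>
  A projective subspace is represented by the underlying linear subspace of a coordinate space
  over the field. A projective dimension \<open>k\<close> is thus a vector dimension \<open>k + 1\<close>, and
  \<open>empty intersection\<close> means that the linear subspaces meet in \<open>{0}\<close> only.
\<close>

definition proj_subspaces :: "nat \<Rightarrow> ('a::field ^ 'd) set set" where
  "proj_subspaces k = {U. vec.subspace U \<and> vec.dim U = k + 1}"

definition is_arc :: "('a::field ^ 3) set set \<Rightarrow> bool" where
  "is_arc A \<longleftrightarrow> A \<subseteq> proj_subspaces 0 \<and>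
     (\<forall>x\<in>A. \<forall>y\<in>A. \<forall>z\<in>A. x \<noteq> y \<and> y \<noteq> z \<and> x \<noteq> z \<longrightarrow>
        \<not> (\<exists>l\<in>proj_subspaces 1. x \<subseteq> l \<and> y \<subseteq> l \<and> z \<subseteq> l))"

definition is_complete_arc :: "('a::field ^ 3) set set \<Rightarrow> bool" where
  "is_complete_arc A \<longleftrightarrow> is_arc A \<and> \<not> (\<exists>B. is_arc B \<and> A \<subset> B)"

definition complete_arc_sizes :: "'a::{field,finite} itself \<Rightarrow> nat set" where
  "complete_arc_sizes (_ :: 'a itself) = card ` {A :: ('a ^ 3) set set. is_complete_arc A}"

text \<open>
  \<open>is_m2' TYPE('b) m\<close> says that \<open>m\<close> is the number $m_2'(r)$ for \<open>r = CARD('b)\<close>. It is a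
  predicate and not a function because the number need not exist: in $PG(2,3)$ and $PG(2,5)$
  all complete arcs have the same size.
\<close>

definition is_m2' :: "'a::{field,finite} itself \<Rightarrow> nat \<Rightarrow> bool" where
  "is_m2' F m \<longleftrightarrow>
     (let T = complete_arc_sizes F - {Max (complete_arc_sizes F)}
      in T \<noteq> {} \<and> m = Max T)"

definition dual_pseudo_arc ::
    "nat \<Rightarrow> ('a::field ^ 'd) set \<Rightarrow> ('a ^ 'd) set set \<Rightarrow> bool" where
  "dual_pseudo_arc n H \<K> \<longleftrightarrow>
     (\<forall>X\<in>\<K>. X \<in> proj_subspaces (2 * n - 1) \<and> X \<subseteq> H) \<and>
     (\<forall>X\<in>\<K>. \<forall>Y\<in>\<K>. \<forall>Z\<in>\<K>. X \<noteq> Y \<and> Y \<noteq> Z \<and> X \<noteq> Z \<longrightarrow> X \<inter> Y \<inter> Z = {0})"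

section \<open>Desarguesian spreads\<close>

definition field_embedding :: "('a::field \<Rightarrow> 'b::field) \<Rightarrow> bool" where
  "field_embedding \<iota> \<longleftrightarrow> \<iota> 1 = 1 \<and> (\<forall>x y. \<iota> (x + y) = \<iota> x + \<iota> y) \<and> (\<forall>x y. \<iota> (x * y) = \<iota> x * \<iota> y)"

text \<open>
  Field reduction: the plane over the extension field \<open>'b\<close> is identified with the space \<open>U\<close>
  over the subfield \<open>'a\<close> by a bijection \<open>\<phi>\<close> that is linear over the subfield, and the spread
  consists of the images of the points of the projective line over \<open>'b\<close>.
\<close>

definition desarguesian_spread ::
    "('a::field \<Rightarrow> 'b::field) \<Rightarrow> ('a ^ 'd) set \<Rightarrow> ('a ^ 'd) set set \<Rightarrow> bool" where
  "desarguesian_spread \<iota> U \<D> \<longleftrightarrow>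
     (\<exists>\<phi> :: 'b ^ 2 \<Rightarrow> 'a ^ 'd.
        (\<forall>x y. \<phi> (x + y) = \<phi> x + \<phi> y) \<and>
        (\<forall>a x. \<phi> (\<iota> a *s x) = a *s \<phi> x) \<and>
        bij_betw \<phi> UNIV U \<and>
        \<D> = (\<lambda>L. \<phi> ` L) ` proj_subspaces 0)"

section \<open>Orthogonal arrays\<close>

text \<open>
  Rows are indexed by \<open>{1..k}\<close>, columns by a finite set \<open>Cols\<close>, and the symbols are taken from
  an \<open>m\<close>-set \<open>M\<close>. Only the values \<open>A i c\<close> with \<open>i \<in> {1..k}\<close> and \<open>c \<in> Cols\<close> matter.
\<close>

definition orthogonal_array ::
    "nat \<Rightarrow> nat \<Rightarrow> nat \<Rightarrow> nat \<Rightarrow> 'm set \<Rightarrow> 'c set \<Rightarrow> (nat \<Rightarrow> 'c \<Rightarrow> 'm) \<Rightarrow> bool" where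
  "orthogonal_array t m k l M Cols A \<longleftrightarrow>
     finite M \<and> card M = m \<and> finite Cols \<and> card Cols = l * m ^ t \<and>
     (\<forall>i\<in>{1..k}. \<forall>c\<in>Cols. A i c \<in> M) \<and>
     (\<forall>T. T \<subseteq> {1..k} \<and> card T = t \<longrightarrow>
        (\<forall>f. f ` T \<subseteq> M \<longrightarrow> card {c\<in>Cols. \<forall>i\<in>T. A i c = f i} = l))"

definition extends_array ::
    "'c set \<Rightarrow> nat \<Rightarrow> (nat \<Rightarrow> 'c \<Rightarrow> 'm) \<Rightarrow> nat \<Rightarrow> (nat \<Rightarrow> 'c \<Rightarrow> 'm) \<Rightarrow> bool" where
  "extends_array Cols s A k A' \<longleftrightarrow> s \<le> k \<and> (\<forall>i\<in>{1..s}. \<forall>c\<in>Cols. A' i c = A i c)"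

text \<open>
  Two arrays with the same first \<open>s\<close> rows are the same extension of these rows if they differ
  only in the order of the new rows and in the naming of the symbols within each new row.
\<close>

definition same_extension ::
    "'m set \<Rightarrow> 'c set \<Rightarrow> nat \<Rightarrow> nat \<Rightarrow> (nat \<Rightarrow> 'c \<Rightarrow> 'm) \<Rightarrow> (nat \<Rightarrow> 'c \<Rightarrow> 'm) \<Rightarrow> bool" where
  "same_extension M Cols s k A A' \<longleftrightarrow>
     (\<forall>i\<in>{1..s}. \<forall>c\<in>Cols. A' i c = A i c) \<and>
     (\<exists>\<pi> \<sigma>. bij_betw \<pi> {s+1..k} {s+1..k} \<and>
        (\<forall>i\<in>{s+1..k}. bij_betw (\<sigma> i) M M \<and> (\<forall>c\<in>Cols. A' (\<pi> i) c = \<sigma> i (A i c))))"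

section \<open>Laguerre planes\<close>

definition laguerre_plane ::
    "'p set \<Rightarrow> 'l set \<Rightarrow> 'c set \<Rightarrow> ('p \<Rightarrow> 'l \<Rightarrow> bool) \<Rightarrow> ('p \<Rightarrow> 'c \<Rightarrow> bool) \<Rightarrow> bool" where
  "laguerre_plane Pts Lns Circs onl onc \<longleftrightarrow>
     (\<forall>p\<in>Pts. \<exists>!l. l \<in> Lns \<and> onl p l) \<and>
     (\<forall>c\<in>Circs. \<forall>l\<in>Lns. \<exists>!p. p \<in> Pts \<and> onl p l \<and> onc p c) \<and>
     (\<forall>p\<in>Pts. \<forall>q\<in>Pts. \<forall>r\<in>Pts.
        \<not> (\<exists>l\<in>Lns. onl p l \<and> onl q l) \<and> \<not> (\<exists>l\<in>Lns. onl q l \<and> onl r l) \<and>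
        \<not> (\<exists>l\<in>Lns. onl p l \<and> onl r l) \<longrightarrow>
        (\<exists>!c. c \<in> Circs \<and> onc p c \<and> onc q c \<and> onc r c)) \<and>
     (\<forall>c\<in>Circs. \<forall>p\<in>Pts. \<forall>q\<in>Pts.
        onc p c \<and> \<not> onc q c \<and> \<not> (\<exists>l\<in>Lns. onl p l \<and> onl q l) \<longrightarrow>
        (\<exists>!d. d \<in> Circs \<and> onc p d \<and> onc q d \<and> (\<forall>x\<in>Pts. onc x c \<and> onc x d \<longrightarrow> x = p)))"

text \<open>
  The condition of Miquel is usually stated for eight points no two of which lie on a line.
  Here this is only required of the last four points \<open>E, F, G, H\<close>, the other points being merely
  distinct, which gives a formally stronger condition. It cannot be dropped altogether: two
  points on a line never lie on a common circle, and in the plane sections of a quadratic cone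
  there are eight distinct points, with \<open>E, G\<close> on one line and \<open>F, H\<close> on another, that satisfy
  the five hypotheses.
\<close>

definition miquelian ::
    "'p set \<Rightarrow> 'l set \<Rightarrow> 'c set \<Rightarrow> ('p \<Rightarrow> 'l \<Rightarrow> bool) \<Rightarrow> ('p \<Rightarrow> 'c \<Rightarrow> bool) \<Rightarrow> bool" where
  "miquelian Pts Lns Circs onl onc \<longleftrightarrow>
     (let conc = (\<lambda>w x y z. \<exists>c\<in>Circs. onc w c \<and> onc x c \<and> onc y c \<and> onc z c);
          par = (\<lambda>x y. \<exists>l\<in>Lns. onl x l \<and> onl y l)
      in \<forall>A\<in>Pts. \<forall>B\<in>Pts. \<forall>C\<in>Pts. \<forall>D\<in>Pts. \<forall>E\<in>Pts. \<forall>F\<in>Pts. \<forall>G\<in>Pts. \<forall>H\<in>Pts.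
           distinct [A, B, C, D, E, F, G, H] \<and>
           \<not> par E F \<and> \<not> par E G \<and> \<not> par E H \<and> \<not> par F G \<and> \<not> par F H \<and> \<not> par G H \<and>
           conc A B C D \<and> conc A B E F \<and> conc B C F G \<and> conc C D G H \<and> conc A D E H \<longrightarrow>
           conc E F G H)"

text \<open>
  The incidence structure of an array: the lines are the row indices, the points are the pairs
  of a row index and a symbol, the circles are the columns.
\<close>

abbreviation array_points :: "nat \<Rightarrow> 'm set \<Rightarrow> (nat \<times> 'm) set" where
  "array_points k M \<equiv> {1..k} \<times> M"

definition array_onl :: "nat \<times> 'm \<Rightarrow> nat \<Rightarrow> bool" where
  "array_onl p i \<longleftrightarrow> fst p = i"

definition array_onc :: "(nat \<Rightarrow> 'c \<Rightarrow> 'm) \<Rightarrow> nat \<times> 'm \<Rightarrow> 'c \<Rightarrow> bool" where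
  "array_onc A p c \<longleftrightarrow> A (fst p) c = snd p"

definition forms_miquelian_laguerre_plane ::
    "nat \<Rightarrow> 'm set \<Rightarrow> 'c set \<Rightarrow> (nat \<Rightarrow> 'c \<Rightarrow> 'm) \<Rightarrow> bool" where
  "forms_miquelian_laguerre_plane k M Cols A \<longleftrightarrow>
     laguerre_plane (array_points k M) {1..k} Cols array_onl (array_onc A) \<and>
     miquelian (array_points k M) {1..k} Cols array_onl (array_onc A)"

section \<open>The incidence structure of a dual pseudo-arc\<close>

text \<open>
  The ambient projective space is that of \<open>'a ^ 'd\<close>, and \<open>H\<close> is a hyperplane in it. The lines
  are the elements of \<open>\<K>\<close>, and incidence is containment.
\<close>

definition G_points :: "nat \<Rightarrow> ('a::field ^ 'd) set \<Rightarrow> ('a ^ 'd) set set \<Rightarrow> ('a ^ 'd) set set" where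
  "G_points n H \<K> = {P \<in> proj_subspaces (2 * n). \<not> P \<subseteq> H \<and> (\<exists>X\<in>\<K>. X \<subseteq> P)}"

definition G_circles :: "('a::field ^ 'd) set \<Rightarrow> ('a ^ 'd) set set" where
  "G_circles H = {c \<in> proj_subspaces 0. \<not> c \<subseteq> H}"

definition G_line_points ::
    "nat \<Rightarrow> ('a::field ^ 'd) set \<Rightarrow> ('a ^ 'd) set set \<Rightarrow> ('a ^ 'd) set \<Rightarrow> ('a ^ 'd) set set" where
  "G_line_points n H \<K> X = {P \<in> G_points n H \<K>. X \<subseteq> P}"

text \<open>
  The column of a circle \<open>c\<close> is the tuple of its points on the lines \<open>K 1, \<dots>, K s\<close>. To have all
  entries in one set of symbols, the points of the line \<open>K i\<close> are named by \<open>lab i\<close>.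
\<close>

definition G_array ::
    "nat \<Rightarrow> ('a::field ^ 'd) set \<Rightarrow> nat \<Rightarrow> (nat \<Rightarrow> ('a ^ 'd) set) \<Rightarrow>
      (nat \<Rightarrow> ('a ^ 'd) set \<Rightarrow> 'm) \<Rightarrow> nat \<Rightarrow> ('a ^ 'd) set \<Rightarrow> 'm" where
  "G_array n H s K lab i c = lab i (THE P. P \<in> G_line_points n H (K ` {1..s}) (K i) \<and> c \<subseteq> P)"

end

theory Submission
  imports Defs
begin

text \<open>
  Let \<open>r = q\<^sup>n\<close>. For a vector \<open>v\<close> of \<open>H\<close> outside \<open>K\<^sub>i\<close>, the translates \<open>v + K\<^sub>j\<close> meet
  \<open>K\<^sub>i = AG(2, r)\<close> in \<open>s - 1\<close> lines that form, together with the line at infinity, a dual arc of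
  size \<open>s > m\<^sub>2'(r)\<close>. By Segre's theorem it is part of a dual conic. Comparing the conics
  of \<open>v\<close>, \<open>v'\<close> and \<open>v + v'\<close> gives additive coordinates in which the circles are the polynomials of
  degree at most \<open>2\<close> over \<open>GF(r)\<close> and the rows of the array are their evaluations at \<open>s\<close> elements
  of \<open>GF(r) \<union> {\<infinity>}\<close>. Evaluating at the remaining elements yields the extension.

  For the uniqueness let \<open>C\<close> be the set of circles with a given symbol in a new row. A linear functional
  that is not a multiple of an evaluation is, again by \<open>s > m\<^sub>2'(r)\<close>, a combination of two of the
  given evaluations, and hence equidistributed on \<open>C\<close>. So the indicator function of
  \<open>C\<close> is a sum of functions of single evaluations, and as it takes the values \<open>0\<close> and \<open>1\<close> only, it
  depends on a single evaluation.
\<close>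

section \<open>Finite fields of odd order\<close>

text \<open>The bound \<open>m < s\<close> acts in two ways. An arc of more than \<open>m\<close>
  points lies on a conic: for existence this is applied to the \<open>s - 1\<close> traces and the
  line at infinity, for uniqueness to the \<open>s\<close> evaluations and one further functional.
  And \<open>s\<close> exceeds five, because \<open>5 \<le> m\<close>; five zeros on the projective
  line annihilate a binary quartic form, which is how conics are compared. The obstacle to additive
  coordinates is that the conic of each \<open>v\<close> comes from an existence theorem and has no
  visible relation to the others. Clearing denominators in the additivity of the traces gives a
  quartic identity, and this forces a common tangent direction. The obstacle to uniqueness is that a
  new row is an arbitrary function, neither additive nor linear, so only counting is available. Two
  different intersection numbers with parallel planes turn out to use up all of \<open>C\<close>; a
  third element of the field then leaves only the numbers 0 and r^2.\<close>

lemma of_nat_card_field: "of_nat CARD('b) = (0 :: 'b::{field,finite})"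
proof -
  \<comment> \<open>Translation by 1 permutes the field, so adding 1 to every summand does not
    change the sum of all elements.\<close>
  have "(\<Sum>x\<in>UNIV. x + (1::'b)) = (\<Sum>x\<in>UNIV. x)"
    by (rule sum.reindex_bij_witness[of _ "\<lambda>x. x - 1" "\<lambda>x. x + 1"]) auto
  thus ?thesis
    by (simp add: sum.distrib)
qed

lemma two_le_card_field: "2 \<le> CARD('b::{field,finite})"
  using card_mono[of UNIV "{0, 1::'b}"] by simp

lemma two_neq_zero:
  assumes "odd CARD('b::{field,finite})"
  shows "(2::'b) \<noteq> 0"
proof
  assume *: "(2::'b) = 0"
  obtain k where "CARD('b) = 2 * k + 1"
    using assms by (auto elim: oddE)
  hence "of_nat CARD('b) = 2 * of_nat k + (1::'b)"
    by simp
  thus False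
    using * by (simp add: of_nat_card_field)
qed

text \<open>Elements cancel against their inverses; the induction removes one pair
  \<open>{x, inverse x}\<close> at a time.\<close>

lemma prod_inverse_closed:
  fixes S :: "'b::field set"
  assumes "finite S" "\<And>x. x \<in> S \<Longrightarrow> inverse x \<in> S \<and> x \<noteq> 0 \<and> inverse x \<noteq> x"
  shows "\<Prod>S = 1"
  using assms
proof (induction S rule: finite_psubset_induct)
  case (psubset S)
  show ?case
  proof (cases "S = {}")
    case False
    then obtain x where x: "x \<in> S"
      by blast
    let ?T = "S - {x, inverse x}"
    have x': "inverse x \<in> S" "x \<noteq> 0" "inverse x \<noteq> x"
      using psubset.prems[OF x] by auto
    have "\<Prod>?T = 1"
    proof (rule psubset.IH)
      show "?T \<subset> S"
        using x by auto
      show "inverse y \<in> ?T \<and> y \<noteq> 0 \<and> inverse y \<noteq> y" if "y \<in> ?T" for y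
        using psubset.prems[of y] that by auto
    qed
    moreover have "\<Prod>S = \<Prod>?T * \<Prod>{x, inverse x}"
      by (rule prod.subset_diff) (use x x' psubset.hyps in auto)
    moreover have "\<Prod>{x, inverse x} = 1"
      using x' by auto
    ultimately show ?thesis
      by simp
  qed auto
qed

text \<open>Wilson's theorem for finite fields: 1 and -1 are the only elements equal to their
  inverses, and all others cancel in pairs.\<close>

lemma prod_nonzero_eq_minus_one: "\<Prod>(UNIV - {0}) = (-1 :: 'b::{field,finite})"
proof -
  let ?T = "UNIV - {0, 1, -1} :: 'b set"
  have "\<Prod>?T = 1"
  proof (rule prod_inverse_closed)
    fix x :: 'b assume x: "x \<in> ?T"
    have "inverse x \<noteq> x"
    proof
      assume "inverse x = x"
      hence "x * x = 1"
        using x by (metis Diff_iff insertI1 right_inverse)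
      thus False
        using x by (auto simp: square_eq_1_iff)
    qed
    moreover have "inverse x \<noteq> -1"
      using x by (metis Diff_iff inverse_inverse_eq inverse_minus_eq inverse_1 insertCI)
    ultimately show "inverse x \<in> ?T \<and> x \<noteq> 0 \<and> inverse x \<noteq> x"
      using x by auto
  qed simp
  moreover have "\<Prod>(UNIV - {0::'b}) = \<Prod>?T * \<Prod>{1, -1}"
  proof -
    have "UNIV - {0::'b} - {1, -1} = ?T"
      by auto
    thus ?thesis
      using prod.subset_diff[of "{1, -1}" "UNIV - {0::'b}" "\<lambda>x. x"] by auto
  qed
  \<comment> \<open>If 1 = -1 the set is a singleton, and its product 1 is still -1.\<close>
  moreover have "\<Prod>{1, -1} = (-1 :: 'b)"
    by (cases "(1::'b) = -1") (simp_all add: prod.insert_if)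
  ultimately show ?thesis
    by simp
qed

section \<open>Arcs of vectors\<close>

definition det3 :: "'b::field ^ 3 \<Rightarrow> 'b ^ 3 \<Rightarrow> 'b ^ 3 \<Rightarrow> 'b" where
  "det3 x y z = x$1 * (y$2 * z$3 - y$3 * z$2) - x$2 * (y$1 * z$3 - y$3 * z$1)
                + x$3 * (y$1 * z$2 - y$2 * z$1)"

definition dot3 :: "'b::field ^ 3 \<Rightarrow> 'b ^ 3 \<Rightarrow> 'b" where
  "dot3 a x = a$1 * x$1 + a$2 * x$2 + a$3 * x$3"

text \<open>Arcs are handled through representing vectors, so that collinearity becomes a
  determinant. With at least three vectors, distinct vectors span distinct points.\<close>

definition vec_arc :: "('b::field ^ 3) set \<Rightarrow> bool" where
  "vec_arc X \<longleftrightarrow> (\<forall>x\<in>X. \<forall>y\<in>X. \<forall>z\<in>X. x \<noteq> y \<and> y \<noteq> z \<and> x \<noteq> z \<longrightarrow> det3 x y z \<noteq> 0)"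

text \<open>The zero form is included, so a conic is given by such a form together with a point
  where it does not vanish.\<close>

definition quadratic_form :: "('b::field ^ 3 \<Rightarrow> 'b) \<Rightarrow> bool" where
  "quadratic_form f \<longleftrightarrow> (\<exists>a b c d e g. \<forall>x. f x =
     a * x$1 * x$1 + b * x$2 * x$2 + c * x$3 * x$3 + d * x$1 * x$2 + e * x$1 * x$3 + g * x$2 * x$3)"

lemma dot3_add: "dot3 a (x + y) = dot3 a x + dot3 a y"
  and dot3_scale: "dot3 a (k *s x) = k * dot3 a x"
  and dot3_add_left: "dot3 (a + b) x = dot3 a x + dot3 b x"
  and dot3_diff: "dot3 a (x - y) = dot3 a x - dot3 a y"
  and dot3_scale_left: "dot3 (k *s a) x = k * dot3 a x"
  by (simp_all add: dot3_def algebra_simps)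

lemma vec3_eq_iff: "(x :: 'b ^ 3) = y \<longleftrightarrow> x$1 = y$1 \<and> x$2 = y$2 \<and> x$3 = y$3"
  by (simp add: vec_eq_iff forall_3)

text \<open>Cramer's rule with the denominator cleared, valid also for dependent \<open>x\<close>,
  \<open>y\<close>, \<open>z\<close>.\<close>

lemma det3_cramer:
  "det3 x y z *s w = det3 w y z *s x + det3 x w z *s y + det3 x y w *s z"
  by (simp add: det3_def vec3_eq_iff algebra_simps)

lemma dot3_cramer:
  "det3 x y z * dot3 a w = det3 w y z * dot3 a x + det3 x w z * dot3 a y + det3 x y w * dot3 a z"
  by (simp add: det3_def dot3_def algebra_simps)

lemma det3_swap23: "det3 x z y = - det3 x y z"
  and det3_rotate: "det3 y z x = det3 x y z"
  by (simp_all add: det3_def algebra_simps)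

lemma det3_same [simp]: "det3 x x y = 0" "det3 x y x = 0" "det3 y x x = 0"
  by (simp_all add: det3_def algebra_simps)

lemma det3_functional: "\<exists>a. \<forall>w. det3 w y z = dot3 a w"
proof
  show "\<forall>w. det3 w y z = dot3 (vector [y$2 * z$3 - y$3 * z$2, - (y$1 * z$3 - y$3 * z$1),
      y$1 * z$2 - y$2 * z$1]) w"
    by (simp add: det3_def dot3_def algebra_simps)
qed

lemma quadratic_form_mult: "quadratic_form (\<lambda>x. dot3 a x * dot3 b x)"
  unfolding quadratic_form_def dot3_def
  by (rule exI[of _ "a$1 * b$1"], rule exI[of _ "a$2 * b$2"], rule exI[of _ "a$3 * b$3"],
      rule exI[of _ "a$1 * b$2 + a$2 * b$1"], rule exI[of _ "a$1 * b$3 + a$3 * b$1"],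
      rule exI[of _ "a$2 * b$3 + a$3 * b$2"]) (simp add: algebra_simps)

lemma quadratic_form_add:
  assumes "quadratic_form f" "quadratic_form g"
  shows "quadratic_form (\<lambda>x. f x + g x)"
proof -
  obtain a b c d e k where f: "\<And>x. f x =
     a * x$1 * x$1 + b * x$2 * x$2 + c * x$3 * x$3 + d * x$1 * x$2 + e * x$1 * x$3 + k * x$2 * x$3"
    using assms(1) unfolding quadratic_form_def by blast
  obtain a' b' c' d' e' k' where g: "\<And>x. g x =
     a' * x$1 * x$1 + b' * x$2 * x$2 + c' * x$3 * x$3 + d' * x$1 * x$2 + e' * x$1 * x$3 + k' * x$2 * x$3"
    using assms(2) unfolding quadratic_form_def by blast
  show ?thesis
    unfolding quadratic_form_def
    by (rule exI[of _ "a + a'"], rule exI[of _ "b + b'"], rule exI[of _ "c + c'"],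
        rule exI[of _ "d + d'"], rule exI[of _ "e + e'"], rule exI[of _ "k + k'"])
       (simp add: f g algebra_simps)
qed

text \<open>
  The lines through \<open>x\<close> other than the one through \<open>y\<close> are parametrised by the ratios
  \<open>det3 x c y / det3 x c z\<close>, so these ratios are distinct for the points \<open>c\<close> of an arc.
\<close>

lemma arc_ratios:
  fixes X :: "('b::{field,finite} ^ 3) set"
  assumes X: "vec_arc X" and xyz: "x \<in> X" "y \<in> X" "z \<in> X" "x \<noteq> y" "y \<noteq> z" "x \<noteq> z"
  defines "R \<equiv> \<lambda>c. det3 x c y / det3 x c z"
  shows "inj_on R (X - {x, y, z})" "R ` (X - {x, y, z}) \<subseteq> UNIV - {0}"
proof -
  have nz: "det3 x c y \<noteq> 0" "det3 x c z \<noteq> 0" if "c \<in> X - {x, y, z}" for c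
    using X xyz that unfolding vec_arc_def by auto
  have xyz0: "det3 x y z \<noteq> 0"
    using X xyz unfolding vec_arc_def by auto
  show "R ` (X - {x, y, z}) \<subseteq> UNIV - {0}"
    using nz by (auto simp: R_def)
  show "inj_on R (X - {x, y, z})"
  proof (rule inj_onI)
    fix c d assume c: "c \<in> X - {x, y, z}" and d: "d \<in> X - {x, y, z}" and eq: "R c = R d"
    have "det3 x c y * det3 x d z = det3 x d y * det3 x c z"
      using eq nz[OF c] nz[OF d] by (simp add: R_def field_simps)
    \<comment> \<open>A Grassmann-Pluecker relation: modulo \<open>x\<close> this is the three-term
      identity for 2 by 2 determinants.\<close>
    moreover have "det3 x c y * det3 x d z - det3 x d y * det3 x c z = det3 x c d * det3 x y z"
      by (simp add: det3_def algebra_simps)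
    ultimately have "det3 x c d = 0"
      using xyz0 by auto
    thus "c = d"
      using X xyz(1) c d unfolding vec_arc_def by (metis Diff_iff insert_iff)
  qed
qed

lemma arc_card_diff:
  assumes "x \<in> X" "y \<in> X" "z \<in> X" "x \<noteq> y" "y \<noteq> z" "x \<noteq> z" "finite X"
  shows "card X = card (X - {x, y, z}) + 3"
proof -
  have "card (X - {x, y, z}) = card X - card {x, y, z}"
    by (rule card_Diff_subset) (use assms in auto)
  moreover have "card {x, y, z} \<le> card X"
    by (rule card_mono) (use assms in auto)
  ultimately show ?thesis
    using assms by simp
qed

lemma obtain_three:
  assumes "card X \<ge> 3"
  obtains x y z where "x \<in> X" "y \<in> X" "z \<in> X" "x \<noteq> y" "y \<noteq> z" "x \<noteq> z"
proof -
  obtain T where T: "T \<subseteq> X" "card T = 3"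
    using obtain_subset_with_card_n[OF assms] by blast
  then obtain x y z where "T = {x, y, z}" "x \<noteq> y" "y \<noteq> z" "x \<noteq> z"
    by (auto simp: card_3_iff)
  thus ?thesis
    using T that by auto
qed

text \<open>The sign decides the next arguments. With r odd and three points removed it is +1 for an
  arc of r + 2 points and -1 for an arc of r + 1 points.\<close>

lemma prod_det3_swap: "(\<Prod>c\<in>Y. det3 u c v) = (-1) ^ card Y * (\<Prod>c\<in>Y. det3 v c u)"
proof -
  have "(\<Prod>c\<in>Y. det3 u c v) = (\<Prod>c\<in>Y. (-1) * det3 v c u)"
    by (rule prod.cong) (simp_all add: det3_def algebra_simps)
  thus ?thesis
    by (simp only: prod.distrib prod_constant)
qed

lemma arc_prod_neq_0:
  fixes X :: "('b::{field,finite} ^ 3) set"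
  assumes X: "vec_arc X" and xyz: "x \<in> X" "y \<in> X" "z \<in> X" "x \<noteq> y" "y \<noteq> z" "x \<noteq> z"
    and uv: "u \<in> {x, y, z}" "v \<in> {x, y, z}" "u \<noteq> v"
  shows "(\<Prod>c\<in>X - {x, y, z}. det3 u c v) \<noteq> 0"
  using X xyz uv unfolding vec_arc_def by auto

text \<open>Bose's bound. In a larger arc the ratios at each point exhaust the nonzero elements, so
  Wilson's theorem gives \<open>P u v = - P u w\<close>. Going once around the triangle
  \<open>x\<close>, \<open>y\<close>, \<open>z\<close> with the symmetric \<open>P\<close> collects
  three signs and yields \<open>P x y = - P x y\<close>.\<close>

lemma arc_card_le:
  fixes X :: "('b::{field,finite} ^ 3) set"
  assumes odd: "odd CARD('b)" and X: "vec_arc X"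
  shows "card X \<le> CARD('b) + 1"
proof (rule ccontr)
  assume *: "\<not> card X \<le> CARD('b) + 1"
  have "CARD('b) \<ge> 2"
    using two_le_card_field[where 'b = 'b] by simp
  then obtain x y z where xyz: "x \<in> X" "y \<in> X" "z \<in> X" "x \<noteq> y" "y \<noteq> z" "x \<noteq> z"
    using obtain_three[of X] * by auto
  let ?Y = "X - {x, y, z}"
  define P where "P = (\<lambda>u v. \<Prod>c\<in>?Y. det3 u c v)"
  have card: "card X = card ?Y + 3"
    using arc_card_diff[OF xyz] by simp
  have cU: "card (UNIV - {0::'b}) = CARD('b) - 1"
    by (simp add: card_Diff_subset)
  have ratio: "card ?Y = CARD('b) - 1 \<and> P u v = - P u w"
    if "u \<in> X" "v \<in> X" "w \<in> X" "u \<noteq> v" "v \<noteq> w" "u \<noteq> w" "{u, v, w} = {x, y, z}" for u v w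
  proof -
    define R where "R = (\<lambda>c. det3 u c v / det3 u c w)"
    have inj: "inj_on R ?Y" and sub: "R ` ?Y \<subseteq> UNIV - {0}"
      using arc_ratios[OF X that(1-6)] that(7) unfolding R_def by auto
    have eq: "R ` ?Y = UNIV - {0}"
      by (rule card_seteq) (use sub inj * card cU in \<open>auto simp: card_image\<close>)
    have "P u v / P u w = (\<Prod>c\<in>?Y. R c)"
      by (simp add: P_def R_def prod_dividef)
    also have "\<dots> = \<Prod>(R ` ?Y)"
      using inj by (simp add: prod.reindex)
    also have "\<dots> = -1"
      using eq prod_nonzero_eq_minus_one by simp
    finally have "P u v / P u w = -1" .
    moreover have "P u w \<noteq> 0"
      using calculation by auto
    moreover have "card ?Y = CARD('b) - 1"
      using card_image[OF inj] eq cU by simp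
    ultimately show ?thesis
      by (simp add: field_simps)
  qed
  have c: "even (card ?Y)"
    using ratio[OF xyz] odd by simp
  have sym: "P u v = P v u" for u v
    using prod_det3_swap[of u v ?Y] c by (simp add: P_def)
  have "P x y = - P x z" "P y z = - P y x" "P z x = - P z y"
    using ratio[OF xyz] ratio[of y z x] ratio[of z x y] xyz by auto
  hence "P x y = - P x y"
    using sym[of x y] sym[of y z] sym[of z x] by simp
  hence "2 * P x y = 0"
    by (metis mult_2 add.right_inverse)
  moreover have "P x y \<noteq> 0"
    unfolding P_def by (rule arc_prod_neq_0[OF X xyz]) (use xyz in auto)
  ultimately show False
    using two_neq_zero[OF odd] by simp
qed

section \<open>Segre's theorem\<close>

text \<open>A tangent line is given by a functional and thus only up to a factor; this freedom is
  what \<open>segre\<close> exploits.\<close>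

definition tangent_at :: "('b::field ^ 3) set \<Rightarrow> 'b ^ 3 \<Rightarrow> 'b ^ 3 \<Rightarrow> bool" where
  "tangent_at X x a \<longleftrightarrow> dot3 a x = 0 \<and> (\<forall>c\<in>X. c \<noteq> x \<longrightarrow> dot3 a c \<noteq> 0)"

lemma tangent_exists:
  fixes X :: "('b::{field,finite} ^ 3) set"
  assumes X: "vec_arc X" and card: "card X = CARD('b) + 1" and x: "x \<in> X"
  shows "\<exists>a. tangent_at X x a"
proof -
  have 2: "CARD('b) \<ge> 2"
    using two_le_card_field[where 'b = 'b] by simp
  have "2 \<le> card (X - {x})"
    using card x 2 by simp
  from obtain_subset_with_card_n[OF this] obtain T where "T \<subseteq> X - {x}" "card T = 2"
    by blast
  then obtain y z where xyz: "x \<in> X" "y \<in> X" "z \<in> X" "x \<noteq> y" "y \<noteq> z" "x \<noteq> z"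
    using x by (auto simp: card_2_iff)
  let ?Y = "X - {x, y, z}"
  define R where "R = (\<lambda>c. det3 x c y / det3 x c z)"
  have inj: "inj_on R ?Y" and sub: "R ` ?Y \<subseteq> UNIV - {0}"
    using arc_ratios[OF X xyz] unfolding R_def by auto
  have "card (R ` ?Y) < card (UNIV - {0::'b})"
    using card_image[OF inj] arc_card_diff[OF xyz] card 2 by simp
  then obtain k where k: "k \<noteq> 0" "k \<notin> R ` ?Y"
    using sub by (metis Diff_iff UNIV_I card_mono finite not_less subsetI singletonI)
  obtain a where a: "\<And>w. det3 w y x = dot3 a w"
    using det3_functional by metis
  obtain b where b: "\<And>w. det3 w z x = dot3 b w"
    using det3_functional by metis
  define t where "t = a - k *s b"
  have t: "dot3 t w = det3 x w y - k * det3 x w z" for w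
  proof -
    have "dot3 t w = dot3 a w - k * dot3 b w"
      by (simp add: t_def dot3_def algebra_simps)
    thus ?thesis
      by (simp add: a[symmetric] b[symmetric] det3_rotate[of w _ x])
  qed
  have xyz0: "det3 x y z \<noteq> 0" "det3 x z y \<noteq> 0"
    using X xyz unfolding vec_arc_def by auto
  have "tangent_at X x t"
    unfolding tangent_at_def
  proof (intro conjI ballI impI)
    show "dot3 t x = 0"
      by (simp add: t)
    fix c assume c: "c \<in> X" "c \<noteq> x"
    consider "c = y" | "c = z" | "c \<in> ?Y"
      using c by auto
    thus "dot3 t c \<noteq> 0"
    proof cases
      case 3
      hence "det3 x c z \<noteq> 0"
        using X xyz unfolding vec_arc_def by auto
      hence "k = R c" if "dot3 t c = 0"
        using that by (simp add: t R_def)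
      thus ?thesis
        using k 3 by blast
    qed (use xyz0 k in \<open>auto simp: t\<close>)
  qed
  thus ?thesis
    by blast
qed

text \<open>The ratio \<open>k\<close> of the tangent is the one missing from the ratios of the arc,
  so Wilson's theorem reads \<open>-1 = k\<close> times the product of those ratios.\<close>

lemma tangent_prod:
  fixes X :: "('b::{field,finite} ^ 3) set"
  assumes X: "vec_arc X" and card: "card X = CARD('b) + 1"
    and xyz: "x \<in> X" "y \<in> X" "z \<in> X" "x \<noteq> y" "y \<noteq> z" "x \<noteq> z"
    and a: "tangent_at X x a"
  shows "dot3 a y * (\<Prod>c\<in>X - {x, y, z}. det3 x c y) = - dot3 a z * (\<Prod>c\<in>X - {x, y, z}. det3 x c z)"
proof -
  let ?Y = "X - {x, y, z}"
  define R where "R = (\<lambda>c. det3 x c y / det3 x c z)"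
  define k where "k = dot3 a y / dot3 a z"
  have inj: "inj_on R ?Y" and sub: "R ` ?Y \<subseteq> UNIV - {0}"
    using arc_ratios[OF X xyz] unfolding R_def by auto
  have a0: "dot3 a x = 0" "dot3 a y \<noteq> 0" "dot3 a z \<noteq> 0"
    using a xyz unfolding tangent_at_def by auto
  have xyz0: "det3 x y z \<noteq> 0"
    using X xyz unfolding vec_arc_def by auto
  have k: "k \<notin> R ` ?Y"
  proof
    assume "k \<in> R ` ?Y"
    then obtain c where c: "c \<in> ?Y" "k = R c"
      by blast
    have "det3 x c z \<noteq> 0"
      using X xyz c unfolding vec_arc_def by auto
    hence "dot3 a y * det3 x c z = dot3 a z * det3 x c y"
      using c a0 by (simp add: k_def R_def field_simps)
    moreover have "det3 x y z * dot3 a c = det3 x c z * dot3 a y - det3 x c y * dot3 a z"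
      by (subst dot3_cramer) (simp add: a0 det3_swap23[of x y c])
    ultimately have "dot3 a c = 0"
      using xyz0 by (simp add: mult.commute)
    thus False
      using a c unfolding tangent_at_def by auto
  qed
  have "2 \<le> CARD('b)"
    using two_le_card_field[where 'b = 'b] by simp
  have "insert k (R ` ?Y) = UNIV - {0}"
  proof (rule card_seteq)
    show "insert k (R ` ?Y) \<subseteq> UNIV - {0}"
      using sub a0 by (auto simp: k_def)
    have "card (insert k (R ` ?Y)) = card ?Y + 1"
      using k card_image[OF inj] by simp
    thus "card (UNIV - {0::'b}) \<le> card (insert k (R ` ?Y))"
      using arc_card_diff[OF xyz] card \<open>2 \<le> CARD('b)\<close> by simp
  qed simp
  moreover have "\<Prod>(insert k (R ` ?Y)) = k * \<Prod>(R ` ?Y)"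
    by (rule prod.insert) (use k in auto)
  ultimately have "-1 = k * \<Prod>(R ` ?Y)"
    using prod_nonzero_eq_minus_one[where 'b = 'b] by simp
  also have "\<Prod>(R ` ?Y) = (\<Prod>c\<in>?Y. R c)"
    using inj by (simp add: prod.reindex)
  also have "\<dots> = (\<Prod>c\<in>?Y. det3 x c y) / (\<Prod>c\<in>?Y. det3 x c z)"
    by (simp add: R_def prod_dividef)
  finally have "-1 = k * ((\<Prod>c\<in>?Y. det3 x c y) / (\<Prod>c\<in>?Y. det3 x c z))" .
  moreover have "(\<Prod>c\<in>?Y. det3 x c z) \<noteq> 0"
    by (rule arc_prod_neq_0[OF X xyz]) (use xyz in auto)
  ultimately show ?thesis
    using a0 unfolding k_def by (simp add: field_simps)
qed

text \<open>Multiply the relations of \<open>tangent_prod\<close> at \<open>x\<close>,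
  \<open>y\<close> and \<open>z\<close>. The three minus signs in them cancel against the three from
  the antisymmetry of \<open>P\<close>, which holds as r - 2 is odd.\<close>

lemma lemma_of_tangents:
  fixes X :: "('b::{field,finite} ^ 3) set"
  assumes odd: "odd CARD('b)" and X: "vec_arc X" and card: "card X = CARD('b) + 1"
    and xyz: "x \<in> X" "y \<in> X" "z \<in> X" "x \<noteq> y" "y \<noteq> z" "x \<noteq> z"
    and t: "tangent_at X x a" "tangent_at X y b" "tangent_at X z c"
  shows "dot3 a y * dot3 b z * dot3 c x = dot3 a z * dot3 b x * dot3 c y"
proof -
  let ?Y = "X - {x, y, z}"
  define P where "P = (\<lambda>u v. \<Prod>c\<in>?Y. det3 u c v)"
  have "odd (card ?Y)"
    using arc_card_diff[OF xyz] card odd by (metis add.commute even_add finite odd_numeral odd_one)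
  hence anti: "P u v = - P v u" for u v
    using prod_det3_swap[of u v ?Y] by (simp add: P_def)
  have Y: "X - {y, z, x} = ?Y" "X - {z, x, y} = ?Y"
    by auto
  have 1: "dot3 a y * P x y = - dot3 a z * P x z"
    using tangent_prod[OF X card xyz t(1)] by (simp add: P_def)
  have 2: "dot3 b z * P y z = - dot3 b x * P y x"
    using tangent_prod[OF X card xyz(2,3,1) _ _ _ t(2)] xyz Y by (simp add: P_def)
  have 3: "dot3 c x * P z x = - dot3 c y * P z y"
    using tangent_prod[OF X card xyz(3,1,2) _ _ _ t(3)] xyz Y by (simp add: P_def)
  have nz: "P x y \<noteq> 0" "P y z \<noteq> 0" "P z x \<noteq> 0"
    unfolding P_def by (rule arc_prod_neq_0[OF X xyz]; use xyz in auto)+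
  have "dot3 a y * dot3 b z * dot3 c x * (P x y * P y z * P z x)
      = (dot3 a y * P x y) * (dot3 b z * P y z) * (dot3 c x * P z x)"
    by (simp add: algebra_simps)
  also have "\<dots> = - (dot3 a z * dot3 b x * dot3 c y) * (P x z * P y x * P z y)"
    unfolding 1 2 3 by (simp add: algebra_simps)
  also have "\<dots> = dot3 a z * dot3 b x * dot3 c y * (P x y * P y z * P z x)"
    by (subst anti[of x z], subst anti[of y x], subst anti[of z y]) (simp add: algebra_simps)
  finally show ?thesis
    using nz by simp
qed

text \<open>
  By the lemma of tangents the tangents can be scaled such that \<open>f\<^sub>x(y) = f\<^sub>y(x)\<close> on the arc.
  Expanding \<open>f\<^sub>y\<close> in a basis consisting of points of the arc, the equation \<open>f\<^sub>y(y) = 0\<close> then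
  becomes quadratic in \<open>y\<close>.
\<close>

theorem segre:
  fixes X :: "('b::{field,finite} ^ 3) set"
  assumes odd: "odd CARD('b)" and X: "vec_arc X" and card: "card X = CARD('b) + 1"
  shows "\<exists>f. quadratic_form f \<and> (\<exists>x. f x \<noteq> 0) \<and> (\<forall>x\<in>X. f x = 0)"
proof -
  have "2 \<le> CARD('b)"
    using two_le_card_field[where 'b = 'b] by simp
  then obtain x y z where xyz: "x \<in> X" "y \<in> X" "z \<in> X" "x \<noteq> y" "y \<noteq> z" "x \<noteq> z"
    using obtain_three[of X] card by auto
  obtain t where t: "\<And>u. u \<in> X \<Longrightarrow> tangent_at X u (t u)"
    using tangent_exists[OF X card] by metis
  \<comment> \<open>Each tangent is scaled to be symmetric with the tangent at \<open>x\<close>; the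
    lemma of tangents then carries the symmetry over to all other pairs.\<close>
  define g where "g = (\<lambda>u. if u = x then t u else (dot3 (t x) u / dot3 (t u) x) *s t u)"
  have nz: "dot3 (t u) v \<noteq> 0" if "u \<in> X" "v \<in> X" "u \<noteq> v" for u v
    using t that unfolding tangent_at_def by auto
  have g: "tangent_at X u (g u)" if u: "u \<in> X" for u
    using t[OF u] nz[OF u xyz(1)] nz[OF xyz(1) u] unfolding g_def tangent_at_def
    by (auto simp: dot3_scale_left)
  have symx: "dot3 (g u) x = dot3 (g x) u" if u: "u \<in> X" for u
    using nz[OF u xyz(1)] by (auto simp: g_def dot3_scale_left)
  have sym: "dot3 (g u) v = dot3 (g v) u" if u: "u \<in> X" "v \<in> X" for u v
  proof (cases "u = x \<or> v = x \<or> u = v")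
    case True
    thus ?thesis
      using symx u by metis
  next
    case False
    hence "dot3 (g x) u * dot3 (g u) v * dot3 (g v) x = dot3 (g x) v * dot3 (g u) x * dot3 (g v) u"
      using lemma_of_tangents[OF odd X card xyz(1) u _ _ _ g[OF xyz(1)] g[OF u(1)] g[OF u(2)]] by auto
    moreover have "dot3 (g x) u \<noteq> 0" "dot3 (g x) v \<noteq> 0"
      using g[OF xyz(1)] u False unfolding tangent_at_def by auto
    ultimately show ?thesis
      using symx[OF u(1)] symx[OF u(2)] by simp
  qed
  obtain a where a: "\<And>w. det3 w y z = dot3 a w"
    using det3_functional by metis
  obtain b where b: "\<And>w. det3 w z x = dot3 b w"
    using det3_functional by metis
  obtain c where c: "\<And>w. det3 w x y = dot3 c w"
    using det3_functional by metis
  define f where "f = (\<lambda>w. dot3 a w * dot3 (g x) w + dot3 b w * dot3 (g y) w + dot3 c w * dot3 (g z) w)"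
  have f: "f w = det3 w y z * dot3 (g x) w + det3 x w z * dot3 (g y) w + det3 x y w * dot3 (g z) w" for w
  proof -
    have "det3 w z x = det3 x w z" "det3 w x y = det3 x y w"
      by (simp_all add: det3_def algebra_simps)
    thus ?thesis
      by (simp add: f_def flip: a b c)
  qed
  have "quadratic_form f"
    unfolding f_def by (intro quadratic_form_add quadratic_form_mult)
  \<comment> \<open>At \<open>x + y\<close> only the mixed term survives, and symmetry doubles it;
    odd characteristic keeps it nonzero.\<close>
  moreover have "f (x + y) \<noteq> 0"
  proof -
    have "f (x + y) = det3 x y z * (dot3 (g x) y + dot3 (g y) x)"
      using g[OF xyz(1)] g[OF xyz(2)]
      by (simp add: f dot3_add tangent_at_def) (simp add: det3_def algebra_simps)
    also have "\<dots> = 2 * det3 x y z * dot3 (g x) y"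
      by (simp add: sym xyz)
    finally show ?thesis
      using two_neq_zero[OF odd] X xyz g[OF xyz(1)] unfolding vec_arc_def tangent_at_def by auto
  qed
  moreover have "f u = 0" if u: "u \<in> X" for u
  proof -
    have "f u = det3 u y z * dot3 (g u) x + det3 x u z * dot3 (g u) y + det3 x y u * dot3 (g u) z"
      by (simp add: f sym u xyz)
    also have "\<dots> = det3 x y z * dot3 (g u) u"
      by (rule dot3_cramer[symmetric])
    finally show ?thesis
      using g[OF u] by (simp add: tangent_at_def)
  qed
  ultimately show ?thesis
    by blast
qed

section \<open>Arcs of points\<close>

lemma proj_point_iff:
  "P \<in> proj_subspaces 0 \<longleftrightarrow> (\<exists>u. u \<noteq> 0 \<and> P = vec.span {u :: 'a::field ^ 'd})"
proof
  assume "P \<in> proj_subspaces 0"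
  hence P: "vec.subspace P" "vec.dim P = 1"
    by (auto simp: proj_subspaces_def)
  obtain B where B: "B \<subseteq> P" "vec.independent B" "P \<subseteq> vec.span B" "card B = vec.dim P"
    using vec.basis_exists by metis
  obtain u where u: "B = {u}"
    using B P by (auto simp: card_1_singleton_iff)
  have "P = vec.span {u}"
    using B P u by (metis vec.span_minimal subset_antisym)
  moreover have "u \<noteq> 0"
    using B u vec.dependent_zero by blast
  ultimately show "\<exists>u. u \<noteq> 0 \<and> P = vec.span {u}"
    by blast
next
  assume "\<exists>u. u \<noteq> 0 \<and> P = vec.span {u}"
  thus "P \<in> proj_subspaces 0"
    by (auto simp: proj_subspaces_def vec.dim_singleton)
qed

lemma mem_span_pair: "x \<in> vec.span {u, v} \<longleftrightarrow> (\<exists>k l. x = k *s u + l *s (v :: 'a::field ^ 'd))"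
proof
  assume "x \<in> vec.span {u, v}"
  then obtain k where "x - k *s u \<in> vec.span {v}"
    using vec.span_breakdown_eq by blast
  then obtain l where "x - k *s u = l *s v"
    by (auto simp: vec.span_singleton)
  thus "\<exists>k l. x = k *s u + l *s v"
    by (metis add.commute diff_add_cancel)
next
  assume "\<exists>k l. x = k *s u + l *s v"
  moreover have "u \<in> vec.span {u, v}" "v \<in> vec.span {u, v}"
    by (simp_all add: vec.span_base)
  ultimately show "x \<in> vec.span {u, v}"
    by (auto intro: vec.span_add vec.span_scale)
qed

lemma span_singleton_eqI:
  assumes "v = k *s u" "k \<noteq> (0::'a::field)"
  shows "vec.span {v} = vec.span {u :: 'a ^ 'd}"
proof -
  have "u = inverse k *s v"
    using assms by simp
  hence "u \<in> vec.span {v}" "v \<in> vec.span {u}"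
    using assms(1) by (metis vec.span_scale vec.span_base singletonI)+
  thus ?thesis
    by (simp add: vec.span_eq)
qed

lemma det3_add: "det3 (a + b) y z = det3 a y z + det3 b y z"
    "det3 x (a + b) z = det3 x a z + det3 x b z" "det3 x y (a + b) = det3 x y a + det3 x y b"
  and det3_scale: "det3 (k *s x) y z = k * det3 x y z" "det3 x (k *s y) z = k * det3 x y z"
    "det3 x y (k *s z) = k * det3 x y z"
  by (simp_all add: det3_def algebra_simps)

text \<open>If \<open>det3 u v\<close> vanished identically, the cross product would be zero and
  \<open>u\<close>, \<open>v\<close> proportional. So some \<open>e\<close> completes them to a
  basis, and Cramer's rule shows that \<open>w\<close> has no \<open>e\<close>-component.\<close>

lemma det3_zero_mem_span:
  assumes "u \<noteq> 0" "v \<noteq> 0" "vec.span {u} \<noteq> vec.span {v :: 'b::field ^ 3}" "det3 u v w = 0"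
  shows "w \<in> vec.span {u, v}"
proof -
  have "\<exists>e. det3 u v e \<noteq> 0"
  proof (rule ccontr)
    assume "\<not> (\<exists>e. det3 u v e \<noteq> 0)"
    hence *: "det3 u v (vector [1, 0, 0]) = 0" "det3 u v (vector [0, 1, 0]) = 0"
        "det3 u v (vector [0, 0, 1]) = 0"
      by auto
    hence cross: "u$2 * v$3 = u$3 * v$2" "u$1 * v$3 = u$3 * v$1" "u$1 * v$2 = u$2 * v$1"
      by (auto simp: det3_def)
    have "\<exists>k. v = k *s u"
    proof -
      consider "u$1 \<noteq> 0" | "u$2 \<noteq> 0" | "u$3 \<noteq> 0"
        using \<open>u \<noteq> 0\<close> by (auto simp: vec3_eq_iff)
      thus ?thesis
      proof cases
        case 1
        hence "v = (v$1 / u$1) *s u"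
          using cross by (simp add: vec3_eq_iff field_simps)
        thus ?thesis ..
      next
        case 2
        hence "v = (v$2 / u$2) *s u"
          using cross by (simp add: vec3_eq_iff field_simps)
        thus ?thesis ..
      next
        case 3
        hence "v = (v$3 / u$3) *s u"
          using cross by (simp add: vec3_eq_iff field_simps)
        thus ?thesis ..
      qed
    qed
    then obtain k where "v = k *s u" ..
    thus False
      using span_singleton_eqI[of v k u] assms by auto
  qed
  then obtain e where e: "det3 u v e \<noteq> 0" ..
  have "det3 u v e *s w = det3 w v e *s u + det3 u w e *s v"
    using det3_cramer[of u v e w] assms by simp
  hence "inverse (det3 u v e) *s (det3 u v e *s w) \<in> vec.span {u, v}"
    by (metis mem_span_pair vec.span_scale)
  thus ?thesis
    using e by simp
qed

lemma collinear_iff_det3: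
  fixes u v w :: "'b::field ^ 3"
  assumes nz: "u \<noteq> 0" "v \<noteq> 0" and ne: "vec.span {u} \<noteq> vec.span {v}"
  shows "(\<exists>l\<in>proj_subspaces 1. vec.span {u} \<subseteq> l \<and> vec.span {v} \<subseteq> l \<and> vec.span {w} \<subseteq> l)
    \<longleftrightarrow> det3 u v w = 0"
proof
  assume "\<exists>l\<in>proj_subspaces 1. vec.span {u} \<subseteq> l \<and> vec.span {v} \<subseteq> l \<and> vec.span {w} \<subseteq> l"
  then obtain l where l: "vec.subspace l" "vec.dim l = 2" "vec.span {u} \<subseteq> l" "vec.span {v} \<subseteq> l"
      "vec.span {w} \<subseteq> l"
    by (auto simp: proj_subspaces_def)
  obtain B where B: "B \<subseteq> l" "vec.independent B" "l \<subseteq> vec.span B" "card B = vec.dim l"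
    using vec.basis_exists by metis
  obtain a b where "B = {a, b}"
    using B l by (auto simp: card_2_iff)
  hence "u \<in> vec.span {a, b}" "v \<in> vec.span {a, b}" "w \<in> vec.span {a, b}"
    using B l vec.span_base by blast+
  then obtain k1 l1 k2 l2 k3 l3 where
    "u = k1 *s a + l1 *s b" "v = k2 *s a + l2 *s b" "w = k3 *s a + l3 *s b"
    unfolding mem_span_pair by blast
  thus "det3 u v w = 0"
    by (simp add: det3_add det3_scale)
next
  assume "det3 u v w = 0"
  hence w: "w \<in> vec.span {u, v}"
    using det3_zero_mem_span assms by blast
  have "v \<notin> vec.span {u}"
    using ne nz span_singleton_eqI[of v _ u] by (auto simp: vec.span_singleton)
  hence "vec.independent {v, u}" "v \<noteq> u"
    using nz by (auto simp: vec.independent_insert vec.span_base)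
  hence "vec.dim (vec.span {u, v}) = 2"
    by (simp add: vec.dim_eq_card_independent insert_commute)
  hence "vec.span {u, v} \<in> proj_subspaces 1"
    by (simp add: proj_subspaces_def)
  moreover have "vec.span {x} \<subseteq> vec.span {u, v}" if "x \<in> vec.span {u, v}" for x
    using that by (simp add: vec.span_minimal)
  ultimately show "\<exists>l\<in>proj_subspaces 1. vec.span {u} \<subseteq> l \<and> vec.span {v} \<subseteq> l \<and> vec.span {w} \<subseteq> l"
    using w by (intro bexI[of _ "vec.span {u, v}"]) (auto intro: vec.span_base)
qed

text \<open>The bridge between the incidence definition of the statement and determinants; rescaling
  representatives does not affect whether a determinant vanishes, so any choice \<open>g\<close>
  will do.\<close>

lemma is_arc_iff_vec_arc:
  fixes g :: "('b::field ^ 3) set \<Rightarrow> 'b ^ 3"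
  assumes g: "\<And>P. P \<in> A \<Longrightarrow> g P \<noteq> 0 \<and> vec.span {g P} = P"
  shows "is_arc A \<longleftrightarrow> vec_arc (g ` A)"
proof -
  have "A \<subseteq> proj_subspaces 0"
    using g proj_point_iff by blast
  hence "is_arc A \<longleftrightarrow> (\<forall>x\<in>A. \<forall>y\<in>A. \<forall>z\<in>A. x \<noteq> y \<and> y \<noteq> z \<and> x \<noteq> z \<longrightarrow> det3 (g x) (g y) (g z) \<noteq> 0)"
  proof -
    have "(\<exists>l\<in>proj_subspaces 1. x \<subseteq> l \<and> y \<subseteq> l \<and> z \<subseteq> l) \<longleftrightarrow> det3 (g x) (g y) (g z) = 0"
      if "x \<in> A" "y \<in> A" "z \<in> A" "x \<noteq> y" for x y z
      using collinear_iff_det3[of "g x" "g y" "g z"] g that by metis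
    note key = this
    show ?thesis
    proof
      assume arc: "is_arc A"
      show "\<forall>x\<in>A. \<forall>y\<in>A. \<forall>z\<in>A. x \<noteq> y \<and> y \<noteq> z \<and> x \<noteq> z \<longrightarrow> det3 (g x) (g y) (g z) \<noteq> 0"
      proof (intro ballI impI)
        fix x y z assume *: "x \<in> A" "y \<in> A" "z \<in> A" "x \<noteq> y \<and> y \<noteq> z \<and> x \<noteq> z"
        hence "\<not> (\<exists>l\<in>proj_subspaces 1. x \<subseteq> l \<and> y \<subseteq> l \<and> z \<subseteq> l)"
          using arc unfolding is_arc_def by metis
        thus "det3 (g x) (g y) (g z) \<noteq> 0"
          using key[of x y z] * by metis
      qed
    next
      assume det: "\<forall>x\<in>A. \<forall>y\<in>A. \<forall>z\<in>A. x \<noteq> y \<and> y \<noteq> z \<and> x \<noteq> z \<longrightarrow> det3 (g x) (g y) (g z) \<noteq> 0"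
      show "is_arc A"
        unfolding is_arc_def
      proof (intro conjI ballI impI)
        fix x y z assume *: "x \<in> A" "y \<in> A" "z \<in> A" "x \<noteq> y \<and> y \<noteq> z \<and> x \<noteq> z"
        hence "det3 (g x) (g y) (g z) \<noteq> 0"
          using det by metis
        thus "\<not> (\<exists>l\<in>proj_subspaces 1. x \<subseteq> l \<and> y \<subseteq> l \<and> z \<subseteq> l)"
          using key[of x y z] * by metis
      qed (rule \<open>A \<subseteq> proj_subspaces 0\<close>)
    qed
  qed
  moreover have "g x = g y \<longleftrightarrow> x = y" if "x \<in> A" "y \<in> A" for x y
    using g[OF that(1)] g[OF that(2)] by metis
  ultimately show ?thesis
    unfolding vec_arc_def by simp
qed

lemma vec_arc_insert:
  assumes X: "vec_arc X" and u: "\<And>x y. x \<in> X \<Longrightarrow> y \<in> X \<Longrightarrow> x \<noteq> y \<Longrightarrow> det3 u x y \<noteq> 0"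
  shows "vec_arc (insert u X)"
  unfolding vec_arc_def
proof (intro ballI impI)
  fix x y z assume xyz: "x \<in> insert u X" "y \<in> insert u X" "z \<in> insert u X" "x \<noteq> y \<and> y \<noteq> z \<and> x \<noteq> z"
  have rot: "det3 y z x = det3 x y z" "det3 z x y = det3 x y z"
    by (simp_all add: det3_def algebra_simps)
  consider "x = u" | "y = u" | "z = u" | "x \<in> X" "y \<in> X" "z \<in> X"
    using xyz by blast
  thus "det3 x y z \<noteq> 0"
  proof cases
    case 1
    thus ?thesis
      using xyz u by auto
  next
    case 2
    hence "det3 y z x \<noteq> 0"
      using xyz u by auto
    thus ?thesis
      by (simp add: rot)
  next
    case 3
    hence "det3 z x y \<noteq> 0"
      using xyz u by auto
    thus ?thesis
      by (simp add: rot)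
  next
    case 4
    thus ?thesis
      using xyz X unfolding vec_arc_def by blast
  qed
qed

lemma arc_representatives:
  assumes "is_arc A"
  shows "\<exists>g. (\<forall>P\<in>A. g P \<noteq> 0 \<and> vec.span {g P} = P) \<and> vec_arc (g ` A) \<and> inj_on g A"
proof -
  have "\<forall>P\<in>A. \<exists>u. u \<noteq> 0 \<and> vec.span {u} = P"
  proof
    fix P assume "P \<in> A"
    hence "P \<in> proj_subspaces 0"
      using assms by (auto simp: is_arc_def)
    thus "\<exists>u. u \<noteq> 0 \<and> vec.span {u} = P"
      unfolding proj_point_iff by metis
  qed
  from bchoice[OF this] obtain g where "\<forall>P\<in>A. g P \<noteq> 0 \<and> vec.span {g P} = P" ..
  hence g: "\<And>P. P \<in> A \<Longrightarrow> g P \<noteq> 0 \<and> vec.span {g P} = P"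
    by blast
  moreover have "inj_on g A"
    using g by (metis inj_onI)
  ultimately show ?thesis
    using is_arc_iff_vec_arc[of A g] assms by blast
qed

text \<open>There is always a third vector to form a determinant with, and that determinant would
  vanish for the zero vector or for two proportional vectors.\<close>

lemma vec_arc_nonzero_inj:
  assumes X: "vec_arc (X :: ('b::field ^ 3) set)" and "card X \<ge> 3"
  shows "x \<in> X \<Longrightarrow> x \<noteq> 0" "inj_on (\<lambda>x. vec.span {x}) X"
proof -
  have third: "\<exists>z\<in>X. z \<noteq> x \<and> z \<noteq> y" for x y
  proof (rule ccontr)
    assume "\<not> (\<exists>z\<in>X. z \<noteq> x \<and> z \<noteq> y)"
    hence "X \<subseteq> {x, y}"
      by auto
    hence "card X \<le> card {x, y}"
      by (simp add: card_mono)
    also have "\<dots> \<le> 2"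
      by (simp add: card_insert_if)
    finally show False
      using assms by simp
  qed
  show nz: "x \<noteq> 0" if "x \<in> X" for x
  proof -
    obtain y z where "y \<in> X" "y \<noteq> x" "z \<in> X" "z \<noteq> x" "z \<noteq> y"
      using third[of x x] third by metis
    hence "det3 x y z \<noteq> 0"
      using X that unfolding vec_arc_def by metis
    thus ?thesis
      by (auto simp: det3_def)
  qed
  show "inj_on (\<lambda>x. vec.span {x}) X"
  proof (rule inj_onI, rule ccontr)
    fix x y assume xy: "x \<in> X" "y \<in> X" "vec.span {x} = vec.span {y}" "x \<noteq> y"
    obtain z where "z \<in> X" "z \<noteq> x" "z \<noteq> y"
      using third by blast
    hence "det3 x y z \<noteq> 0"
      using X xy unfolding vec_arc_def by metis
    moreover have "y \<in> vec.span {x}"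
      using xy by (simp add: vec.span_base)
    ultimately show False
      by (auto simp: vec.span_singleton det3_scale)
  qed
qed

lemma vec_arc_imp_is_arc:
  assumes X: "vec_arc (X :: ('b::field ^ 3) set)" and "card X \<ge> 3"
  shows "is_arc ((\<lambda>x. vec.span {x}) ` X)" "card ((\<lambda>x. vec.span {x}) ` X) = card X"
proof -
  let ?f = "\<lambda>x :: 'b ^ 3. vec.span {x}"
  have inj: "inj_on ?f X" and nz: "\<And>x. x \<in> X \<Longrightarrow> x \<noteq> 0"
    using vec_arc_nonzero_inj[OF assms] by blast+
  have "is_arc (?f ` X) \<longleftrightarrow> vec_arc (inv_into X ?f ` ?f ` X)"
    by (rule is_arc_iff_vec_arc) (use nz in \<open>auto simp: inv_into_f_f[OF inj]\<close>)
  moreover have "inv_into X ?f ` ?f ` X = X"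
    using inj by (simp add: inv_into_image_cancel)
  ultimately show "is_arc (?f ` X)"
    using X by simp
  show "card (?f ` X) = card X"
    using inj by (rule card_image)
qed

section \<open>Large arcs\<close>

text \<open>The standard conic, with equation \<open>x$2 * x$2 = x$1 * x$3\<close>, parametrised by
  the projective line; \<open>None\<close> is the parameter at infinity.\<close>

definition veronese :: "'b::field option \<Rightarrow> 'b ^ 3" where
  "veronese \<tau> = (case \<tau> of Some t \<Rightarrow> vector [1, t, t * t] | None \<Rightarrow> vector [0, 0, 1])"

text \<open>A Vandermonde determinant, which becomes a difference of the two finite parameters, up
  to sign, when the third one is infinite.\<close>

lemma det3_veronese:
  fixes a b c :: "'b::field option"
  assumes "a \<noteq> b" "b \<noteq> c" "a \<noteq> c"
  shows "det3 (veronese a) (veronese b) (veronese c) \<noteq> 0"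
proof -
  have vdm: "det3 (veronese (Some a)) (veronese (Some b)) (veronese (Some c)) = (b - a) * (c - a) * (c - b)"
    and 1: "det3 (veronese None) (veronese (Some b)) (veronese (Some c)) = c - b"
    and 2: "det3 (veronese (Some a)) (veronese None) (veronese (Some c)) = a - c"
    and 3: "det3 (veronese (Some a)) (veronese (Some b)) (veronese None) = b - a"
    for a b c :: 'b
    by (simp_all add: det3_def veronese_def algebra_simps)
  show ?thesis
    using assms by (cases a; cases b; cases c) (simp_all add: vdm 1 2 3)
qed

lemma inj_veronese: "inj veronese"
  by (rule injI) (auto simp: veronese_def vec3_eq_iff split: option.splits)

lemma vec_arc_veronese: "vec_arc (range veronese)"
  by (simp add: vec_arc_def det3_veronese inj_veronese[THEN inj_eq])

lemma card_range_veronese: "card (range (veronese :: 'b::{field,finite} option \<Rightarrow> _)) = CARD('b) + 1"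
  by (simp add: card_image inj_veronese card_UNIV_option)

lemma arc_card_bound:
  assumes "odd CARD('b::{field,finite})" "is_arc (A :: ('b ^ 3) set set)"
  shows "card A \<le> CARD('b) + 1"
proof -
  from arc_representatives[OF assms(2)] obtain g where
    "(\<forall>P\<in>A. g P \<noteq> 0 \<and> vec.span {g P} = P) \<and> vec_arc (g ` A) \<and> inj_on g A" ..
  hence g: "vec_arc (g ` A)" "inj_on g A"
    by simp_all
  thus ?thesis
    using arc_card_le[OF assms(1) g(1)] card_image[OF g(2)] by simp
qed

text \<open>The standard conic attains the bound of \<open>arc_card_le\<close>. This identifies the
  size that \<open>is_m2'\<close> discards.\<close>

lemma Max_complete_arc_sizes:
  assumes odd: "odd CARD('b::{field,finite})"
  shows "Max (complete_arc_sizes TYPE('b)) = CARD('b) + 1"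
proof (rule Max_eqI)
  show "finite (complete_arc_sizes TYPE('b))"
    by (simp add: complete_arc_sizes_def)
  show "k \<le> CARD('b) + 1" if "k \<in> complete_arc_sizes TYPE('b)" for k
    using that arc_card_bound[OF odd] by (auto simp: complete_arc_sizes_def is_complete_arc_def)
  have 2: "2 \<le> CARD('b)"
    using two_le_card_field[where 'b = 'b] by simp
  let ?C = "(\<lambda>x. vec.span {x}) ` range (veronese :: 'b option \<Rightarrow> _)"
  have "3 \<le> card (range (veronese :: 'b option \<Rightarrow> _))"
    using card_range_veronese[where 'b = 'b] 2 by simp
  from vec_arc_imp_is_arc[OF vec_arc_veronese this]
  have C: "is_arc ?C" "card ?C = CARD('b) + 1"
    using card_range_veronese[where 'b = 'b] by simp_all
  have "is_complete_arc ?C"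
    unfolding is_complete_arc_def
  proof (intro conjI notI)
    assume "\<exists>B. is_arc B \<and> ?C \<subset> B"
    then obtain B where B: "is_arc B" "?C \<subset> B"
      by blast
    have "card ?C < card B"
      by (rule psubset_card_mono) (use B in auto)
    thus False
      using arc_card_bound[OF odd B(1)] C by simp
  qed (rule C)
  thus "CARD('b) + 1 \<in> complete_arc_sizes TYPE('b)"
    using C(2) unfolding complete_arc_sizes_def by (metis (mono_tags) imageI mem_Collect_eq)
qed

lemma card_small_subsets:
  assumes "finite X"
  shows "(\<Sum>B | B \<subseteq> X \<and> card B \<le> 2. t ^ card B) = 1 + card X * t + (card X choose 2) * (t ^ 2 :: nat)"
proof -
  have eq: "{B. B \<subseteq> X \<and> card B \<le> 2} = {B. B \<subseteq> X \<and> card B = 0} \<union> ({B. B \<subseteq> X \<and> card B = 1} \<union> {B. B \<subseteq> X \<and> card B = 2})"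
    by auto
  have sum: "(\<Sum>B | B \<subseteq> X \<and> card B = k. t ^ card B) = (card X choose k) * t ^ k" for k
    using assms by (simp add: n_subsets)
  have "(\<Sum>B | B \<subseteq> X \<and> card B \<le> 2. t ^ card B) = (\<Sum>B | B \<subseteq> X \<and> card B = 0. t ^ card B)
      + ((\<Sum>B | B \<subseteq> X \<and> card B = 1. t ^ card B) + (\<Sum>B | B \<subseteq> X \<and> card B = 2. t ^ card B))"
    unfolding eq by (subst sum.union_disjoint; (use assms in force)?)+
  thus ?thesis
    unfolding sum by simp
qed

text \<open>Every vector on a secant is a combination, with nonzero coefficients, of a set
  \<open>B\<close> of at most two vectors of \<open>X\<close>. The summands in \<open>small\<close>
  count these combinations for \<open>card B\<close> equal to 0, 1 and 2; any vector left over is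
  off all secants.\<close>

lemma vec_arc_extend:
  fixes X :: "('b::{field,finite} ^ 3) set"
  assumes span: "inj_on (\<lambda>x. vec.span {x}) X" and nz: "0 \<notin> X"
    and small: "1 + card X * (CARD('b) - 1) + (card X choose 2) * (CARD('b) - 1) ^ 2 < CARD('b) ^ 3"
  shows "\<exists>w. w \<noteq> 0 \<and> (\<forall>u\<in>X. w \<notin> vec.span {u}) \<and> (\<forall>u\<in>X. \<forall>v\<in>X. u \<noteq> v \<longrightarrow> det3 w u v \<noteq> 0)"
proof -
  define D where "D = (\<lambda>B :: ('b ^ 3) set. (\<lambda>c. \<Sum>x\<in>B. c x *s x) ` (B \<rightarrow>\<^sub>E (UNIV - {0::'b})))"
  define S where "S = {B. B \<subseteq> X \<and> card B \<le> 2}"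
  have fin: "finite S"
    by (simp add: S_def)
  have "card (D B) \<le> (CARD('b) - 1) ^ card B" for B
  proof -
    have "card (D B) \<le> card (B \<rightarrow>\<^sub>E (UNIV - {0::'b}))"
      unfolding D_def by (rule card_image_le) (simp add: finite_PiE)
    thus ?thesis
      by (simp add: card_PiE card_Diff_subset)
  qed
  hence "card (\<Union>B\<in>S. D B) \<le> (\<Sum>B\<in>S. (CARD('b) - 1) ^ card B)"
    using card_UN_le[OF fin, of D] by (meson le_trans sum_mono)
  also have "\<dots> < CARD('b) ^ 3"
    unfolding S_def using card_small_subsets[of X] small by simp
  also have "CARD('b) ^ 3 = CARD('b ^ 3)"
    by simp
  finally have "(\<Union>B\<in>S. D B) \<noteq> UNIV"
    by auto
  then obtain w where w: "w \<notin> (\<Union>B\<in>S. D B)"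
    by blast
  have D: "(\<Sum>x\<in>B. c x *s x) \<in> D B" if "\<And>x. x \<in> B \<Longrightarrow> c x \<noteq> 0" for B c
  proof -
    have "(\<Sum>x\<in>B. c x *s x) = (\<Sum>x\<in>B. restrict c B x *s x)"
      by (rule sum.cong) auto
    moreover have "restrict c B \<in> B \<rightarrow>\<^sub>E (UNIV - {0})"
      using that by auto
    ultimately show ?thesis
      unfolding D_def by blast
  qed
  have w0: "w \<noteq> 0"
  proof -
    have "0 \<in> D {}" "{} \<in> S"
      by (auto simp: D_def S_def)
    thus ?thesis
      using w by auto
  qed
  have w1: "w \<noteq> k *s u" if "u \<in> X" for u k
  proof (cases "k = 0")
    case False
    have "k *s u \<in> D {u}"
      using D[of "{u}" "\<lambda>_. k"] False by simp
    moreover have "{u} \<in> S"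
      using that by (simp add: S_def)
    ultimately show ?thesis
      using w by blast
  qed (use w0 in simp)
  have w2: "w \<noteq> k *s u + l *s v" if "u \<in> X" "v \<in> X" "u \<noteq> v" for u v k l
  proof (cases "k = 0 \<or> l = 0")
    case False
    have "k *s u + l *s v \<in> D {u, v}"
      using D[of "{u, v}" "\<lambda>x. if x = u then k else l"] False that by simp
    moreover have "{u, v} \<in> S"
      using that by (simp add: S_def)
    ultimately show ?thesis
      using w by blast
  qed (use w1[OF that(1), of k] w1[OF that(2), of l] in auto)
  show ?thesis
  proof (intro exI[of _ w] conjI ballI impI)
    show "w \<noteq> 0"
      by (rule w0)
    show "w \<notin> vec.span {u}" if "u \<in> X" for u
      using w1[OF that] by (auto simp: vec.span_singleton)
    show "det3 w u v \<noteq> 0" if "u \<in> X" "v \<in> X" "u \<noteq> v" for u v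
    proof
      assume "det3 w u v = 0"
      hence "det3 u v w = 0"
        by (simp add: det3_rotate)
      moreover have "u \<noteq> 0" "v \<noteq> 0" "vec.span {u} \<noteq> vec.span {v}"
        using that nz span by (auto dest: inj_onD)
      ultimately have "w \<in> vec.span {u, v}"
        using det3_zero_mem_span by blast
      thus False
        using w2[OF that] by (auto simp: mem_span_pair)
    qed
  qed
qed

text \<open>Otherwise the vector found by \<open>vec_arc_extend\<close> spans a point that can be
  added to \<open>A\<close>.\<close>

lemma complete_arc_card:
  fixes A :: "('b::{field,finite} ^ 3) set set"
  assumes A: "is_complete_arc A"
  shows "CARD('b) ^ 3 \<le> 1 + card A * (CARD('b) - 1) + (card A choose 2) * (CARD('b) - 1) ^ 2"
proof (rule ccontr)
  assume *: "\<not> ?thesis"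
  have "is_arc A"
    using A by (simp add: is_complete_arc_def)
  from arc_representatives[OF this] obtain g where
    "(\<forall>P\<in>A. g P \<noteq> 0 \<and> vec.span {g P} = P) \<and> vec_arc (g ` A) \<and> inj_on g A" ..
  hence g: "\<And>P. P \<in> A \<Longrightarrow> g P \<noteq> 0 \<and> vec.span {g P} = P" and arc: "vec_arc (g ` A)"
      and inj: "inj_on g A"
    by simp_all
  have "inj_on (\<lambda>x. vec.span {x}) (g ` A)"
  proof (rule inj_onI)
    fix x y assume "x \<in> g ` A" "y \<in> g ` A" "vec.span {x} = vec.span {y}"
    thus "x = y"
      using g by auto
  qed
  moreover have "0 \<notin> g ` A"
    using g by auto
  ultimately obtain w where w: "w \<noteq> 0" "\<forall>u\<in>g ` A. w \<notin> vec.span {u}"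
      "\<forall>u\<in>g ` A. \<forall>v\<in>g ` A. u \<noteq> v \<longrightarrow> det3 w u v \<noteq> 0"
    using vec_arc_extend[of "g ` A"] * card_image[OF inj] by auto
  let ?P = "vec.span {w}"
  have P: "?P \<notin> A"
    using w g vec.span_base by (metis imageI singletonI)
  define h where "h = g(?P := w)"
  have hA: "h ` insert ?P A = insert w (g ` A)"
    using P by (auto simp: h_def)
  have "vec_arc (insert w (g ` A))"
    by (rule vec_arc_insert[OF arc]) (use w in blast)
  hence "vec_arc (h ` insert ?P A)"
    by (simp only: hA)
  moreover have "h Q \<noteq> 0 \<and> vec.span {h Q} = Q" if "Q \<in> insert ?P A" for Q
    using g w that unfolding h_def by auto
  ultimately have "is_arc (insert ?P A)"
    using is_arc_iff_vec_arc[of "insert ?P A" h] by blast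
  thus False
    using A P unfolding is_complete_arc_def by blast
qed

text \<open>With r = t + 1, the count in \<open>complete_arc_card\<close> excludes three or fewer
  points by the term \<open>t ^ 3\<close>, and four points once \<open>t \<ge> 4\<close>. The
  remaining case r = 3 is that of the conic itself, which has four points and hence is not second
  largest.\<close>

lemma is_m2'_ge_5:
  assumes odd: "odd CARD('b::{field,finite})" and m: "is_m2' TYPE('b) m"
  shows "5 \<le> m"
proof (rule ccontr)
  assume "\<not> 5 \<le> m"
  define T where "T = complete_arc_sizes TYPE('b) - {CARD('b) + 1}"
  have "finite T" "T \<noteq> {}" "m = Max T"
    using m Max_complete_arc_sizes[OF odd] by (auto simp: is_m2'_def Let_def T_def complete_arc_sizes_def)
  hence "m \<in> T"
    using Max_in by blast
  then obtain A :: "('b ^ 3) set set" where A: "is_complete_arc A" "card A = m" "m \<noteq> CARD('b) + 1"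
    by (auto simp: T_def complete_arc_sizes_def)
  have "m \<le> CARD('b) + 1"
    using A arc_card_bound[OF odd] by (auto simp: is_complete_arc_def)
  have "2 \<le> CARD('b)"
    using two_le_card_field[where 'b = 'b] by simp
  then obtain t where t: "CARD('b) = t + 1" "even t" "t \<ge> 1"
    using odd by (metis add.commute even_plus_one_iff le_add_diff_inverse2 nat_le_iff_add one_le_numeral order_trans add_le_cancel_left one_add_one)
  have ineq: "(t + 1) ^ 3 \<le> 1 + m * t + (m choose 2) * t ^ 2"
    using complete_arc_card[OF A(1)] by (simp add: A(2) t(1))
  have "t \<ge> 2"
    using t by (auto elim!: evenE)
  have cube: "(t + 1) ^ 3 = 1 + 3 * t + 3 * t ^ 2 + t ^ 3"
    by (simp add: power2_eq_square power3_eq_cube algebra_simps)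
  have "m \<le> 3 \<or> m = 4"
    using \<open>\<not> 5 \<le> m\<close> by auto
  thus False
  proof
    assume "m \<le> 3"
    hence "m = 0 \<or> m = 1 \<or> m = 2 \<or> m = 3"
      by auto
    hence "m * t \<le> 3 * t" "m choose 2 \<le> 3"
      by (auto simp: numeral_eq_Suc)
    hence "1 + m * t + (m choose 2) * t ^ 2 \<le> 1 + 3 * t + 3 * t ^ 2"
      by (simp add: add_mono mult_le_mono1)
    hence "t ^ 3 \<le> 0"
      using ineq cube by linarith
    thus False
      using \<open>t \<ge> 2\<close> by simp
  next
    assume m4: "m = 4"
    hence "t \<noteq> 3" "t + 2 \<noteq> 4" "t \<ge> 2"
      using A(3) t \<open>t \<ge> 2\<close> by auto
    hence "t \<ge> 4"
      by linarith
    have "(4::nat) choose 2 = 6"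
      by (simp add: numeral_eq_Suc)
    hence "t ^ 3 \<le> t + 3 * t ^ 2"
      using ineq cube m4 by simp
    moreover have "4 * t ^ 2 \<le> t ^ 3"
      using \<open>t \<ge> 4\<close> by (simp add: power2_eq_square power3_eq_cube)
    moreover have "t < t ^ 2"
      using \<open>t \<ge> 4\<close> by (simp add: power2_eq_square)
    ultimately show False
      by linarith
  qed
qed

text \<open>A maximal arc containing \<open>X\<close> is complete and has more than \<open>m\<close>
  points, so by the choice of \<open>m\<close> it has r + 1 points and Segre's theorem applies to
  it.\<close>

theorem conic_of_large_arc:
  fixes X :: "('b::{field,finite} ^ 3) set"
  assumes odd: "odd CARD('b)" and m: "is_m2' TYPE('b) m" and X: "vec_arc X" "m < card X"
  shows "\<exists>f. quadratic_form f \<and> (\<exists>x. f x \<noteq> 0) \<and> (\<forall>x\<in>X. f x = 0)"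
proof -
  let ?A = "(\<lambda>x. vec.span {x}) ` X"
  have "3 \<le> card X"
    using is_m2'_ge_5[OF odd m] X by simp
  note A = vec_arc_imp_is_arc[OF X(1) this]
  have "\<exists>A'\<in>{B. is_arc B}. ?A \<subseteq> A' \<and> (\<forall>B\<in>{B. is_arc B}. A' \<subseteq> B \<longrightarrow> A' = B)"
    by (rule finite_has_maximal2) (use A in auto)
  then obtain A' where A': "is_arc A'" "?A \<subseteq> A'" "\<And>B. is_arc B \<Longrightarrow> A' \<subseteq> B \<Longrightarrow> A' = B"
    by auto
  have complete: "is_complete_arc A'"
    using A' unfolding is_complete_arc_def by blast
  have "card A' = CARD('b) + 1"
  proof (rule ccontr)
    assume *: "card A' \<noteq> CARD('b) + 1"
    define T where "T = complete_arc_sizes TYPE('b) - {CARD('b) + 1}"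
    have "card A' \<in> T"
      using complete * by (auto simp: T_def complete_arc_sizes_def)
    moreover have "finite T" "m = Max T"
      using m Max_complete_arc_sizes[OF odd] by (auto simp: is_m2'_def Let_def T_def complete_arc_sizes_def)
    ultimately have "card A' \<le> m"
      by simp
    moreover have "card ?A \<le> card A'"
      using A' by (intro card_mono) auto
    ultimately show False
      using A X by simp
  qed
  from arc_representatives[OF A'(1)] obtain g where
    "(\<forall>P\<in>A'. g P \<noteq> 0 \<and> vec.span {g P} = P) \<and> vec_arc (g ` A') \<and> inj_on g A'" ..
  hence g: "\<And>P. P \<in> A' \<Longrightarrow> g P \<noteq> 0 \<and> vec.span {g P} = P" "vec_arc (g ` A')" "inj_on g A'"
    by simp_all
  obtain f where f: "quadratic_form f" "\<exists>x. f x \<noteq> 0" "\<forall>x\<in>g ` A'. f x = 0"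
    using segre[OF odd g(2)] card_image[OF g(3)] \<open>card A' = CARD('b) + 1\<close> by auto
  have "f x = 0" if x: "x \<in> X" for x
  proof -
    have P: "vec.span {x} \<in> A'"
      using A' x by blast
    have "x \<in> vec.span {g (vec.span {x})}"
      using g(1)[OF P] vec.span_base by blast
    then obtain k where k: "x = k *s g (vec.span {x})"
      by (auto simp: vec.span_singleton)
    \<comment> \<open>Segre's form vanishes at the representatives chosen by \<open>g\<close>;
      homogeneity carries this over to the given vectors.\<close>
    have hom: "f (k *s y) = k * k * f y" for y
      using f(1) unfolding quadratic_form_def by (auto simp: algebra_simps)
    show ?thesis
      using f(3) P k hom by (metis imageI mult_zero_right)
  qed
  thus ?thesis
    using f by blast
qed

section \<open>Planes over a finite field\<close>

definition vprod3 :: "'b::field ^ 3 \<Rightarrow> 'b ^ 3 \<Rightarrow> 'b ^ 3" where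
  "vprod3 v w = vector [v$2 * w$3 - v$3 * w$2, v$3 * w$1 - v$1 * w$3, v$1 * w$2 - v$2 * w$1]"

lemma dot3_vprod3: "dot3 u (vprod3 v w) = det3 u v w"
  by (simp add: dot3_def vprod3_def det3_def algebra_simps)

lemma dot3_commute: "dot3 u v = dot3 v u"
  by (simp add: dot3_def mult.commute)

text \<open>Up to the determinant, the three cross products are the basis dual to \<open>u\<close>,
  \<open>v\<close>, \<open>w\<close>. This makes the solution in \<open>dot3_solve\<close>
  explicit.\<close>

lemma dot3_expand:
  "det3 u v w *s d = dot3 u d *s vprod3 v w + dot3 v d *s vprod3 w u + dot3 w d *s vprod3 u v"
  by (simp add: vec3_eq_iff dot3_def vprod3_def det3_def algebra_simps)

lemma dot3_solve:
  fixes u v w :: "'b::field ^ 3"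
  assumes "det3 u v w \<noteq> 0"
  shows "\<exists>!c. dot3 u c = x \<and> dot3 v c = y \<and> dot3 w c = z"
proof (rule ex_ex1I)
  let ?d = "inverse (det3 u v w)"
  let ?c = "?d *s (x *s vprod3 v w + y *s vprod3 w u + z *s vprod3 u v)"
  have rot: "det3 v w u = det3 u v w" "det3 w u v = det3 u v w"
    by (simp_all add: det3_def algebra_simps)
  have "dot3 u ?c = x" "dot3 v ?c = y" "dot3 w ?c = z"
    using assms by (simp_all add: dot3_add dot3_scale dot3_vprod3 rot)
  thus "\<exists>c. dot3 u c = x \<and> dot3 v c = y \<and> dot3 w c = z"
    by blast
next
  fix c c'
  assume "dot3 u c = x \<and> dot3 v c = y \<and> dot3 w c = z" "dot3 u c' = x \<and> dot3 v c' = y \<and> dot3 w c' = z"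
  hence "det3 u v w *s (c - c') = 0"
    by (subst dot3_expand) (simp add: dot3_diff)
  thus "c = c'"
    using assms by simp
qed

lemma dot3_eqI:
  assumes "det3 u v w \<noteq> 0" "dot3 u c = dot3 u c'" "dot3 v c = dot3 v c'" "dot3 w c = dot3 w c'"
  shows "c = c'"
  using dot3_solve[OF assms(1)] assms(2-4) by metis

text \<open>Used to turn a sum of an evaluation along a line into a sum over the whole
  field.\<close>

lemma dot3_bij_line:
  assumes "det3 u v w \<noteq> 0"
  shows "bij_betw (dot3 w) {c. dot3 u c = x \<and> dot3 v c = y} (UNIV :: 'b::field set)"
  unfolding bij_betw_def
proof
  show "inj_on (dot3 w) {c. dot3 u c = x \<and> dot3 v c = y}"
    by (auto intro!: inj_onI dot3_eqI[OF assms])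
  show "dot3 w ` {c. dot3 u c = x \<and> dot3 v c = y} = UNIV"
  proof -
    have "z \<in> dot3 w ` {c. dot3 u c = x \<and> dot3 v c = y}" for z
      using ex1_implies_ex[OF dot3_solve[OF assms, of x y z]] by blast
    thus ?thesis
      by blast
  qed
qed

lemma card_line:
  fixes u v w :: "'b::{field,finite} ^ 3"
  assumes "det3 u v w \<noteq> 0"
  shows "card {c. dot3 u c = x \<and> dot3 v c = y} = CARD('b)"
  using bij_betw_same_card[OF dot3_bij_line[OF assms]] .

lemma card_plane:
  fixes u :: "'b::{field,finite} ^ 3"
  assumes "u \<noteq> 0"
  shows "card {c. dot3 u c = x} = CARD('b) ^ 2"
proof -
  obtain v w where vw: "det3 u v w \<noteq> 0"
  proof -
    consider "u$1 \<noteq> 0" | "u$2 \<noteq> 0" | "u$3 \<noteq> 0"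
      using assms by (auto simp: vec3_eq_iff)
    thus ?thesis
    proof cases
      case 1
      thus ?thesis
        by (intro that[of "vector [0, 1, 0]" "vector [0, 0, 1]"]) (simp add: det3_def)
    next
      case 2
      thus ?thesis
        by (intro that[of "vector [1, 0, 0]" "vector [0, 0, 1]"]) (simp add: det3_def)
    next
      case 3
      thus ?thesis
        by (intro that[of "vector [1, 0, 0]" "vector [0, 1, 0]"]) (simp add: det3_def)
    qed
  qed
  have "bij_betw (\<lambda>c. (dot3 v c, dot3 w c)) {c. dot3 u c = x} UNIV"
    unfolding bij_betw_def
  proof
    show "inj_on (\<lambda>c. (dot3 v c, dot3 w c)) {c. dot3 u c = x}"
      by (auto intro!: inj_onI dot3_eqI[OF vw])
    have "(y, z) \<in> (\<lambda>c. (dot3 v c, dot3 w c)) ` {c. dot3 u c = x}" for y z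
      using ex1_implies_ex[OF dot3_solve[OF vw, of x y z]] by (auto simp: image_iff)
    thus "(\<lambda>c. (dot3 v c, dot3 w c)) ` {c. dot3 u c = x} = UNIV"
      by auto
  qed
  from bij_betw_same_card[OF this] show ?thesis
    by (simp add: power2_eq_square card_prod flip: UNIV_Times_UNIV)
qed

lemma card_linear_equation:
  fixes k l y :: "'b::{field,finite}"
  assumes "k \<noteq> 0 \<or> l \<noteq> 0"
  shows "card {p. k * fst p + l * snd p = y} = CARD('b)"
proof (cases "k = 0")
  case True
  hence "{p. k * fst p + l * snd p = y} = (\<lambda>x. (x, y / l)) ` UNIV"
    using assms by (auto simp: field_simps image_iff)
  thus ?thesis
    by (simp add: card_image inj_on_def)
next
  case False
  hence "{p. k * fst p + l * snd p = y} = (\<lambda>x. ((y - l * x) / k, x)) ` UNIV"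
    by (auto simp: field_simps image_iff)
  thus ?thesis
    by (simp add: card_image inj_on_def)
qed

section \<open>Points on no secant of a large subset of a conic\<close>

text \<open>A zero at infinity lowers the degree of the dehomogenised polynomial by one and also
  uses up one element of \<open>T\<close>, so there are too many zeros in either case.\<close>

lemma binary_quartic_eq_0:
  fixes T :: "'b::field option set"
  assumes card: "5 \<le> card T"
    and Some: "\<And>t. Some t \<in> T \<Longrightarrow> c0 + c1 * t + c2 * t ^ 2 + c3 * t ^ 3 + c4 * t ^ 4 = 0"
    and None: "None \<in> T \<Longrightarrow> c4 = 0"
  shows "c0 = 0 \<and> c1 = 0 \<and> c2 = 0 \<and> c3 = 0 \<and> c4 = 0"
proof -
  let ?p = "[:c0, c1, c2, c3, c4:]"
  let ?S = "{t. Some t \<in> T}"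
  have fin: "finite T"
    using card by (auto intro: card_ge_0_finite)
  have S: "T - {None} = Some ` ?S"
    by (auto simp: image_iff) (metis not_None_eq)
  hence card_S: "card (T - {None}) = card ?S"
    by (metis card_image inj_Some inj_on_subset subset_UNIV)
  have "?p = 0"
  proof (rule ccontr)
    assume p: "?p \<noteq> 0"
    have "?S \<subseteq> {t. poly ?p t = 0}"
      using Some by (auto simp: power2_eq_square power3_eq_cube power4_eq_xxxx algebra_simps)
    hence "card ?S \<le> card {t. poly ?p t = 0}"
      by (intro card_mono poly_roots_finite p)
    also have "\<dots> \<le> degree ?p"
      using p by (rule card_poly_roots_bound)
    finally have le: "card ?S \<le> degree ?p" .
    show False
    proof (cases "None \<in> T")
      case True
      hence "card ?S \<ge> 4" "degree ?p \<le> 3"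
        using card card_S fin None by (auto simp: card_Diff_singleton)
      thus ?thesis
        using le by simp
    next
      case False
      hence "card ?S \<ge> 5" "degree ?p \<le> 4"
        using card card_S by (auto simp: degree_pCons_eq_if)
      thus ?thesis
        using le by simp
    qed
  qed
  thus ?thesis
    by (simp add: pCons_eq_0_iff)
qed

text \<open>Restricted to the standard conic the form is a quartic in the parameter. The
  coefficients \<open>b\<close> and \<open>e\<close> contribute to the same power, and this
  one-dimensional ambiguity is the equation of the conic.\<close>

lemma quadratic_form_vanishing_on_conic:
  fixes f :: "'b::field ^ 3 \<Rightarrow> 'b"
  assumes f: "quadratic_form f" and T: "5 \<le> card T" "\<And>\<tau>. \<tau> \<in> T \<Longrightarrow> f (veronese \<tau>) = 0"
  shows "\<exists>k. \<forall>x. f x = k * (x$2 * x$2 - x$1 * x$3)"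
proof -
  obtain a b c d e g where f: "\<And>x. f x =
     a * x$1 * x$1 + b * x$2 * x$2 + c * x$3 * x$3 + d * x$1 * x$2 + e * x$1 * x$3 + g * x$2 * x$3"
    using f unfolding quadratic_form_def by blast
  have "a = 0 \<and> d = 0 \<and> b + e = 0 \<and> g = 0 \<and> c = 0"
  proof (rule binary_quartic_eq_0[OF T(1)])
    fix t assume "Some t \<in> T"
    from T(2)[OF this] show "a + d * t + (b + e) * t ^ 2 + g * t ^ 3 + c * t ^ 4 = 0"
      by (simp add: f veronese_def power2_eq_square power3_eq_cube power4_eq_xxxx algebra_simps)
  next
    assume "None \<in> T"
    from T(2)[OF this] show "c = 0"
      by (simp add: f veronese_def)
  qed
  moreover from this have "e = - b"
    by (simp add: eq_neg_iff_add_eq_0 add.commute)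
  ultimately have "f x = b * (x$2 * x$2 - x$1 * x$3)" for x
    by (simp add: f algebra_simps)
  thus ?thesis
    by blast
qed

lemma conic_point:
  fixes u :: "'b::field ^ 3"
  assumes "u \<noteq> 0" "u$2 * u$2 = u$1 * u$3"
  shows "\<exists>\<tau> k. k \<noteq> 0 \<and> u = k *s veronese \<tau>"
proof (cases "u$1 = 0")
  case True
  hence "u$2 = 0" "u$3 \<noteq> 0"
    using assms by (auto simp: vec3_eq_iff)
  hence "u = u$3 *s veronese None"
    using True by (simp add: vec3_eq_iff veronese_def)
  thus ?thesis
    using \<open>u$3 \<noteq> 0\<close> by blast
next
  case False
  hence "u = u$1 *s veronese (Some (u$2 / u$1))"
    using assms by (simp add: vec3_eq_iff veronese_def field_simps)
  thus ?thesis
    using False by blast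
qed

lemma veronese_neq_0: "veronese \<tau> \<noteq> 0"
  by (cases \<tau>) (auto simp: veronese_def vec3_eq_iff)

lemma veronese_span_inj:
  assumes "vec.span {veronese a} = vec.span {veronese b}"
  shows "a = b"
proof -
  have "veronese a \<in> vec.span {veronese b}"
    using assms vec.span_base by blast
  then obtain k where "veronese a = k *s veronese b"
    by (auto simp: vec.span_singleton)
  thus ?thesis
    by (cases a; cases b) (auto simp: veronese_def vec3_eq_iff)
qed

text \<open>Otherwise \<open>u\<close> extends the points of \<open>T\<close> to an arc, which lies
  on a conic. That conic shares at least five points with the standard one and so has the same
  equation; but \<open>u\<close> is not on it.\<close>

lemma mem_secant_of_large_arc:
  fixes u :: "'b::{field,finite} ^ 3"
  assumes odd: "odd CARD('b)" and m: "is_m2' TYPE('b) m" and T: "m < card T"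
    and u: "u \<noteq> 0" "\<And>\<tau> k. u \<noteq> k *s veronese \<tau>"
  shows "\<exists>a\<in>T. \<exists>b\<in>T. a \<noteq> b \<and> u \<in> vec.span {veronese a, veronese b}"
proof (rule ccontr)
  assume *: "\<not> ?thesis"
  have det: "det3 u (veronese a) (veronese b) \<noteq> 0" if "a \<in> T" "b \<in> T" "a \<noteq> b" for a b
  proof
    assume "det3 u (veronese a) (veronese b) = 0"
    hence "det3 (veronese a) (veronese b) u = 0"
      by (simp add: det3_def algebra_simps)
    hence "u \<in> vec.span {veronese a, veronese b}"
      using det3_zero_mem_span[of "veronese a" "veronese b" u] veronese_neq_0 veronese_span_inj that
      by metis
    thus False
      using * that by blast
  qed
  let ?X = "insert u (veronese ` T)"
  have arc: "vec_arc ?X"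
  proof (rule vec_arc_insert)
    show "vec_arc (veronese ` T)"
      using vec_arc_veronese unfolding vec_arc_def by blast
    show "det3 u x y \<noteq> 0" if "x \<in> veronese ` T" "y \<in> veronese ` T" "x \<noteq> y" for x y
      using det that by blast
  qed
  have "u \<notin> veronese ` T"
    using u(2)[of 1] by auto
  hence "card ?X = card T + 1"
    by (simp add: card_image inj_on_subset[OF inj_veronese])
  hence "m < card ?X"
    using T by simp
  from conic_of_large_arc[OF odd m arc this] obtain f where
    f: "quadratic_form f" "\<exists>x. f x \<noteq> 0" "\<forall>x\<in>?X. f x = 0"
    by blast
  have "5 \<le> card T"
    using is_m2'_ge_5[OF odd m] T by simp
  then obtain k where k: "\<And>x. f x = k * (x$2 * x$2 - x$1 * x$3)"
    using quadratic_form_vanishing_on_conic[OF f(1)] f(3) by (metis imageI insertCI)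
  have "k \<noteq> 0"
    using f(2) k by auto
  hence "u$2 * u$2 = u$1 * u$3"
    using f(3) k by auto
  thus False
    using conic_point u by blast
qed

section \<open>Transversal sets of polynomials\<close>

text \<open>The vector \<open>c\<close> is read as the polynomial with coefficients
  \<open>c$1\<close>, \<open>c$2\<close>, \<open>c$3\<close> in ascending order;
  \<open>ev None\<close> is the leading coefficient, the value at infinity.\<close>

abbreviation ev :: "'b::field option \<Rightarrow> 'b ^ 3 \<Rightarrow> 'b" where
  "ev \<tau> \<equiv> dot3 (veronese \<tau>)"

lemma exists_third:
  assumes "3 \<le> card (UNIV :: 'x::finite set)"
  shows "\<exists>z :: 'x. z \<noteq> x \<and> z \<noteq> y"
proof (rule ccontr)
  assume "\<not> ?thesis"
  hence "(UNIV :: 'x set) \<subseteq> {x, y}"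
    by auto
  hence "card (UNIV :: 'x set) \<le> card {x, y}"
    by (rule card_mono[rotated]) simp
  also have "\<dots> \<le> 2"
    by (simp add: card_insert_if)
  finally show False
    using assms by simp
qed

text \<open>
  Counting the incidences of \<open>C\<close> with all planes through a point expresses the indicator function
  of \<open>C\<close> as a sum of functions of the single evaluations \<open>ev \<tau>\<close>: the planes that are not of the
  form \<open>ev \<tau> c = y\<close> are equidistributed, because they are unions of lines each meeting \<open>C\<close> once.
\<close>

locale transversal =
  fixes C :: "('b::{field,finite} ^ 3) set" and T :: "'b option set" and r :: int
  assumes card_field: "3 \<le> CARD('b)"
    and r [simp]: "int CARD('b) = r"
    and once: "\<And>a b x y. a \<in> T \<Longrightarrow> b \<in> T \<Longrightarrow> a \<noteq> b \<Longrightarrow> card {c \<in> C. ev a c = x \<and> ev b c = y} = 1"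
    and secant: "\<And>u. u \<noteq> 0 \<Longrightarrow> (\<And>\<tau> k. u \<noteq> k *s veronese \<tau>) \<Longrightarrow>
      \<exists>a\<in>T. \<exists>b\<in>T. a \<noteq> b \<and> u \<in> vec.span {veronese a, veronese b}"
begin

lemma r_ge_3: "3 \<le> r"
  using card_field by (simp flip: r)

definition N :: "'b option \<Rightarrow> 'b \<Rightarrow> int" where
  "N \<tau> y = int (card {c \<in> C. ev \<tau> c = y})"

lemma ev_pair_bij:
  assumes "a \<in> T" "b \<in> T" "a \<noteq> b"
  shows "bij_betw (\<lambda>c. (ev a c, ev b c)) C UNIV"
proof -
  have one: "\<exists>!c. c \<in> C \<and> ev a c = x \<and> ev b c = y" for x y
  proof -
    obtain c0 where "{c \<in> C. ev a c = x \<and> ev b c = y} = {c0}"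
      using once[OF assms, of x y] by (auto simp: card_1_singleton_iff)
    hence "c \<in> C \<and> ev a c = x \<and> ev b c = y \<longleftrightarrow> c = c0" for c
      by (simp add: set_eq_iff)
    thus ?thesis
      by simp
  qed
  show ?thesis
    unfolding bij_betw_def
  proof
    show "inj_on (\<lambda>c. (ev a c, ev b c)) C"
      using one by (auto intro!: inj_onI)
    have "(x, y) \<in> (\<lambda>c. (ev a c, ev b c)) ` C" for x y
      using ex1_implies_ex[OF one[of x y]] by auto
    thus "(\<lambda>c. (ev a c, ev b c)) ` C = UNIV"
      by auto
  qed
qed

text \<open>Provides two elements of \<open>T\<close>, and with them a bijective chart of
  \<open>C\<close>. Any functional off the conic would do; here it is the middle
  coefficient.\<close>

lemma exists_secant: "\<exists>a\<in>T. \<exists>b\<in>T. a \<noteq> b"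
proof -
  have "(vector [0, 1, 0] :: 'b ^ 3) \<noteq> k *s veronese \<tau>" for k \<tau>
    by (cases \<tau>) (auto simp: veronese_def vec3_eq_iff)
  moreover have "(vector [0, 1, 0] :: 'b ^ 3) \<noteq> 0"
    by (simp add: vec3_eq_iff)
  ultimately show ?thesis
    using secant by blast
qed

lemma card_C: "int (card C) = r ^ 2"
proof -
  obtain a b where "a \<in> T" "b \<in> T" "a \<noteq> b"
    using exists_secant by blast
  from bij_betw_same_card[OF ev_pair_bij[OF this]] show ?thesis
    by (simp add: power2_eq_square card_prod flip: UNIV_Times_UNIV)
qed

lemma card_C_plane:
  assumes "u \<noteq> 0" "\<And>\<tau> k. u \<noteq> k *s veronese \<tau>"
  shows "card {c \<in> C. dot3 u c = y} = CARD('b)"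
proof -
  obtain a b where ab: "a \<in> T" "b \<in> T" "a \<noteq> b" "u \<in> vec.span {veronese a, veronese b}"
    using secant[OF assms] by blast
  then obtain k l where u: "u = k *s veronese a + l *s veronese b"
    by (auto simp: mem_span_pair)
  have kl: "k \<noteq> 0 \<or> l \<noteq> 0"
    using u assms(1) by auto
  have "bij_betw (\<lambda>c. (ev a c, ev b c)) {c \<in> C. dot3 u c = y} {p. k * fst p + l * snd p = y}"
  proof (rule bij_betw_subset[OF ev_pair_bij[OF ab(1-3)]])
    have "dot3 u c = k * ev a c + l * ev b c" for c
      by (simp add: u dot3_add_left dot3_scale_left)
    moreover have "p \<in> (\<lambda>c. (ev a c, ev b c)) ` C" for p
      using ev_pair_bij[OF ab(1-3)] by (simp add: bij_betw_def)
    ultimately show "(\<lambda>c. (ev a c, ev b c)) ` {c \<in> C. dot3 u c = y} = {p. k * fst p + l * snd p = y}"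
      by (auto simp: image_iff) metis
  qed auto
  from bij_betw_same_card[OF this] show ?thesis
    using card_linear_equation[OF kl] by simp
qed

lemma sum_N: "(\<Sum>y\<in>UNIV. N \<tau> y) = r ^ 2"
proof -
  have "(\<Sum>y\<in>UNIV. card {c \<in> C. ev \<tau> c = y}) = card (\<Union>y\<in>UNIV. {c \<in> C. ev \<tau> c = y})"
    by (subst card_UN_disjoint) auto
  moreover have "(\<Union>y\<in>UNIV. {c \<in> C. ev \<tau> c = y}) = C"
    by auto
  ultimately show ?thesis
    by (simp add: N_def card_C flip: of_nat_sum)
qed

lemma conic_vectors_inj:
  "inj_on (\<lambda>(\<tau>, k). k *s veronese \<tau>) (UNIV \<times> (UNIV - {0::'b}))"
proof (rule inj_onI)
  fix p p' :: "'b option \<times> 'b"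
  assume p: "p \<in> UNIV \<times> (UNIV - {0})" "p' \<in> UNIV \<times> (UNIV - {0})"
    "(\<lambda>(\<tau>, k). k *s veronese \<tau>) p = (\<lambda>(\<tau>, k). k *s veronese \<tau>) p'"
  obtain \<tau> k \<tau>' k' where pp: "p = (\<tau>, k)" "p' = (\<tau>', k')"
    by (metis surj_pair)
  hence k: "k \<noteq> 0" "k' \<noteq> 0" and eq: "k *s veronese \<tau> = k' *s veronese \<tau>'"
    using p by auto
  have "vec.span {veronese \<tau>} = vec.span {veronese \<tau>'}"
    using span_singleton_eqI[OF refl k(1), of "veronese \<tau>"]
      span_singleton_eqI[OF refl k(2), of "veronese \<tau>'"] eq by simp
  hence "\<tau> = \<tau>'"
    by (rule veronese_span_inj)
  moreover have "k = k'"
    using eq k veronese_neq_0[of \<tau>] calculation by simp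
  ultimately show "p = p'"
    by (simp add: pp)
qed

text \<open>Double counting of the pairs of a nonzero \<open>u\<close> and a \<open>c\<close> in
  \<open>C\<close> on which \<open>u\<close> takes the same value as on \<open>c0\<close>. A
  \<open>u\<close> off the conic contributes r, and each evaluation occurs with its r - 1 multiples.
  Conversely \<open>c = c0\<close> admits all r^3 - 1 functionals and every other \<open>c\<close>
  only r^2 - 1.\<close>

lemma sum_N_through: "(\<Sum>\<tau>\<in>UNIV. N \<tau> (ev \<tau> c0)) = r ^ 2 + (if c0 \<in> C then r ^ 2 else 0)"
proof -
  let ?V = "UNIV - {0} :: ('b ^ 3) set"
  let ?Q = "(\<lambda>(\<tau>, k). k *s veronese \<tau>) ` (UNIV \<times> (UNIV - {0::'b}))"
  define P where "P = (\<lambda>u. int (card {c \<in> C. dot3 u c = dot3 u c0}))"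
  have fin: "finite C"
    by simp
  have Q: "?Q \<subseteq> ?V"
    by (auto simp: veronese_neq_0)
  have card_V: "int (card ?V) = r ^ 3 - 1"
  proof -
    have "card ?V = CARD('b) ^ 3 - 1"
      by (simp add: card_Diff_subset)
    moreover have "1 \<le> CARD('b) ^ 3"
      by simp
    ultimately show ?thesis
      by (simp add: of_nat_diff)
  qed
  have card_units: "int (card (UNIV - {0::'b})) = r - 1"
    using card_field by (simp add: card_Diff_subset of_nat_diff)
  have card_Q: "int (card ?Q) = (r + 1) * (r - 1)"
    using card_image[OF conic_vectors_inj] card_units by (simp add: card_cartesian_product card_UNIV_option algebra_simps)
  have "(\<Sum>u\<in>?V. P u) = (\<Sum>u\<in>?Q. P u) + (\<Sum>u\<in>?V - ?Q. P u)"
    using sum.subset_diff[OF Q] by (simp add: add.commute)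
  also have "(\<Sum>u\<in>?V - ?Q. P u) = (\<Sum>u\<in>?V - ?Q. r)"
  proof (rule sum.cong)
    fix u assume u: "u \<in> ?V - ?Q"
    have "u \<noteq> k *s veronese \<tau>" for \<tau> k
    proof
      assume *: "u = k *s veronese \<tau>"
      hence "k \<noteq> 0"
        using u by auto
      hence "u \<in> ?Q"
        using * by (auto simp: image_iff)
      thus False
        using u by simp
    qed
    thus "P u = r"
      using card_C_plane[of u] u by (simp add: P_def)
  qed simp
  also have "\<dots> = (r ^ 3 - r ^ 2) * r"
  proof -
    have "int (card (?V - ?Q)) = int (card ?V) - int (card ?Q)"
      by (subst card_Diff_subset[OF finite Q]) (rule of_nat_diff, rule card_mono[OF finite Q])
    also have "\<dots> = r ^ 3 - r ^ 2"
      unfolding card_V card_Q by (simp add: algebra_simps power2_eq_square)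
    finally show ?thesis
      by simp
  qed
  also have "(\<Sum>u\<in>?Q. P u) = (\<Sum>\<tau>\<in>UNIV. (r - 1) * N \<tau> (ev \<tau> c0))"
  proof -
    have "(\<Sum>u\<in>?Q. P u) = (\<Sum>(\<tau>, k)\<in>UNIV \<times> (UNIV - {0}). P (k *s veronese \<tau>))"
      by (subst sum.reindex[OF conic_vectors_inj]) (simp add: case_prod_unfold)
    also have "\<dots> = (\<Sum>\<tau>\<in>UNIV. \<Sum>k\<in>UNIV - {0}. P (k *s veronese \<tau>))"
      by (rule sum.cartesian_product[symmetric])
    also have "\<dots> = (\<Sum>\<tau>\<in>UNIV. \<Sum>k\<in>UNIV - {0::'b}. N \<tau> (ev \<tau> c0))"
      by (intro sum.cong refl) (auto simp: P_def N_def dot3_scale_left)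
    finally show ?thesis
      using card_units by simp
  qed
  finally have 1: "(\<Sum>u\<in>?V. P u) = (r - 1) * (\<Sum>\<tau>\<in>UNIV. N \<tau> (ev \<tau> c0)) + (r ^ 3 - r ^ 2) * r"
    by (simp add: sum_distrib_left)
  have "(\<Sum>u\<in>?V. P u) = (\<Sum>u\<in>?V. \<Sum>c\<in>C. if dot3 u c = dot3 u c0 then 1 else 0)"
    by (simp add: P_def sum.If_cases Int_def)
  also have "\<dots> = (\<Sum>c\<in>C. \<Sum>u\<in>?V. if dot3 u c = dot3 u c0 then 1 else 0)"
    by (rule sum.swap)
  also have "\<dots> = (\<Sum>c\<in>C. r ^ 2 - 1 + (if c = c0 then r ^ 3 - r ^ 2 else 0))"
  proof (rule sum.cong)
    fix c
    have "(\<Sum>u\<in>?V. if dot3 u c = dot3 u c0 then 1 else 0) = int (card {u \<in> ?V. dot3 u (c - c0) = 0})"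
      by (simp add: sum.If_cases Int_def dot3_diff)
    also have "\<dots> = r ^ 2 - 1 + (if c = c0 then r ^ 3 - r ^ 2 else 0)"
    proof (cases "c = c0")
      case True
      hence "{u \<in> ?V. dot3 u (c - c0) = 0} = ?V"
        by (auto simp: dot3_def)
      thus ?thesis
        using card_V True by simp
    next
      case False
      have "{u \<in> ?V. dot3 u (c - c0) = 0} = {u. dot3 (c - c0) u = 0} - {0}"
        by (auto simp: dot3_commute)
      moreover have "card {u. dot3 (c - c0) u = 0} = CARD('b) ^ 2"
        using False by (intro card_plane) simp
      moreover have "0 \<in> {u. dot3 (c - c0) u = 0}"
        by (simp add: dot3_def)
      moreover have "1 \<le> CARD('b) ^ 2"
        by simp
      ultimately show ?thesis
        using False by (simp add: card_Diff_singleton of_nat_diff)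
    qed
    finally show "(\<Sum>u\<in>?V. if dot3 u c = dot3 u c0 then 1 else 0)
        = r ^ 2 - 1 + (if c = c0 then r ^ 3 - r ^ 2 else 0)" .
  qed simp
  also have "\<dots> = r ^ 2 * (r ^ 2 - 1) + (if c0 \<in> C then r ^ 3 - r ^ 2 else 0)"
    by (simp add: sum.distrib card_C)
  finally have 2: "(\<Sum>u\<in>?V. P u) = r ^ 2 * (r ^ 2 - 1) + (if c0 \<in> C then r ^ 3 - r ^ 2 else 0)" .
  have "(r - 1) * (\<Sum>\<tau>\<in>UNIV. N \<tau> (ev \<tau> c0)) = (r - 1) * (r ^ 2 + (if c0 \<in> C then r ^ 2 else 0))"
    using 1 2 by (cases "c0 \<in> C") (simp_all add: algebra_simps power2_eq_square power3_eq_cube)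
  thus ?thesis
    using r_ge_3 by simp
qed

text \<open>The deviation from the mean: r^2 elements are spread over r values. Centring makes the
  sums over the field vanish, which removes the other evaluations below.\<close>

definition d :: "'b option \<Rightarrow> 'b \<Rightarrow> int" where
  "d \<tau> y = N \<tau> y - r"

lemma sum_d_through: "(\<Sum>\<tau>\<in>UNIV. d \<tau> (ev \<tau> c)) = (if c \<in> C then r ^ 2 else 0) - r"
  by (simp add: d_def sum_subtractf sum_N_through card_UNIV_option power2_eq_square algebra_simps)

lemma sum_d: "(\<Sum>y\<in>UNIV. d \<tau> y) = 0"
  by (simp add: d_def sum_subtractf sum_N power2_eq_square)

text \<open>Sum \<open>sum_d_through\<close> along the line. Every evaluation other than
  \<open>\<tau>\<close> and \<open>\<sigma>\<close> runs through the whole field once there, so its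
  deviations cancel; those at \<open>\<tau>\<close> and \<open>\<sigma>\<close> are
  constant.\<close>

lemma card_C_line:
  assumes ne: "\<tau> \<noteq> \<sigma>"
  shows "r * int (card {c \<in> C. ev \<tau> c = y \<and> ev \<sigma> c = x}) = r + d \<tau> y + d \<sigma> x"
proof -
  let ?L = "{c. ev \<tau> c = y \<and> ev \<sigma> c = x}"
  have det: "det3 (veronese \<tau>) (veronese \<sigma>) (veronese \<omega>) \<noteq> 0" if "\<omega> \<noteq> \<tau>" "\<omega> \<noteq> \<sigma>" for \<omega>
    using det3_veronese ne that by metis
  have "3 \<le> CARD('b option)"
    using card_field by (simp add: card_UNIV_option)
  then obtain \<omega>' where "\<omega>' \<noteq> \<tau>" "\<omega>' \<noteq> \<sigma>"
    using exists_third by blast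
  hence card_L: "int (card ?L) = r"
    using card_line[OF det] by simp
  have other: "(\<Sum>c\<in>?L. d \<omega> (ev \<omega> c)) = 0" if "\<omega> \<noteq> \<tau>" "\<omega> \<noteq> \<sigma>" for \<omega>
    using sum.reindex_bij_betw[OF dot3_bij_line[OF det[OF that]], of "d \<omega>"] by (simp add: sum_d)
  have "r ^ 2 * int (card {c \<in> C. ev \<tau> c = y \<and> ev \<sigma> c = x}) = (\<Sum>c\<in>?L. if c \<in> C then r ^ 2 else 0)"
    by (simp add: sum.If_cases Int_def conj_commute)
  also have "\<dots> = (\<Sum>c\<in>?L. r + (\<Sum>\<omega>\<in>UNIV. d \<omega> (ev \<omega> c)))"
    by (simp add: sum_d_through)
  also have "\<dots> = r * r + (\<Sum>\<omega>\<in>UNIV. \<Sum>c\<in>?L. d \<omega> (ev \<omega> c))"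
    by (simp add: sum.distrib card_L) (rule sum.swap)
  also have "(\<Sum>\<omega>\<in>UNIV. \<Sum>c\<in>?L. d \<omega> (ev \<omega> c)) = (\<Sum>\<omega>\<in>{\<tau>, \<sigma>}. \<Sum>c\<in>?L. d \<omega> (ev \<omega> c))"
    by (rule sum.mono_neutral_right) (auto intro: other)
  also have "\<dots> = r * d \<tau> y + r * d \<sigma> x"
    using ne card_L by simp
  finally have "r * (r * int (card {c \<in> C. ev \<tau> c = y \<and> ev \<sigma> c = x})) = r * (r + d \<tau> y + d \<sigma> x)"
    by (simp add: power2_eq_square algebra_simps)
  thus ?thesis
    using r_ge_3 by simp
qed

text \<open>
  This is the identity \<open>f\<^sup>2 = f\<close> for the indicator function \<open>f\<close> of \<open>C\<close>, summed over a plane. As the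
  right-hand side does not depend on \<open>y\<close>, any two distinct values of \<open>N \<tau>\<close> have the sum \<open>r\<^sup>2\<close>.
\<close>

lemma N_quadratic:
  "r * (N \<tau> y * (r ^ 2 - N \<tau> y)) = (\<Sum>\<sigma>\<in>UNIV - {\<tau>}. \<Sum>x\<in>UNIV. d \<sigma> x ^ 2)"
proof -
  let ?P = "{c \<in> C. ev \<tau> c = y}"
  \<comment> \<open>The plane is split by the value of \<open>\<sigma>\<close>, and
    \<open>card_C_line\<close> gives the size of each part. The linear terms vanish by
    \<open>sum_d\<close>, so only the squares survive.\<close>
  have other: "r * (\<Sum>c\<in>?P. d \<sigma> (ev \<sigma> c)) = (\<Sum>x\<in>UNIV. d \<sigma> x ^ 2)" if "\<sigma> \<noteq> \<tau>" for \<sigma>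
  proof -
    have "(\<Sum>c\<in>?P. d \<sigma> (ev \<sigma> c)) = (\<Sum>x\<in>UNIV. \<Sum>c\<in>{c \<in> ?P. ev \<sigma> c = x}. d \<sigma> (ev \<sigma> c))"
      by (rule sum.group[symmetric]) auto
    also have "\<dots> = (\<Sum>x\<in>UNIV. int (card {c \<in> C. ev \<tau> c = y \<and> ev \<sigma> c = x}) * d \<sigma> x)"
      by (intro sum.cong) (auto simp: conj_assoc)
    finally have "r * (\<Sum>c\<in>?P. d \<sigma> (ev \<sigma> c))
        = (\<Sum>x\<in>UNIV. (r * int (card {c \<in> C. ev \<tau> c = y \<and> ev \<sigma> c = x})) * d \<sigma> x)"
      by (simp add: sum_distrib_left mult.assoc)
    also have "\<dots> = (\<Sum>x\<in>UNIV. (r + d \<tau> y) * d \<sigma> x + d \<sigma> x ^ 2)"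
      using that by (simp add: card_C_line power2_eq_square algebra_simps)
    also have "\<dots> = (\<Sum>x\<in>UNIV. d \<sigma> x ^ 2)"
      by (simp add: sum.distrib sum_d flip: sum_distrib_left)
    finally show ?thesis .
  qed
  have "r ^ 2 * N \<tau> y = (\<Sum>c\<in>?P. r + (\<Sum>\<sigma>\<in>UNIV. d \<sigma> (ev \<sigma> c)))"
    by (simp add: sum_d_through N_def)
  also have "\<dots> = r * N \<tau> y + (\<Sum>\<sigma>\<in>UNIV. \<Sum>c\<in>?P. d \<sigma> (ev \<sigma> c))"
    by (simp add: sum.distrib N_def) (rule sum.swap)
  also have "(\<Sum>\<sigma>\<in>UNIV. \<Sum>c\<in>?P. d \<sigma> (ev \<sigma> c))
      = N \<tau> y * d \<tau> y + (\<Sum>\<sigma>\<in>UNIV - {\<tau>}. \<Sum>c\<in>?P. d \<sigma> (ev \<sigma> c))"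
    by (subst sum.remove[of _ \<tau>]) (simp_all add: N_def)
  finally have "N \<tau> y * (r ^ 2 - N \<tau> y) = (\<Sum>\<sigma>\<in>UNIV - {\<tau>}. \<Sum>c\<in>?P. d \<sigma> (ev \<sigma> c))"
    by (simp add: d_def algebra_simps)
  hence "r * (N \<tau> y * (r ^ 2 - N \<tau> y)) = (\<Sum>\<sigma>\<in>UNIV - {\<tau>}. r * (\<Sum>c\<in>?P. d \<sigma> (ev \<sigma> c)))"
    by (simp add: sum_distrib_left)
  also have "\<dots> = (\<Sum>\<sigma>\<in>UNIV - {\<tau>}. \<Sum>x\<in>UNIV. d \<sigma> x ^ 2)"
    by (intro sum.cong) (auto intro: other)
  finally show ?thesis .
qed

theorem is_plane: "\<exists>\<tau> y. C = {c. ev \<tau> c = y}"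
proof -
  note r3 = r_ge_3
  \<comment> \<open>If all deviations were zero, \<open>sum_d_through\<close> would make the
    indicator function constant and equal to 1/r.\<close>
  have "\<exists>\<tau> y. N \<tau> y \<noteq> r"
  proof (rule ccontr)
    assume "\<not> ?thesis"
    hence "d = (\<lambda>_ _. 0)"
      by (simp add: d_def fun_eq_iff)
    hence "(if 0 \<in> C then r ^ 2 else 0) = r"
      using sum_d_through[of 0] by simp
    thus False
      using r3 by (auto simp: power2_eq_square split: if_splits)
  qed
  then obtain \<tau> where "\<exists>y. N \<tau> y \<noteq> r"
    by blast
  have "\<exists>y1 y2. N \<tau> y1 \<noteq> N \<tau> y2"
  proof (rule ccontr)
    assume "\<not> ?thesis"
    hence const: "N \<tau> y = N \<tau> 0" for y
      by blast
    have "(\<Sum>y\<in>UNIV. N \<tau> y) = (\<Sum>y\<in>(UNIV :: 'b set). N \<tau> 0)"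
      by (intro sum.cong const refl)
    hence "(\<Sum>y\<in>UNIV. N \<tau> y) = r * N \<tau> 0"
      by simp
    hence "N \<tau> 0 = r"
      using r3 by (simp add: sum_N power2_eq_square)
    thus False
      using \<open>\<exists>y. N \<tau> y \<noteq> r\<close> const by metis
  qed
  then obtain y1 y2 where ne: "N \<tau> y1 \<noteq> N \<tau> y2"
    by blast
  \<comment> \<open>Two distinct values of \<open>N \<tau>\<close> already add up to the total
    \<open>r ^ 2\<close>. So the value at a third element is 0, and the quadratic equation then
    leaves only 0 and \<open>r ^ 2\<close>.\<close>
  obtain y3 where y3: "y3 \<noteq> y1" "y3 \<noteq> y2"
    using exists_third[OF card_field] by blast
  have eq: "N \<tau> y * (r ^ 2 - N \<tau> y) = N \<tau> y' * (r ^ 2 - N \<tau> y')" for y y'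
  proof -
    have "r * (N \<tau> y * (r ^ 2 - N \<tau> y)) = r * (N \<tau> y' * (r ^ 2 - N \<tau> y'))"
      by (simp only: N_quadratic)
    moreover have "r \<noteq> 0"
      using r3 by simp
    ultimately show ?thesis
      by (simp only: mult_cancel_left) simp
  qed
  have "(N \<tau> y1 - N \<tau> y2) * (r ^ 2 - N \<tau> y1 - N \<tau> y2) = 0"
    using eq[of y1 y2] by (simp add: algebra_simps)
  hence "N \<tau> y1 + N \<tau> y2 = r ^ 2"
    using ne by simp
  moreover have "(\<Sum>y\<in>{y1, y2, y3}. N \<tau> y) \<le> (\<Sum>y\<in>UNIV. N \<tau> y)"
    by (rule sum_mono2) (auto simp: N_def)
  moreover have "N \<tau> y3 \<ge> 0"
    by (simp add: N_def)
  moreover have "y1 \<noteq> y2"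
    using ne by auto
  ultimately have "N \<tau> y3 = 0"
    using y3 by (simp add: sum_N)
  hence "N \<tau> y1 = 0 \<or> N \<tau> y1 = r ^ 2"
    using eq[of y1 y3] by auto
  then obtain y where "N \<tau> y = r ^ 2"
    using \<open>N \<tau> y1 + N \<tau> y2 = r ^ 2\<close> by auto
  hence "int (card {c \<in> C. ev \<tau> c = y}) = int (card C)"
      "int (card {c \<in> C. ev \<tau> c = y}) = int (CARD('b) ^ 2)"
    using card_C by (simp_all add: N_def)
  hence card: "card {c \<in> C. ev \<tau> c = y} = card C" "card {c \<in> C. ev \<tau> c = y} = CARD('b) ^ 2"
    by (simp_all only: of_nat_eq_iff)
  hence "{c \<in> C. ev \<tau> c = y} = C"
    by (intro card_subset_eq) auto
  hence "C \<subseteq> {c. ev \<tau> c = y}"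
    by auto
  moreover have "card C = card {c. ev \<tau> c = y}"
    using card by (simp add: card_plane[OF veronese_neq_0])
  ultimately have "C = {c. ev \<tau> c = y}"
    by (intro card_subset_eq) auto
  thus ?thesis
    by blast
qed

end

section \<open>Orthogonal arrays and Laguerre planes\<close>

lemma orthogonal_array_ex1:
  assumes oa: "orthogonal_array 3 m k 1 M Cols A"
    and ijh: "i \<in> {1..k}" "j \<in> {1..k}" "h \<in> {1..k}" "i \<noteq> j" "j \<noteq> h" "i \<noteq> h"
    and xyz: "x \<in> M" "y \<in> M" "z \<in> M"
  shows "\<exists>!c. c \<in> Cols \<and> A i c = x \<and> A j c = y \<and> A h c = z"
proof -
  define f where "f = (\<lambda>t. if t = i then x else if t = j then y else z)"
  have "card {c \<in> Cols. \<forall>t\<in>T. A t c = f t} = 1" if "T \<subseteq> {1..k}" "card T = 3" "f ` T \<subseteq> M" for T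
    using oa that by (simp add: orthogonal_array_def)
  from this[of "{i, j, h}"] have "card {c \<in> Cols. \<forall>t\<in>{i, j, h}. A t c = f t} = 1"
    using ijh xyz by (simp add: f_def)
  then obtain c0 where "{c \<in> Cols. \<forall>t\<in>{i, j, h}. A t c = f t} = {c0}"
    by (auto simp: card_1_singleton_iff)
  moreover have "{c \<in> Cols. \<forall>t\<in>{i, j, h}. A t c = f t} = {c \<in> Cols. A i c = x \<and> A j c = y \<and> A h c = z}"
    using ijh by (auto simp: f_def)
  ultimately have "{c \<in> Cols. A i c = x \<and> A j c = y \<and> A h c = z} = {c0}"
    by simp
  hence "c \<in> Cols \<and> A i c = x \<and> A j c = y \<and> A h c = z \<longleftrightarrow> c = c0" for c
    by (simp add: set_eq_iff)
  thus ?thesis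
    by simp
qed

lemma orthogonal_array_values:
  assumes "orthogonal_array t m k l M Cols A" "i \<in> {1..k}" "c \<in> Cols"
  shows "A i c \<in> M"
  using assms unfolding orthogonal_array_def by blast

text \<open>
  The tangency axiom is a count: of the \<open>m\<close> circles through \<open>p\<close> and \<open>q\<close>, each of the \<open>m - 1\<close>
  remaining lines excludes exactly one, the circle meeting \<open>c\<close> on that line.
\<close>

lemma orthogonal_array_tangent:
  assumes oa: "orthogonal_array 3 m (m + 1) 1 M Cols A" and m: "2 \<le> m"
    and c: "c \<in> Cols" and ij: "i \<in> {1..m + 1}" "j \<in> {1..m + 1}" "i \<noteq> j"
    and y: "y \<in> M" "A j c \<noteq> y"
  shows "\<exists>!d. d \<in> Cols \<and> A i d = A i c \<and> A j d = y \<and> (\<forall>h\<in>{1..m + 1}. A h d = A h c \<longrightarrow> h = i)"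
proof -
  define S where "S = {d \<in> Cols. A i d = A i c \<and> A j d = y}"
  define R where "R = {1..m + 1} - {i, j}"
  have fin: "finite Cols" "finite M" "card M = m"
    using oa by (auto simp: orthogonal_array_def)
  have "card R = m + 1 - card {i, j}"
    unfolding R_def by (subst card_Diff_subset) (use ij in auto)
  hence card_R: "card R = m - 1"
    using ij by simp
  have M: "A h d \<in> M" if "h \<in> {1..m + 1}" "d \<in> Cols" for h d
    using orthogonal_array_values[OF oa] that by blast
  have ex1: "\<exists>!d. d \<in> S \<and> A h d = z" if "h \<in> R" "z \<in> M" for h z
    using orthogonal_array_ex1[OF oa, of i j h "A i c" y z] that ij y M c
    by (simp add: S_def R_def conj_assoc)
  obtain h0 where h0: "h0 \<in> R"
    using card_R m by (metis One_nat_def Suc_1 Suc_le_lessD card.empty diff_is_0_eq ex_in_conv not_less)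
  have "bij_betw (A h0) S M"
    unfolding bij_betw_def
  proof
    have MS: "A h0 d \<in> M" if "d \<in> S" for d
      using M h0 that by (auto simp: S_def R_def)
    show "inj_on (A h0) S"
      using ex1[OF h0] MS by (metis inj_onI)
    have "z \<in> A h0 ` S" if "z \<in> M" for z
      using ex1_implies_ex[OF ex1[OF h0 that]] by blast
    thus "A h0 ` S = M"
      using MS by auto
  qed
  hence card_S: "card S = m"
    using bij_betw_same_card fin by auto
  have "\<exists>g. \<forall>h\<in>R. g h \<in> S \<and> A h (g h) = A h c \<and> (\<forall>d\<in>S. A h d = A h c \<longrightarrow> d = g h)"
  proof (rule bchoice, rule ballI)
    fix h assume h: "h \<in> R"
    hence "A h c \<in> M"
      using M c by (auto simp: R_def)
    from ex1[OF h this] show "\<exists>d. d \<in> S \<and> A h d = A h c \<and> (\<forall>d'\<in>S. A h d' = A h c \<longrightarrow> d' = d)"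
      by blast
  qed
  then obtain g where g: "\<And>h. h \<in> R \<Longrightarrow> g h \<in> S" "\<And>h. h \<in> R \<Longrightarrow> A h (g h) = A h c"
      "\<And>h d. h \<in> R \<Longrightarrow> d \<in> S \<Longrightarrow> A h d = A h c \<Longrightarrow> d = g h"
    by blast
  \<comment> \<open>A circle meeting \<open>c\<close> on two of the remaining lines would share
    three points with it, counting the one on line \<open>i\<close>. It would be \<open>c\<close>,
    which does not pass through the point \<open>y\<close> of line \<open>j\<close>.\<close>
  have "inj_on g R"
  proof (rule inj_onI, rule ccontr)
    fix h h' assume h: "h \<in> R" "h' \<in> R" "g h = g h'" "h \<noteq> h'"
    have "g h \<in> Cols" "A i (g h) = A i c" "A j (g h) = y"
      using g(1)[OF h(1)] by (auto simp: S_def)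
    moreover have "A h' (g h) = A h' c"
      using g(2)[OF h(2)] h(3) by simp
    ultimately have "g h = c"
      using orthogonal_array_ex1[OF oa, of i h h' "A i c" "A h c" "A h' c"] h g(2)[OF h(1)] ij M c
      by (auto simp: R_def)
    thus False
      using \<open>A j (g h) = y\<close> y by simp
  qed
  hence "card (g ` R) = m - 1"
    using card_R by (simp add: card_image)
  moreover have "g ` R \<subseteq> S"
    using g(1) by blast
  moreover have "finite S"
    using fin by (simp add: S_def)
  ultimately have "card (S - g ` R) = 1"
    using card_S m by (subst card_Diff_subset) (auto intro: finite_subset)
  then obtain d0 where d0: "S - g ` R = {d0}"
    by (auto simp: card_1_singleton_iff)
  have "d \<in> Cols \<and> A i d = A i c \<and> A j d = y \<and> (\<forall>h\<in>{1..m + 1}. A h d = A h c \<longrightarrow> h = i)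
      \<longleftrightarrow> d \<in> S - g ` R" for d
  proof
    assume d: "d \<in> Cols \<and> A i d = A i c \<and> A j d = y \<and> (\<forall>h\<in>{1..m + 1}. A h d = A h c \<longrightarrow> h = i)"
    have "d \<noteq> g h" if "h \<in> R" for h
      using d g(2)[OF that] that by (auto simp: R_def)
    thus "d \<in> S - g ` R"
      using d by (auto simp: S_def)
  next
    assume d: "d \<in> S - g ` R"
    have "h = i" if "h \<in> {1..m + 1}" "A h d = A h c" for h
    proof (rule ccontr)
      assume "h \<noteq> i"
      moreover have "h \<noteq> j"
        using that d y by (auto simp: S_def)
      ultimately have "h \<in> R"
        using that by (simp add: R_def)
      thus False
        using g(3) d that by blast
    qed
    thus "d \<in> Cols \<and> A i d = A i c \<and> A j d = y \<and> (\<forall>h\<in>{1..m + 1}. A h d = A h c \<longrightarrow> h = i)"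
      using d by (auto simp: S_def)
  qed
  thus ?thesis
    by (simp add: d0)
qed

text \<open>The first three axioms restate that the rows are functions and that the strength is 3;
  the number m + 1 of rows enters through tangency.\<close>

theorem orthogonal_array_laguerre_plane:
  assumes oa: "orthogonal_array 3 m (m + 1) 1 M Cols A" and m: "2 \<le> m"
  shows "laguerre_plane (array_points (m + 1) M) {1..m + 1} Cols array_onl (array_onc A)"
  unfolding laguerre_plane_def
proof (intro conjI ballI impI)
  fix p assume "p \<in> array_points (m + 1) M"
  thus "\<exists>!l. l \<in> {1..m + 1} \<and> array_onl p l"
    by (auto simp: array_onl_def)
next
  fix c l assume "c \<in> Cols" "l \<in> {1..m + 1}"
  moreover from this have "A l c \<in> M"
    using orthogonal_array_values[OF oa] by blast
  ultimately show "\<exists>!p. p \<in> array_points (m + 1) M \<and> array_onl p l \<and> array_onc A p c"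
    by (intro ex1I[of _ "(l, A l c)"]) (auto simp: array_onl_def array_onc_def)
next
  fix p q t assume pqt: "p \<in> array_points (m + 1) M" "q \<in> array_points (m + 1) M" "t \<in> array_points (m + 1) M"
    and *: "\<not> (\<exists>l\<in>{1..m + 1}. array_onl p l \<and> array_onl q l) \<and>
      \<not> (\<exists>l\<in>{1..m + 1}. array_onl q l \<and> array_onl t l) \<and>
      \<not> (\<exists>l\<in>{1..m + 1}. array_onl p l \<and> array_onl t l)"
  have "fst p \<noteq> fst q" "fst q \<noteq> fst t" "fst p \<noteq> fst t"
    using pqt * by (auto simp: array_onl_def)
  thus "\<exists>!c. c \<in> Cols \<and> array_onc A p c \<and> array_onc A q c \<and> array_onc A t c"
    unfolding array_onc_def
    using pqt by (intro orthogonal_array_ex1[OF oa]) auto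
next
  fix c p q assume c: "c \<in> Cols" and p: "p \<in> array_points (m + 1) M" and q: "q \<in> array_points (m + 1) M"
    and *: "array_onc A p c \<and> \<not> array_onc A q c \<and> \<not> (\<exists>l\<in>{1..m + 1}. array_onl p l \<and> array_onl q l)"
  have ne: "fst p \<noteq> fst q"
    using p q * by (auto simp: array_onl_def)
  have M: "A h c \<in> M" if "h \<in> {1..m + 1}" for h
    using orthogonal_array_values[OF oa that c] .
  have "\<exists>!d. d \<in> Cols \<and> A (fst p) d = A (fst p) c \<and> A (fst q) d = snd q \<and>
      (\<forall>h\<in>{1..m + 1}. A h d = A h c \<longrightarrow> h = fst p)"
    using p q * ne by (intro orthogonal_array_tangent[OF oa m c]) (auto simp: array_onc_def)
  moreover have "(\<forall>h\<in>{1..m + 1}. A h d = A h c \<longrightarrow> h = fst p) \<longleftrightarrow>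
      (\<forall>x\<in>array_points (m + 1) M. array_onc A x c \<and> array_onc A x d \<longrightarrow> x = p)" for d
  proof
    assume tang: "\<forall>h\<in>{1..m + 1}. A h d = A h c \<longrightarrow> h = fst p"
    show "\<forall>x\<in>array_points (m + 1) M. array_onc A x c \<and> array_onc A x d \<longrightarrow> x = p"
    proof (intro ballI impI)
      fix x assume x: "x \<in> array_points (m + 1) M" "array_onc A x c \<and> array_onc A x d"
      hence "fst x \<in> {1..m + 1}" "A (fst x) d = A (fst x) c"
        by (auto simp: array_onc_def)
      hence "fst x = fst p"
        using tang by blast
      moreover from this have "snd x = snd p"
        using x * by (simp add: array_onc_def)
      ultimately show "x = p"
        by (simp add: prod_eq_iff)
    qed
  next
    assume tang: "\<forall>x\<in>array_points (m + 1) M. array_onc A x c \<and> array_onc A x d \<longrightarrow> x = p"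
    show "\<forall>h\<in>{1..m + 1}. A h d = A h c \<longrightarrow> h = fst p"
    proof (intro ballI impI)
      fix h assume h: "h \<in> {1..m + 1}" "A h d = A h c"
      hence "(h, A h c) \<in> array_points (m + 1) M" "array_onc A (h, A h c) c \<and> array_onc A (h, A h c) d"
        using M by (auto simp: array_onc_def)
      hence "(h, A h c) = p"
        using tang by blast
      thus "h = fst p"
        by auto
    qed
  qed
  ultimately show "\<exists>!d. d \<in> Cols \<and> array_onc A p d \<and> array_onc A q d \<and>
      (\<forall>x\<in>array_points (m + 1) M. array_onc A x c \<and> array_onc A x d \<longrightarrow> x = p)"
    using * by (simp add: array_onc_def)
qed

section \<open>Coordinates of an array\<close>

text \<open>
  The rows of the array are, up to the names of the symbols, evaluations of polynomials of degree
  at most \<open>2\<close> at distinct elements of the field or at infinity.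
\<close>

definition coordinates ::
    "nat \<Rightarrow> 'm set \<Rightarrow> 'c set \<Rightarrow> (nat \<Rightarrow> 'c \<Rightarrow> 'm) \<Rightarrow>
      ('c \<Rightarrow> 'b::field ^ 3) \<Rightarrow> (nat \<Rightarrow> 'b option) \<Rightarrow> (nat \<Rightarrow> 'b \<Rightarrow> 'm) \<Rightarrow> bool" where
  "coordinates k M Cols A \<theta> \<tau> l \<longleftrightarrow> bij_betw \<theta> Cols UNIV \<and> inj_on \<tau> {1..k} \<and>
     (\<forall>i\<in>{1..k}. bij_betw (l i) UNIV M \<and> (\<forall>c\<in>Cols. A i c = l i (ev (\<tau> i) (\<theta> c))))"

lemma coordinates_ex1:
  assumes coord: "coordinates k M Cols A \<theta> \<tau> l"
    and ijh: "i \<in> {1..k}" "j \<in> {1..k}" "h \<in> {1..k}" "i \<noteq> j" "j \<noteq> h" "i \<noteq> h"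
    and xyz: "x \<in> M" "y \<in> M" "z \<in> M"
  shows "\<exists>!c. c \<in> Cols \<and> A i c = x \<and> A j c = y \<and> A h c = z"
proof -
  have l: "bij_betw (l t) UNIV M" "\<And>c. c \<in> Cols \<Longrightarrow> A t c = l t (ev (\<tau> t) (\<theta> c))" if "t \<in> {1..k}" for t
    using coord that unfolding coordinates_def by blast+
  have \<theta>: "bij_betw \<theta> Cols UNIV" and \<tau>: "inj_on \<tau> {1..k}"
    using coord unfolding coordinates_def by blast+
  obtain x' y' z' where xyz': "x = l i x'" "y = l j y'" "z = l h z'"
    using l(1)[OF ijh(1)] l(1)[OF ijh(2)] l(1)[OF ijh(3)] xyz by (metis bij_betw_imp_surj_on imageE)
  have inj: "l t u = l t v \<longleftrightarrow> u = v" if "t \<in> {1..k}" for t u v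
    using l(1)[OF that] by (simp add: bij_betw_def inj_eq)
  have "det3 (veronese (\<tau> i)) (veronese (\<tau> j)) (veronese (\<tau> h)) \<noteq> 0"
    using \<tau> ijh by (intro det3_veronese) (auto dest: inj_onD)
  from dot3_solve[OF this, of x' y' z'] obtain v where
    v: "\<And>w. ev (\<tau> i) w = x' \<and> ev (\<tau> j) w = y' \<and> ev (\<tau> h) w = z' \<longleftrightarrow> w = v"
    by metis
  obtain c where c: "c \<in> Cols" "\<theta> c = v"
    using \<theta> by (metis UNIV_I bij_betw_imp_surj_on imageE)
  have "d \<in> Cols \<and> A i d = x \<and> A j d = y \<and> A h d = z \<longleftrightarrow> d \<in> Cols \<and> \<theta> d = v" for d
    unfolding v[symmetric] xyz' using ijh by (auto simp: l(2) inj)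
  moreover have "d \<in> Cols \<and> \<theta> d = v \<longleftrightarrow> d = c" for d
    using \<theta> c by (metis bij_betw_imp_inj_on inj_on_def)
  ultimately show ?thesis
    by simp
qed

lemma coordinates_orthogonal_array:
  fixes \<theta> :: "'c \<Rightarrow> 'b::{field,finite} ^ 3"
  assumes coord: "coordinates k M Cols A \<theta> \<tau> l" and k: "1 \<le> k"
  shows "orthogonal_array 3 CARD('b) k 1 M Cols A"
  unfolding orthogonal_array_def
proof (intro conjI ballI allI impI)
  have l: "bij_betw (l t) UNIV M" "\<And>c. c \<in> Cols \<Longrightarrow> A t c = l t (ev (\<tau> t) (\<theta> c))" if "t \<in> {1..k}" for t
    using coord that unfolding coordinates_def by blast+
  have \<theta>: "bij_betw \<theta> Cols UNIV"
    using coord unfolding coordinates_def by blast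
  have "1 \<in> {1..k}"
    using k by simp
  note bij = l(1)[OF this]
  show "finite M" "card M = CARD('b)"
    using bij_betw_finite[OF bij] bij_betw_same_card[OF bij] by simp_all
  show "finite Cols" "card Cols = 1 * CARD('b) ^ 3"
    using bij_betw_finite[OF \<theta>] bij_betw_same_card[OF \<theta>] by auto
  show "A i c \<in> M" if "i \<in> {1..k}" "c \<in> Cols" for i c
    using l[OF that(1)] that(2) by (auto simp: bij_betw_def)
  fix T f assume T: "T \<subseteq> {1..k} \<and> card T = 3" and f: "f ` T \<subseteq> M"
  then obtain i j h where ijh: "T = {i, j, h}" "i \<noteq> j" "j \<noteq> h" "i \<noteq> h"
    by (auto simp: card_3_iff)
  have "\<exists>!c. c \<in> Cols \<and> A i c = f i \<and> A j c = f j \<and> A h c = f h"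
    using T f ijh by (intro coordinates_ex1[OF coord]) auto
  then obtain c where "\<And>d. d \<in> Cols \<and> A i d = f i \<and> A j d = f j \<and> A h d = f h \<longleftrightarrow> d = c"
    by metis
  hence "{c \<in> Cols. \<forall>i\<in>T. A i c = f i} = {c}"
    by (auto simp: ijh)
  thus "card {c \<in> Cols. \<forall>i\<in>T. A i c = f i} = 1"
    by simp
qed

text \<open>
  A level set of a new row is transversal, hence a plane \<open>ev t c = y\<close>. Distinct level sets are
  disjoint, so that \<open>t\<close> depends on the row only.
\<close>

lemma new_row_coordinates:
  fixes \<theta> :: "'c \<Rightarrow> 'b::{field,finite} ^ 3"
  assumes card: "3 \<le> CARD('b)"
    and coord: "coordinates s M Cols A \<theta> \<tau> l"
    and oa: "orthogonal_array 3 CARD('b) k 1 M Cols A" and k: "s \<le> k"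
    and secant: "\<And>u. u \<noteq> 0 \<Longrightarrow> (\<And>\<tau> k. u \<noteq> k *s veronese \<tau>) \<Longrightarrow>
      \<exists>a\<in>\<tau> ` {1..s}. \<exists>b\<in>\<tau> ` {1..s}. a \<noteq> b \<and> u \<in> vec.span {veronese a, veronese b}"
    and i: "i \<in> {1..k}" "i \<notin> {1..s}"
  shows "\<exists>t g. bij_betw g UNIV M \<and> (\<forall>c\<in>Cols. A i c = g (ev t (\<theta> c)))"
proof -
  have l: "bij_betw (l t) UNIV M" "\<And>c. c \<in> Cols \<Longrightarrow> A t c = l t (ev (\<tau> t) (\<theta> c))" if "t \<in> {1..s}" for t
    using coord that unfolding coordinates_def by blast+
  have \<theta>: "bij_betw \<theta> Cols UNIV"
    using coord unfolding coordinates_def by blast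
  have M: "finite M" "card M = CARD('b)"
    using oa by (auto simp: orthogonal_array_def)
  have "\<exists>t y. \<theta> ` {c \<in> Cols. A i c = z} = {v. ev t v = y}" if z: "z \<in> M" for z
  proof -
    let ?C = "\<theta> ` {c \<in> Cols. A i c = z}"
    have "transversal ?C (\<tau> ` {1..s}) (int CARD('b))"
    proof (unfold_locales, rule card, rule refl)
      fix a b x y assume "a \<in> \<tau> ` {1..s}" "b \<in> \<tau> ` {1..s}" "a \<noteq> b"
      then obtain j h where jh: "j \<in> {1..s}" "h \<in> {1..s}" "a = \<tau> j" "b = \<tau> h" "j \<noteq> h"
        by blast
      have inj: "l t u = l t v \<longleftrightarrow> u = v" if "t \<in> {1..s}" for t u v
        using l(1)[OF that] by (simp add: bij_betw_def inj_eq)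
      have "\<exists>!c. c \<in> Cols \<and> A i c = z \<and> A j c = l j x \<and> A h c = l h y"
        using i jh k z l(1)[OF jh(1)] l(1)[OF jh(2)]
        by (intro orthogonal_array_ex1[OF oa]) (auto simp: bij_betw_def)
      then obtain c where c: "\<And>d. d \<in> Cols \<and> A i d = z \<and> A j d = l j x \<and> A h d = l h y \<longleftrightarrow> d = c"
        by metis
      have "{v \<in> ?C. ev a v = x \<and> ev b v = y} = \<theta> ` {d \<in> Cols. A i d = z \<and> A j d = l j x \<and> A h d = l h y}"
        using jh by (auto simp: l(2) inj)
      also have "\<dots> = {\<theta> c}"
        unfolding c by simp
      finally show "card {v \<in> ?C. ev a v = x \<and> ev b v = y} = 1"
        by simp
    qed (rule secant)
    thus ?thesis
      by (rule transversal.is_plane)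
  qed
  hence "\<forall>z\<in>M. \<exists>p. \<theta> ` {c \<in> Cols. A i c = z} = {v. ev (fst p) v = snd p}"
    by simp
  from bchoice[OF this] obtain p where
    "\<forall>z\<in>M. \<theta> ` {c \<in> Cols. A i c = z} = {v. ev (fst (p z)) v = snd (p z)}" ..
  hence p: "\<theta> ` {c \<in> Cols. A i c = z} = {v. ev (fst (p z)) v = snd (p z)}" if "z \<in> M" for z
    using that by blast
  have disjoint: "z = z'" if z: "z \<in> M" "z' \<in> M" "ev (fst (p z)) v = snd (p z)" "ev (fst (p z')) v = snd (p z')" for z z' v
  proof -
    have "v \<in> \<theta> ` {c \<in> Cols. A i c = z}" "v \<in> \<theta> ` {c \<in> Cols. A i c = z'}"
      using z by (simp_all add: p)
    then obtain c c' where "c \<in> Cols" "A i c = z" "c' \<in> Cols" "A i c' = z'" "\<theta> c = \<theta> c'"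
      by auto
    thus ?thesis
      using \<theta> by (metis bij_betw_imp_inj_on inj_on_def)
  qed
  \<comment> \<open>Planes belonging to different parameters intersect, and a common point would
    have two symbols in row \<open>i\<close>.\<close>
  have same: "fst (p z) = fst (p z')" if z: "z \<in> M" "z' \<in> M" for z z'
  proof (rule ccontr)
    assume ne: "fst (p z) \<noteq> fst (p z')"
    have "3 \<le> CARD('b option)"
      using card by (simp add: card_UNIV_option)
    then obtain w where "w \<noteq> fst (p z)" "w \<noteq> fst (p z')"
      using exists_third by blast
    hence "det3 (veronese (fst (p z))) (veronese (fst (p z'))) (veronese w) \<noteq> 0"
      using ne by (intro det3_veronese) auto
    from ex1_implies_ex[OF dot3_solve[OF this, of "snd (p z)" "snd (p z')" 0]]
    obtain v where "ev (fst (p z)) v = snd (p z)" "ev (fst (p z')) v = snd (p z')"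
      by blast
    hence "z = z'"
      using disjoint z by blast
    thus False
      using ne by simp
  qed
  obtain z0 where z0: "z0 \<in> M"
    using M card by (metis card.empty card_eq_0_iff ex_in_conv not_numeral_le_zero)
  define t where "t = fst (p z0)"
  have t: "fst (p z) = t" if "z \<in> M" for z
    using same[OF that z0] by (simp add: t_def)
  have val: "ev t (\<theta> c) = snd (p (A i c))" if c: "c \<in> Cols" for c
  proof -
    have M': "A i c \<in> M"
      using orthogonal_array_values[OF oa i(1) c] .
    have "\<theta> c \<in> \<theta> ` {c' \<in> Cols. A i c' = A i c}"
      using c by blast
    thus ?thesis
      using p[OF M'] t[OF M'] by simp
  qed
  have "inj_on (\<lambda>z. snd (p z)) M"
  proof (rule inj_onI)
    fix z z' assume z: "z \<in> M" "z' \<in> M" "snd (p z) = snd (p z')"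
    hence eq: "p z = p z'"
      using t by (metis prod.collapse)
    have "card {v. ev t v = snd (p z)} = CARD('b) ^ 2"
      by (rule card_plane[OF veronese_neq_0])
    hence "{v. ev t v = snd (p z)} \<noteq> {}"
      by (metis card.empty power_not_zero zero_less_card_finite less_numeral_extra(3))
    then obtain v where "ev t v = snd (p z)"
      by blast
    thus "z = z'"
      using disjoint[OF z(1,2), of v] t[OF z(1)] t[OF z(2)] eq by simp
  qed
  moreover from this have "(\<lambda>z. snd (p z)) ` M = UNIV"
    using M by (intro card_subset_eq) (auto simp: card_image)
  ultimately have bij: "bij_betw (\<lambda>z. snd (p z)) M UNIV"
    by (simp add: bij_betw_def)
  let ?g = "inv_into M (\<lambda>z. snd (p z))"
  have "bij_betw ?g UNIV M"
    by (rule bij_betw_inv_into[OF bij])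
  moreover have "A i c = ?g (ev t (\<theta> c))" if c: "c \<in> Cols" for c
    using val[OF c] orthogonal_array_values[OF oa i(1) c] bij
    by (simp add: bij_betw_inv_into_left[OF bij])
  ultimately show ?thesis
    by blast
qed

lemma extension_coordinates:
  fixes \<theta> :: "'c \<Rightarrow> 'b::{field,finite} ^ 3"
  assumes card: "3 \<le> CARD('b)"
    and coord: "coordinates s M Cols A \<theta> \<tau> l"
    and oa: "orthogonal_array 3 CARD('b) k 1 M Cols A" and k: "s \<le> k" "3 \<le> k"
    and secant: "\<And>u. u \<noteq> 0 \<Longrightarrow> (\<And>\<tau> k. u \<noteq> k *s veronese \<tau>) \<Longrightarrow>
      \<exists>a\<in>\<tau> ` {1..s}. \<exists>b\<in>\<tau> ` {1..s}. a \<noteq> b \<and> u \<in> vec.span {veronese a, veronese b}"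
  shows "\<exists>\<tau>' l'. coordinates k M Cols A \<theta> \<tau>' l' \<and> (\<forall>i\<in>{1..s}. \<tau>' i = \<tau> i)"
proof -
  have l: "bij_betw (l t) UNIV M" "\<And>c. c \<in> Cols \<Longrightarrow> A t c = l t (ev (\<tau> t) (\<theta> c))" if "t \<in> {1..s}" for t
    using coord that unfolding coordinates_def by blast+
  have "\<forall>i\<in>{1..k}. \<exists>p. bij_betw (snd p) UNIV M \<and> (\<forall>c\<in>Cols. A i c = snd p (ev (fst p) (\<theta> c)))
      \<and> (i \<in> {1..s} \<longrightarrow> fst p = \<tau> i)"
  proof
    fix i assume i: "i \<in> {1..k}"
    show "\<exists>p. bij_betw (snd p) UNIV M \<and> (\<forall>c\<in>Cols. A i c = snd p (ev (fst p) (\<theta> c)))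
      \<and> (i \<in> {1..s} \<longrightarrow> fst p = \<tau> i)"
    proof (cases "i \<in> {1..s}")
      case True
      thus ?thesis
        using l[OF True] by (intro exI[of _ "(\<tau> i, l i)"]) simp
    next
      case False
      obtain t g where "bij_betw g UNIV M" "\<forall>c\<in>Cols. A i c = g (ev t (\<theta> c))"
        using new_row_coordinates[OF card coord oa k(1) secant i False] by blast
      thus ?thesis
        using False by (intro exI[of _ "(t, g)"]) auto
    qed
  qed
  from bchoice[OF this] obtain p where
    p_all: "\<forall>i\<in>{1..k}. bij_betw (snd (p i)) UNIV M \<and> (\<forall>c\<in>Cols. A i c = snd (p i) (ev (fst (p i)) (\<theta> c)))
      \<and> (i \<in> {1..s} \<longrightarrow> fst (p i) = \<tau> i)" ..
  hence p: "\<And>i. i \<in> {1..k} \<Longrightarrow> bij_betw (snd (p i)) UNIV M"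
      "\<And>i c. i \<in> {1..k} \<Longrightarrow> c \<in> Cols \<Longrightarrow> A i c = snd (p i) (ev (fst (p i)) (\<theta> c))"
    by blast+
  have p3: "fst (p i) = \<tau> i" if "i \<in> {1..s}" for i
    using p_all that k(1) by simp
  \<comment> \<open>Two rows with the same parameter determine each other, whereas in an orthogonal
    array every pair of symbols occurs in them. The row \<open>h\<close> only serves to fill up
    three rows.\<close>
  have "inj_on (\<lambda>i. fst (p i)) {1..k}"
  proof (rule inj_onI, rule ccontr)
    fix i j assume ij: "i \<in> {1..k}" "j \<in> {1..k}" "fst (p i) = fst (p j)" "i \<noteq> j"
    obtain h where h: "h \<in> {1..k}" "h \<noteq> i" "h \<noteq> j"
    proof -
      have "card ({1..k} - {i, j}) = k - 2"
        by (subst card_Diff_subset) (use ij in auto)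
      hence "{1..k} - {i, j} \<noteq> {}"
        using k(2) by (metis card.empty diff_is_0_eq not_numeral_le_zero numeral_le_iff
            order_trans zero_less_diff less_le_trans eval_nat_numeral(3) lessI not_less)
      thus ?thesis
        using that by blast
    qed
    have mem: "snd (p t) y \<in> M" if "t \<in> {1..k}" for t y
      using p(1)[OF that] by (auto simp: bij_betw_def)
    obtain c where "c \<in> Cols" "A i c = snd (p i) 0" "A j c = snd (p j) 1"
      using ex1_implies_ex[OF orthogonal_array_ex1[OF oa ij(1,2) h(1) ij(4) h(3)[symmetric] h(2)[symmetric]
            mem[OF ij(1)] mem[OF ij(2)] mem[OF h(1)]], of 0 1 0] by blast
    hence "snd (p i) (ev (fst (p i)) (\<theta> c)) = snd (p i) 0" "snd (p j) (ev (fst (p j)) (\<theta> c)) = snd (p j) 1"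
      using p(2) ij by simp_all
    hence "ev (fst (p i)) (\<theta> c) = 0" "ev (fst (p j)) (\<theta> c) = 1"
      using p(1)[OF ij(1)] p(1)[OF ij(2)] by (auto simp: bij_betw_def inj_eq)
    thus False
      using ij(3) by simp
  qed
  hence "coordinates k M Cols A \<theta> (\<lambda>i. fst (p i)) (\<lambda>i. snd (p i))"
    using coord p unfolding coordinates_def by blast
  moreover have "\<forall>i\<in>{1..s}. fst (p i) = \<tau> i"
    using p3 by blast
  ultimately show ?thesis
    by blast
qed

text \<open>With r + 1 rows the parameters exhaust the projective line. Two extensions thus
  distribute the same leftover parameters over the new rows; \<open>\<pi>\<close> matches equal
  parameters and \<open>\<sigma>\<close> compares the names of the symbols.\<close>

lemma coordinates_same_extension:
  fixes \<theta> :: "'c \<Rightarrow> 'b::{field,finite} ^ 3"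
  assumes A: "coordinates (CARD('b) + 1) M Cols A \<theta> \<tau> l"
    and A': "coordinates (CARD('b) + 1) M Cols A' \<theta> \<tau>' l'"
    and s: "s \<le> CARD('b) + 1" and same: "\<And>i. i \<in> {1..s} \<Longrightarrow> \<tau> i = \<tau>' i"
    and rows: "\<And>i c. i \<in> {1..s} \<Longrightarrow> c \<in> Cols \<Longrightarrow> A' i c = A i c"
  shows "same_extension M Cols s (CARD('b) + 1) A A'"
proof -
  let ?k = "CARD('b) + 1"
  have split: "{1..?k} - {1..s} = {s+1..?k}"
    using s by auto
  have bij: "bij_betw \<tau> {s+1..?k} (UNIV - \<tau> ` {1..s})" if "inj_on \<tau> {1..?k}" for \<tau> :: "nat \<Rightarrow> 'b option"
  proof -
    have "\<tau> ` {1..?k} = UNIV"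
      by (rule card_subset_eq) (use that in \<open>auto simp: card_image card_UNIV_option\<close>)
    moreover have "\<tau> ` ({1..?k} - {1..s}) = \<tau> ` {1..?k} - \<tau> ` {1..s}"
      using that s by (intro inj_on_image_set_diff[OF that]) auto
    ultimately show ?thesis
      unfolding bij_betw_def split[symmetric] using that inj_on_subset by blast
  qed
  have b: "bij_betw \<tau> {s+1..?k} (UNIV - \<tau> ` {1..s})"
    using A bij unfolding coordinates_def by blast
  have "bij_betw \<tau>' {s+1..?k} (UNIV - \<tau>' ` {1..s})"
    using A' bij unfolding coordinates_def by blast
  moreover have "\<tau>' ` {1..s} = \<tau> ` {1..s}"
    using same by auto
  ultimately have b': "bij_betw \<tau>' {s+1..?k} (UNIV - \<tau> ` {1..s})"
    by simp
  define \<pi> where "\<pi> = inv_into {s+1..?k} \<tau>' \<circ> \<tau>"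
  define \<sigma> where "\<sigma> = (\<lambda>i. l' (\<pi> i) \<circ> inv (l i))"
  have \<pi>: "bij_betw \<pi> {s+1..?k} {s+1..?k}"
    unfolding \<pi>_def by (rule bij_betw_trans[OF b bij_betw_inv_into[OF b']])
  have "bij_betw (\<sigma> i) M M \<and> (\<forall>c\<in>Cols. A' (\<pi> i) c = \<sigma> i (A i c))" if i: "i \<in> {s+1..?k}" for i
  proof -
    have \<pi>i: "\<pi> i \<in> {s+1..?k}"
      using \<pi> i by (auto simp: bij_betw_def)
    have "\<tau> i \<in> UNIV - \<tau> ` {1..s}"
      using bij_betwE[OF b] i by blast
    hence \<tau>: "\<tau>' (\<pi> i) = \<tau> i"
      unfolding \<pi>_def using bij_betw_inv_into_right[OF b'] by simp
    have l: "bij_betw (l i) UNIV M" "\<And>c. c \<in> Cols \<Longrightarrow> A i c = l i (ev (\<tau> i) (\<theta> c))"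
      using A i s unfolding coordinates_def by auto
    have l': "bij_betw (l' (\<pi> i)) UNIV M" "\<And>c. c \<in> Cols \<Longrightarrow> A' (\<pi> i) c = l' (\<pi> i) (ev (\<tau>' (\<pi> i)) (\<theta> c))"
      using A' \<pi>i s unfolding coordinates_def by auto
    have "bij_betw (\<sigma> i) M M"
      unfolding \<sigma>_def by (rule bij_betw_trans[OF bij_betw_inv_into[OF l(1)] l'(1)])
    moreover have "A' (\<pi> i) c = \<sigma> i (A i c)" if "c \<in> Cols" for c
      using l l' that \<tau> by (simp add: \<sigma>_def bij_betw_def inv_f_f)
    ultimately show ?thesis
      by blast
  qed
  thus ?thesis
    unfolding same_extension_def using rows \<pi> by blast
qed

lemma coordinates_extend:
  fixes \<theta> :: "'c \<Rightarrow> 'b::{field,finite} ^ 3"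
  assumes coord: "coordinates s M Cols A \<theta> \<tau> l" and s: "1 \<le> s"
  shows "s \<le> CARD('b) + 1"
    and "\<exists>A' \<tau>' l'. coordinates (CARD('b) + 1) M Cols A' \<theta> \<tau>' l' \<and> (\<forall>i\<in>{1..s}. \<forall>c\<in>Cols. A' i c = A i c)"
proof -
  let ?k = "CARD('b) + 1"
  have \<tau>: "inj_on \<tau> {1..s}"
    using coord by (simp add: coordinates_def)
  have "card (\<tau> ` {1..s}) \<le> CARD('b option)"
    by (rule card_mono) auto
  thus sk: "s \<le> ?k"
    using \<tau> by (simp add: card_image card_UNIV_option)
  have "card {s+1..?k} = card (UNIV - \<tau> ` {1..s})"
    using \<tau> by (simp add: card_Diff_subset card_image card_UNIV_option)
  then obtain g where g: "bij_betw g {s+1..?k} (UNIV - \<tau> ` {1..s})"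
    using finite_same_card_bij[of "{s+1..?k}" "UNIV - \<tau> ` {1..s}"] by auto
  define \<tau>' where "\<tau>' = (\<lambda>i. if i \<in> {1..s} then \<tau> i else g i)"
  \<comment> \<open>The new rows need some naming of the field elements by symbols, and that of row
    1 is borrowed.\<close>
  define l' where "l' = (\<lambda>i. if i \<in> {1..s} then l i else l 1)"
  define A' where "A' = (\<lambda>i c. l' i (ev (\<tau>' i) (\<theta> c)))"
  have "inj_on \<tau>' {1..?k}"
  proof -
    have "inj_on \<tau>' ({1..s} \<union> {s+1..?k})"
    proof (subst inj_on_Un, intro conjI)
      show "inj_on \<tau>' {1..s}"
        using \<tau> by (subst inj_on_cong[of _ \<tau>' \<tau>]) (auto simp: \<tau>'_def)
      show "inj_on \<tau>' {s+1..?k}"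
        using g by (subst inj_on_cong[of _ \<tau>' g]) (auto simp: \<tau>'_def bij_betw_def)
      have "\<tau>' ` ({1..s} - {s+1..?k}) \<subseteq> \<tau> ` {1..s}"
        by (auto simp: \<tau>'_def)
      moreover have "\<tau>' ` ({s+1..?k} - {1..s}) \<subseteq> UNIV - \<tau> ` {1..s}"
        using g by (auto simp: \<tau>'_def bij_betw_def)
      ultimately show "\<tau>' ` ({1..s} - {s+1..?k}) \<inter> \<tau>' ` ({s+1..?k} - {1..s}) = {}"
        by blast
    qed
    moreover have "{1..s} \<union> {s+1..?k} = {1..?k}"
      using sk by auto
    ultimately show ?thesis
      by simp
  qed
  hence "coordinates ?k M Cols A' \<theta> \<tau>' l'"
    using coord s by (simp add: coordinates_def A'_def l'_def)
  moreover have "\<forall>i\<in>{1..s}. \<forall>c\<in>Cols. A' i c = A i c"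
    using coord by (simp add: coordinates_def A'_def l'_def \<tau>'_def)
  ultimately show "\<exists>A' \<tau>' l'. coordinates ?k M Cols A' \<theta> \<tau>' l' \<and> (\<forall>i\<in>{1..s}. \<forall>c\<in>Cols. A' i c = A i c)"
    by blast
qed

section \<open>Miquel's theorem\<close>

text \<open>Homogeneous coordinates on the projective line. Circles become binary quadratic forms,
  and the parameter at infinity needs no case distinction.\<close>

definition pt :: "'b::field option \<Rightarrow> 'b \<times> 'b" where
  "pt \<tau> = (case \<tau> of Some t \<Rightarrow> (1, t) | None \<Rightarrow> (0, 1))"

definition br :: "'b::field \<times> 'b \<Rightarrow> 'b \<times> 'b \<Rightarrow> 'b" where
  "br x y = fst x * snd y - snd x * fst y"

definition qf :: "'b::field ^ 3 \<Rightarrow> 'b \<times> 'b \<Rightarrow> 'b" where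
  "qf c x = c$1 * (fst x)\<^sup>2 + c$2 * fst x * snd x + c$3 * (snd x)\<^sup>2"

lemma ev_eq_qf: "ev \<tau> c = qf c (pt \<tau>)"
  by (cases \<tau>) (simp_all add: dot3_def veronese_def qf_def pt_def power2_eq_square algebra_simps)

lemma br_pt: "br (pt \<sigma>) (pt \<tau>) = 0 \<longleftrightarrow> \<sigma> = \<tau>"
  by (cases \<sigma>; cases \<tau>) (auto simp: br_def pt_def)

lemma br_swap: "br x y = - br y x"
  by (simp add: br_def algebra_simps)

lemma qf_diff: "qf (c - d) x = qf c x - qf d x"
  and qf_add: "qf (c + d) x = qf c x + qf d x"
  and qf_scale: "qf (k *s c) x = k * qf c x"
  by (simp_all add: qf_def algebra_simps)

text \<open>Expand \<open>x\<close> in the basis \<open>a\<close>, \<open>b\<close>: the two square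
  terms drop out, and the mixed term carries the polar form \<open>B\<close>.\<close>

lemma qf_factor:
  assumes "qf c a = 0" "qf c b = 0" "br a b \<noteq> 0"
  shows "\<exists>k. \<forall>x. qf c x = k * br x a * br x b"
proof -
  define B where "B = 2 * c$1 * fst a * fst b + c$2 * (fst a * snd b + snd a * fst b) + 2 * c$3 * snd a * snd b"
  have "(br a b)\<^sup>2 * qf c x = (br x b)\<^sup>2 * qf c a - br x b * br x a * B + (br x a)\<^sup>2 * qf c b" for x
    by (simp add: B_def br_def qf_def power2_eq_square algebra_simps)
  hence "qf c x = (- B / (br a b)\<^sup>2) * br x a * br x b" for x
    using assms by (simp add: field_simps)
  thus ?thesis
    by blast
qed

lemma qf_product: "\<exists>c. \<forall>x. qf c x = br x a * br x b"
  by (rule exI[of _ "vector [snd a * snd b, - (snd a * fst b + fst a * snd b), fst a * fst b]"])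
     (simp add: qf_def br_def power2_eq_square algebra_simps)

text \<open>The left-hand side is linear in \<open>x\<close> and vanishes at \<open>f\<close>; a
  linear form in two variables is determined by a zero up to a factor.\<close>

lemma br_combination:
  assumes "f \<noteq> (0, 0)" "k * br f a = l * br f b"
  shows "\<exists>m. \<forall>x. l * br x b - k * br x a = m * br x f"
proof -
  define w where "w = (l * fst b - k * fst a, l * snd b - k * snd a)"
  have w: "l * br x b - k * br x a = br x w" for x
    by (simp add: w_def br_def algebra_simps)
  have 0: "fst f * snd w = snd f * fst w"
    using assms(2) w[of f] by (simp add: br_def)
  have "\<exists>m. fst w = m * fst f \<and> snd w = m * snd f"
  proof (cases "fst f = 0")
    case True
    hence "snd f \<noteq> 0"
      using assms(1) by (simp add: prod_eq_iff)
    thus ?thesis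
      using 0 True by (intro exI[of _ "snd w / snd f"]) auto
  next
    case False
    thus ?thesis
      using 0 by (intro exI[of _ "fst w / fst f"]) (simp add: field_simps)
  qed
  then obtain m where "fst w = m * fst f" "snd w = m * snd f"
    by blast
  hence "br x w = m * br x f" for x
    by (simp add: br_def algebra_simps)
  thus ?thesis
    using w by auto
qed

text \<open>
  With \<open>c\<^sub>2 - c\<^sub>1 = k\<^sub>2 [x a] [x b]\<close>, \<open>c\<^sub>3 - c\<^sub>1 = k\<^sub>3 [x b] [x c]\<close> and so on, the four incidences in
  \<open>e, f, g, h\<close> say that the linear forms \<open>k\<^sub>3 [x c] - k\<^sub>2 [x a]\<close> etc. are multiples of
  \<open>[x f]\<close> etc. The required circle is then found in the pencil \<open>c\<^sub>2 + \<mu> [x e] [x f]\<close>.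
\<close>

lemma miquel:
  fixes a b c d e f g h :: "'b::field \<times> 'b"
  assumes abcd: "br a b \<noteq> 0" "br b c \<noteq> 0" "br c d \<noteq> 0" "br a d \<noteq> 0" "br a c \<noteq> 0" "br b d \<noteq> 0"
    and abef: "br e a \<noteq> 0" "br e b \<noteq> 0" "br f a \<noteq> 0" "br f b \<noteq> 0"
    and bcfg: "br f c \<noteq> 0" "br g b \<noteq> 0" "br g c \<noteq> 0"
    and cdgh: "br g d \<noteq> 0" "br h c \<noteq> 0" "br h d \<noteq> 0"
    and adeh: "br e d \<noteq> 0" "br h a \<noteq> 0"
    and eg: "br g e \<noteq> 0"
    and a: "qf c1 a = qf c2 a" "qf c1 a = qf c5 a" and b: "qf c1 b = qf c2 b" "qf c1 b = qf c3 b"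
    and c: "qf c1 c = qf c3 c" "qf c1 c = qf c4 c" and d: "qf c1 d = qf c4 d" "qf c1 d = qf c5 d"
    and efgh: "qf c2 e = qf c5 e" "qf c2 f = qf c3 f" "qf c3 g = qf c4 g" "qf c4 h = qf c5 h"
  shows "\<exists>w. qf w e = qf c2 e \<and> qf w f = qf c2 f \<and> qf w g = qf c3 g \<and> qf w h = qf c4 h"
proof -
  obtain k2 where k2: "\<And>x. qf (c2 - c1) x = k2 * br x a * br x b"
    using qf_factor[of "c2 - c1" a b] a b abcd by (auto simp: qf_diff)
  obtain k3 where k3: "\<And>x. qf (c3 - c1) x = k3 * br x b * br x c"
    using qf_factor[of "c3 - c1" b c] b c abcd by (auto simp: qf_diff)
  obtain k4 where k4: "\<And>x. qf (c4 - c1) x = k4 * br x c * br x d"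
    using qf_factor[of "c4 - c1" c d] c d abcd by (auto simp: qf_diff)
  obtain k5 where k5: "\<And>x. qf (c5 - c1) x = k5 * br x a * br x d"
    using qf_factor[of "c5 - c1" a d] a d abcd by (auto simp: qf_diff)
  have q: "qf c2 x = qf c1 x + k2 * br x a * br x b" "qf c3 x = qf c1 x + k3 * br x b * br x c"
      "qf c4 x = qf c1 x + k4 * br x c * br x d" "qf c5 x = qf c1 x + k5 * br x a * br x d" for x
    using k2[of x] k3[of x] k4[of x] k5[of x] by (simp_all add: qf_diff algebra_simps)
  have E: "k2 * br e b = k5 * br e d"
    using efgh(1) abef by (simp add: q mult.commute mult.left_commute)
  have F: "k2 * br f a = k3 * br f c"
    using efgh(2) abef by (simp add: q mult.commute mult.left_commute)
  have G: "k3 * br g b = k4 * br g d"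
    using efgh(3) bcfg by (simp add: q mult.commute mult.left_commute)
  have H: "k4 * br h c = k5 * br h a"
    using efgh(4) cdgh by (simp add: q mult.commute mult.left_commute)
  have zero: "k3 = 0 \<longleftrightarrow> k2 = 0" "k4 = 0 \<longleftrightarrow> k2 = 0" "k5 = 0 \<longleftrightarrow> k2 = 0"
    using E F G abef bcfg cdgh adeh by (metis mult_eq_0_iff)+
  show ?thesis
  proof (cases "k2 = 0")
    \<comment> \<open>All five forms take the same values then, so \<open>c1\<close> itself is the
      required circle.\<close>
    case True
    thus ?thesis
      using zero by (intro exI[of _ c1]) (simp add: q)
  next
    case False
    have nz: "e \<noteq> (0, 0)" "f \<noteq> (0, 0)" "g \<noteq> (0, 0)" "h \<noteq> (0, 0)"
      using abef bcfg cdgh by (auto simp: br_def)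
    obtain kf where kf: "\<And>x. k3 * br x c - k2 * br x a = kf * br x f"
      using br_combination[OF nz(2) F] by blast
    obtain ke where ke: "\<And>x. k5 * br x d - k2 * br x b = ke * br x e"
      using br_combination[OF nz(1) E] by blast
    obtain kg where kg: "\<And>x. k4 * br x d - k3 * br x b = kg * br x g"
      using br_combination[OF nz(3) G] by blast
    obtain kh where kh: "\<And>x. k5 * br x a - k4 * br x c = kh * br x h"
      using br_combination[OF nz(4) H] by blast
    have "kg \<noteq> 0"
      using kg[of b] False zero abcd by (auto simp: br_def)
    have "kh \<noteq> 0"
      using kh[of a] False zero abcd by (auto simp: br_def)
    have gb: "kg * br g b = k4 * br d b" 
      using kg[of b] by (simp add: br_def algebra_simps)
    have ha: "kh * br h a = k4 * br a c"
      using kh[of a] by (simp add: br_def algebra_simps)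
    have hf: "kh * (kf * br h f) = (k3 * k5 - k2 * k4) * br a c"
    proof -
      have "kh * (kf * br h f) = k3 * (kh * br h c) - k2 * (kh * br h a)"
        using kf[of h] by (simp add: algebra_simps flip: kf)
      moreover have "kh * br h c = k5 * br a c"
        using kh[of c] by (simp add: br_def algebra_simps)
      ultimately show ?thesis
        by (simp add: ha algebra_simps)
    qed
    have ge: "kg * (ke * br g e) = (k3 * k5 - k2 * k4) * br d b"
    proof -
      have "kg * (ke * br g e) = k5 * (kg * br g d) - k2 * (kg * br g b)"
        by (simp add: algebra_simps flip: ke)
      moreover have "kg * br g d = k3 * br d b"
        using kg[of d] by (simp add: br_def algebra_simps)
      ultimately show ?thesis
        by (simp add: gb algebra_simps)
    qed
    have "kg * kh * (kf * br g b * br h f) = (kg * br g b) * (kh * (kf * br h f))"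
      by (simp add: algebra_simps)
    also have "\<dots> = (kh * br h a) * (kg * (ke * br g e))"
      unfolding gb hf ha ge by (simp add: algebra_simps)
    also have "\<dots> = kg * kh * (ke * br h a * br g e)"
      by (simp add: algebra_simps)
    finally have key: "kf * br g b * br h f = ke * br h a * br g e"
      using \<open>kg \<noteq> 0\<close> \<open>kh \<noteq> 0\<close> by simp
    obtain p where p: "\<And>x. qf p x = br x e * br x f"
      using qf_product by blast
    \<comment> \<open>Chosen such that the member \<open>c2 + m *s p\<close> of the pencil passes
      through the fourth circles' point on \<open>g\<close>; by \<open>key\<close> it then passes
      through the point on \<open>h\<close> as well. The division is where \<open>e\<close> and
      \<open>g\<close> must be on different lines.\<close>
    define m where "m = kf * br g b / br g e"
    have "qf c3 g - qf c2 g = br g b * (k3 * br g c - k2 * br g a)"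
      by (simp add: q algebra_simps)
    also have "\<dots> = m * (br g e * br g f)"
      unfolding kf using eg by (simp add: m_def)
    finally have 3: "qf c3 g = qf c2 g + m * (br g e * br g f)"
      by (simp add: algebra_simps)
    have "qf c5 h - qf c2 h = br h a * (k5 * br h d - k2 * br h b)"
      by (simp add: q algebra_simps)
    also have "\<dots> = br h e * (ke * br h a)"
      unfolding ke by (simp add: algebra_simps)
    also have "ke * br h a = m * br h f"
      using key eg by (simp add: m_def field_simps)
    finally have 5: "qf c5 h = qf c2 h + m * (br h e * br h f)"
      by (simp add: algebra_simps)
    have "br e e = 0" "br f f = 0"
      by (simp_all add: br_def)
    thus ?thesis
      using 3 5 efgh(4) by (intro exI[of _ "c2 + m *s p"]) (simp add: qf_add qf_scale p)
  qed
qed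

text \<open>Circles meet on a row exactly if their forms agree at its parameter. Distinct points of
  one circle lie on different rows, which makes all brackets in \<open>miquel\<close> nonzero except
  \<open>br g e\<close>; that one needs the hypothesis on parallel points.\<close>

theorem coordinates_miquelian:
  fixes M :: "'m set"
  assumes coord: "coordinates k M Cols A \<theta> \<tau> l"
  shows "miquelian (array_points k M) {1..k} Cols array_onl (array_onc A)"
proof -
  have l: "bij_betw (l t) UNIV M" "\<And>c. c \<in> Cols \<Longrightarrow> A t c = l t (ev (\<tau> t) (\<theta> c))" if "t \<in> {1..k}" for t
    using coord that unfolding coordinates_def by blast+
  have \<theta>: "bij_betw \<theta> Cols UNIV" and \<tau>: "inj_on \<tau> {1..k}"
    using coord unfolding coordinates_def by blast+
  define P where "P = (\<lambda>p :: nat \<times> 'm. pt (\<tau> (fst p)))"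
  define Pts where "Pts = array_points k M"
  have same: "qf (\<theta> c) (P p) = qf (\<theta> c') (P p) \<longleftrightarrow> A (fst p) c = A (fst p) c'"
    if "p \<in> Pts" "c \<in> Cols" "c' \<in> Cols" for p c c'
  proof -
    have p: "fst p \<in> {1..k}"
      using that(1) by (auto simp: Pts_def)
    show ?thesis
      using l(1)[OF p] by (simp add: l(2)[OF p] that P_def ev_eq_qf bij_betw_def inj_eq)
  qed
  have eq: "qf (\<theta> c) (P p) = qf (\<theta> c') (P p)"
    if "p \<in> Pts" "c \<in> Cols" "c' \<in> Cols" "array_onc A p c" "array_onc A p c'" for p c c'
    using that same[OF that(1-3)] by (simp add: array_onc_def)
  have br: "br (P p) (P p') \<noteq> 0" if "p \<in> Pts" "p' \<in> Pts" "fst p \<noteq> fst p'" for p p'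
    using that \<tau> unfolding P_def br_pt by (auto simp: Pts_def dest: inj_onD)
  have ne: "fst p \<noteq> fst p'" if "array_onc A p c" "array_onc A p' c" "p \<noteq> p'" for p p' c
    using that by (auto simp: array_onc_def prod_eq_iff)
  have npar: "fst p \<noteq> fst p'" if "p \<in> Pts" "\<not> (\<exists>l\<in>{1..k}. array_onl p l \<and> array_onl p' l)" for p p'
    using that by (auto simp: Pts_def array_onl_def)
  have brc: "br (P p) (P p') \<noteq> 0" if "p \<in> Pts" "p' \<in> Pts" "array_onc A p c" "array_onc A p' c" "p \<noteq> p'" for p p' c
    using br ne that by blast
  show ?thesis
    unfolding miquelian_def Let_def Pts_def[symmetric]
  proof (intro ballI impI, elim conjE bexE)
    fix a b c d e f g h c1 c2 c3 c4 c5
    assume pts: "a \<in> Pts" "b \<in> Pts" "c \<in> Pts" "d \<in> Pts" "e \<in> Pts" "f \<in> Pts" "g \<in> Pts" "h \<in> Pts"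
      and dist: "distinct [a, b, c, d, e, f, g, h]"
      and par: "\<not> (\<exists>l\<in>{1..k}. array_onl e l \<and> array_onl g l)"
      and c: "c1 \<in> Cols" "c2 \<in> Cols" "c3 \<in> Cols" "c4 \<in> Cols" "c5 \<in> Cols"
      and on1: "array_onc A a c1" "array_onc A b c1" "array_onc A c c1" "array_onc A d c1"
      and on2: "array_onc A a c2" "array_onc A b c2" "array_onc A e c2" "array_onc A f c2"
      and on3: "array_onc A b c3" "array_onc A c c3" "array_onc A f c3" "array_onc A g c3"
      and on4: "array_onc A c c4" "array_onc A d c4" "array_onc A g c4" "array_onc A h c4"
      and on5: "array_onc A a c5" "array_onc A d c5" "array_onc A e c5" "array_onc A h c5"
    have dist': "a \<noteq> b" "b \<noteq> c" "c \<noteq> d" "a \<noteq> d" "a \<noteq> c" "b \<noteq> d" "e \<noteq> a" "e \<noteq> b" "f \<noteq> a" "f \<noteq> b"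
      "f \<noteq> c" "g \<noteq> b" "g \<noteq> c" "g \<noteq> d" "h \<noteq> c" "h \<noteq> d" "e \<noteq> d" "h \<noteq> a"
      using dist by auto
    have eg: "br (P g) (P e) \<noteq> 0"
      using br[OF pts(7,5)] npar[OF pts(5) par] by metis
    have "\<exists>w. qf w (P e) = qf (\<theta> c2) (P e) \<and> qf w (P f) = qf (\<theta> c2) (P f) \<and>
        qf w (P g) = qf (\<theta> c3) (P g) \<and> qf w (P h) = qf (\<theta> c4) (P h)"
      by (rule miquel[where a = "P a" and b = "P b" and c = "P c" and d = "P d" and ?c1.0 = "\<theta> c1" and ?c5.0 = "\<theta> c5"])
         (rule eg eq brc[OF _ _ on1(1) on1(2)] brc[OF _ _ on1(2) on1(3)] brc[OF _ _ on1(3) on1(4)]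
          brc[OF _ _ on1(1) on1(4)] brc[OF _ _ on1(1) on1(3)] brc[OF _ _ on1(2) on1(4)]
          brc[OF _ _ on2(3) on2(1)] brc[OF _ _ on2(3) on2(2)] brc[OF _ _ on2(4) on2(1)] brc[OF _ _ on2(4) on2(2)]
          brc[OF _ _ on3(3) on3(2)] brc[OF _ _ on3(4) on3(1)] brc[OF _ _ on3(4) on3(2)]
          brc[OF _ _ on4(3) on4(2)] brc[OF _ _ on4(4) on4(1)] brc[OF _ _ on4(4) on4(2)]
          brc[OF _ _ on5(3) on5(2)] brc[OF _ _ on5(4) on5(1)] pts c dist' on1 on2 on3 on4 on5)+
    then obtain w where w: "qf w (P e) = qf (\<theta> c2) (P e)" "qf w (P f) = qf (\<theta> c2) (P f)"
        "qf w (P g) = qf (\<theta> c3) (P g)" "qf w (P h) = qf (\<theta> c4) (P h)"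
      by blast
    obtain c6 where c6: "c6 \<in> Cols" "\<theta> c6 = w"
      using \<theta> by (metis UNIV_I bij_betw_imp_surj_on imageE)
    have on6: "array_onc A p c6" if "p \<in> Pts" "c' \<in> Cols" "array_onc A p c'" "qf w (P p) = qf (\<theta> c') (P p)" for p c'
      using same[OF that(1) c6(1) that(2)] that c6 by (simp add: array_onc_def)
    show "\<exists>c\<in>Cols. array_onc A e c \<and> array_onc A f c \<and> array_onc A g c \<and> array_onc A h c"
      using on6[OF pts(5) c(2) on2(3) w(1)] on6[OF pts(6) c(2) on2(4) w(2)]
        on6[OF pts(7) c(3) on3(4) w(3)] on6[OF pts(8) c(4) on4(4) w(4)] c6 by blast
  qed
qed

section \<open>Coordinates of a dual pseudo-arc\<close>

lemma qf_pt_eqI: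
  assumes "3 \<le> card T" "\<And>\<tau>. \<tau> \<in> T \<Longrightarrow> qf c (pt \<tau>) = qf d (pt \<tau>)"
  shows "c = d"
proof -
  obtain t u v where "t \<in> T" "u \<in> T" "v \<in> T" "t \<noteq> u" "u \<noteq> v" "t \<noteq> v"
    using obtain_three[OF assms(1)] by blast
  thus ?thesis
    using dot3_eqI[OF det3_veronese[of t u v], of c d] assms(2) by (simp add: ev_eq_qf)
qed

lemma br_add_left: "br (x + y) z = br x z + br y z"
  and br_diff_left: "br (x - y) z = br x z - br y z"
  by (simp_all add: br_def algebra_simps)

lemma br_self [simp]: "br x x = 0"
  by (simp add: br_def)

lemma pt_neq_0: "pt \<tau> \<noteq> (0, 0)"
  by (cases \<tau>) (auto simp: pt_def)

lemma br_eq_0_iff: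
  assumes "w \<noteq> (0, 0)"
  shows "br x w = 0 \<longleftrightarrow> (\<exists>k. x = (k * fst w, k * snd w))"
proof
  assume *: "br x w = 0"
  show "\<exists>k. x = (k * fst w, k * snd w)"
  proof (cases "fst w = 0")
    case True
    hence "snd w \<noteq> 0"
      using assms by (simp add: prod_eq_iff)
    thus ?thesis
      using * True by (intro exI[of _ "snd x / snd w"]) (auto simp: br_def prod_eq_iff)
  next
    case False
    thus ?thesis
      using * by (intro exI[of _ "fst x / fst w"]) (auto simp: br_def prod_eq_iff field_simps)
  qed
qed (auto simp: br_def)

lemma exists_pt:
  assumes "w \<noteq> (0, 0 :: 'b::field)"
  shows "\<exists>\<tau> k. k \<noteq> 0 \<and> w = (k * fst (pt \<tau>), k * snd (pt \<tau>))"
proof (cases "fst w = 0")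
  case True
  thus ?thesis
    using assms by (intro exI[of _ None] exI[of _ "snd w"]) (auto simp: pt_def prod_eq_iff)
next
  case False
  thus ?thesis
    by (intro exI[of _ "Some (snd w / fst w)"] exI[of _ "fst w"]) (auto simp: pt_def prod_eq_iff)
qed

lemma br_solve:
  fixes p p' :: "'a::field \<times> 'a"
  assumes "br p p' \<noteq> 0"
  shows "\<exists>z. br z p = x \<and> br z p' = y"
proof -
  have br_div: "br (a / k, b / k) u = (a * snd u - b * fst u) / k" for a b k and u :: "'a \<times> 'a"
    by (simp add: br_def diff_divide_distrib)
  define z where "z = ((y * fst p - x * fst p') / br p p', (y * snd p - x * snd p') / br p p')"
  have "br z p = ((y * fst p - x * fst p') * snd p - (y * snd p - x * snd p') * fst p) / br p p'"
    "br z p' = ((y * fst p - x * fst p') * snd p' - (y * snd p - x * snd p') * fst p') / br p p'"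
    unfolding z_def by (rule br_div)+
  moreover have "(y * fst p - x * fst p') * snd p - (y * snd p - x * snd p') * fst p = x * br p p'"
    "(y * fst p - x * fst p') * snd p' - (y * snd p - x * snd p') * fst p' = y * br p p'"
    by (simp_all add: br_def algebra_simps)
  ultimately have "br z p = x" "br z p' = y"
    using assms by simp_all
  thus ?thesis
    by blast
qed

lemma qf_root_factor:
  assumes "qf c w = 0" "w \<noteq> (0, 0)"
  shows "\<exists>u. \<forall>x. qf c x = br x w * br u x"
proof (cases "fst w = 0")
  case True
  hence "snd w \<noteq> 0" "c$3 = 0"
    using assms by (auto simp: prod_eq_iff qf_def)
  thus ?thesis
    using True by (intro exI[of _ "(c$2 / snd w, - (c$1 / snd w))"])
      (simp add: qf_def br_def power2_eq_square field_simps)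
next
  case False
  \<comment> \<open>The cofactor is read off from the last two coefficients; the zero at
    \<open>w\<close> then forces the first one.\<close>
  define u where "u = (- (c$3 / fst w), (c$2 + c$3 * snd w / fst w) / fst w)"
  have c: "c$3 = - (fst w * fst u)" "c$2 = snd w * fst u + fst w * snd u"
    using False by (simp_all add: u_def field_simps)
  have "fst w * fst w * (c$1 + snd w * snd u) = 0"
    using assms(1) by (simp add: qf_def c power2_eq_square algebra_simps)
  hence "c$1 = - (snd w * snd u)"
    using False by (simp add: eq_neg_iff_add_eq_0)
  hence "qf c x = br x w * br u x" for x
    by (simp add: qf_def c br_def power2_eq_square algebra_simps)
  thus ?thesis
    by blast
qed

definition quartic_form :: "('b::field \<times> 'b \<Rightarrow> 'b) \<Rightarrow> bool" where
  "quartic_form f \<longleftrightarrow> (\<exists>c0 c1 c2 c3 c4. \<forall>x. f x = c0 * fst x ^ 4 + c1 * fst x ^ 3 * snd x +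
     c2 * fst x ^ 2 * snd x ^ 2 + c3 * fst x * snd x ^ 3 + c4 * snd x ^ 4)"

text \<open>The shape of the terms that arise in \<open>conic_of_parallel\<close> when the equations
  of three conics are brought to a common denominator.\<close>

lemma quartic_form_product: "quartic_form (\<lambda>x. qf c x * br x u * br x v)"
  unfolding quartic_form_def
  by (rule exI[of _ "c$1 * (snd u * snd v)"],
      rule exI[of _ "c$2 * (snd u * snd v) - c$1 * (snd u * fst v + fst u * snd v)"],
      rule exI[of _ "c$3 * (snd u * snd v) - c$2 * (snd u * fst v + fst u * snd v) + c$1 * (fst u * fst v)"],
      rule exI[of _ "c$2 * (fst u * fst v) - c$3 * (snd u * fst v + fst u * snd v)"],
      rule exI[of _ "c$3 * (fst u * fst v)"])
     (simp add: qf_def br_def eval_nat_numeral algebra_simps)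

lemma quartic_form_add:
  assumes "quartic_form f" "quartic_form g"
  shows "quartic_form (\<lambda>x. f x + g x)" "quartic_form (\<lambda>x. f x - g x)"
proof -
  obtain a b c d e where f: "\<And>x. f x = a * fst x ^ 4 + b * fst x ^ 3 * snd x +
     c * fst x ^ 2 * snd x ^ 2 + d * fst x * snd x ^ 3 + e * snd x ^ 4"
    using assms(1) unfolding quartic_form_def by blast
  obtain a' b' c' d' e' where g: "\<And>x. g x = a' * fst x ^ 4 + b' * fst x ^ 3 * snd x +
     c' * fst x ^ 2 * snd x ^ 2 + d' * fst x * snd x ^ 3 + e' * snd x ^ 4"
    using assms(2) unfolding quartic_form_def by blast
  show "quartic_form (\<lambda>x. f x + g x)"
    unfolding quartic_form_def
    by (rule exI[of _ "a + a'"], rule exI[of _ "b + b'"], rule exI[of _ "c + c'"],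
        rule exI[of _ "d + d'"], rule exI[of _ "e + e'"]) (simp add: f g algebra_simps)
  show "quartic_form (\<lambda>x. f x - g x)"
    unfolding quartic_form_def
    by (rule exI[of _ "a - a'"], rule exI[of _ "b - b'"], rule exI[of _ "c - c'"],
        rule exI[of _ "d - d'"], rule exI[of _ "e - e'"]) (simp add: f g algebra_simps)
qed

lemma quartic_form_eq_0:
  assumes f: "quartic_form f" and T: "5 \<le> card T" "\<And>\<tau>. \<tau> \<in> T \<Longrightarrow> f (pt \<tau>) = 0"
  shows "f x = 0"
proof -
  obtain c0 c1 c2 c3 c4 where f: "\<And>x. f x = c0 * fst x ^ 4 + c1 * fst x ^ 3 * snd x +
     c2 * fst x ^ 2 * snd x ^ 2 + c3 * fst x * snd x ^ 3 + c4 * snd x ^ 4"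
    using f unfolding quartic_form_def by blast
  have "c0 = 0 \<and> c1 = 0 \<and> c2 = 0 \<and> c3 = 0 \<and> c4 = 0"
  proof (rule binary_quartic_eq_0[OF T(1)])
    show "c0 + c1 * t + c2 * t ^ 2 + c3 * t ^ 3 + c4 * t ^ 4 = 0" if "Some t \<in> T" for t
      using T(2)[OF that] by (simp add: f pt_def)
    show "c4 = 0" if "None \<in> T"
      using T(2)[OF that] by (simp add: f pt_def)
  qed
  thus ?thesis
    by (simp add: f)
qed

text \<open>
  The group \<open>H\<close> with the additive functions \<open>\<mu> j\<close>, whose kernels are the elements of the dual
  pseudo-arc other than \<open>K\<^sub>0 = range \<Phi>\<close>, which carries the Desarguesian spread. For \<open>v\<close> outside
  \<open>K\<^sub>0\<close> the points \<open>(p j, \<mu> j v)\<close> form an arc together with \<open>(0, 0, 1)\<close>, and hence lie on a conic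
  \<open>X\<^sub>2 [X w] = Q(X)\<close>, where \<open>X = (X\<^sub>0, X\<^sub>1)\<close>. The tangent direction \<open>w\<close> turns out not to depend on
  \<open>v\<close>, and \<open>v \<mapsto> Q\<close> provides the coordinates.
\<close>

locale field_reduction =
  fixes H :: "'v::ab_group_add set" and \<Phi> :: "'b::{field,finite} \<times> 'b \<Rightarrow> 'v"
    and J :: "nat set" and \<tau> :: "nat \<Rightarrow> 'b option" and \<mu> :: "nat \<Rightarrow> 'v \<Rightarrow> 'b" and m :: nat
  assumes odd: "odd CARD('b)" and m2: "is_m2' TYPE('b) m" and card_J: "m \<le> card J"
    and H_add: "\<And>u v. u \<in> H \<Longrightarrow> v \<in> H \<Longrightarrow> u + v \<in> H"
    and H_diff: "\<And>u v. u \<in> H \<Longrightarrow> v \<in> H \<Longrightarrow> u - v \<in> H"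
    and \<Phi>_H: "\<And>z. \<Phi> z \<in> H"
    and inj_\<tau>: "inj_on \<tau> J"
    and \<mu>_add: "\<And>j u v. j \<in> J \<Longrightarrow> u \<in> H \<Longrightarrow> v \<in> H \<Longrightarrow> \<mu> j (u + v) = \<mu> j u + \<mu> j v"
    and \<mu>_\<Phi>: "\<And>j z. j \<in> J \<Longrightarrow> \<mu> j (\<Phi> z) = br z (pt (\<tau> j))"
    and \<mu>_0: "\<And>i j k v. i \<in> J \<Longrightarrow> j \<in> J \<Longrightarrow> k \<in> J \<Longrightarrow> i \<noteq> j \<Longrightarrow> j \<noteq> k \<Longrightarrow> i \<noteq> k \<Longrightarrow> v \<in> H \<Longrightarrow>
      \<mu> i v = 0 \<Longrightarrow> \<mu> j v = 0 \<Longrightarrow> \<mu> k v = 0 \<Longrightarrow> v = 0"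
    and proper: "range \<Phi> \<noteq> H"
begin

abbreviation p :: "nat \<Rightarrow> 'b \<times> 'b" where
  "p j \<equiv> pt (\<tau> j)"

lemma J5: "5 \<le> card J"
  using is_m2'_ge_5[OF odd m2] card_J by simp

lemma fin_J: "finite J"
  using J5 by (auto intro: card_ge_0_finite)

lemma card_\<tau>_J: "card (\<tau> ` J) = card J"
  using inj_\<tau> by (rule card_image)

lemma br_p: "i \<in> J \<Longrightarrow> j \<in> J \<Longrightarrow> i \<noteq> j \<Longrightarrow> br (p i) (p j) \<noteq> 0"
  using inj_\<tau> by (auto simp: br_pt dest: inj_onD)

lemma \<mu>_diff: "j \<in> J \<Longrightarrow> u \<in> H \<Longrightarrow> v \<in> H \<Longrightarrow> \<mu> j (u - v) = \<mu> j u - \<mu> j v"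
  using \<mu>_add[of j "u - v" v] H_diff[of u v] by simp

text \<open>By additivity and \<open>\<mu>_0\<close>, any three of the functions
  \<open>\<mu> j\<close> separate the elements of \<open>H\<close>, and \<open>\<Phi> z\<close> has
  the same three values as \<open>v\<close>.\<close>

lemma mem_range_\<Phi>:
  assumes "i \<in> J" "j \<in> J" "k \<in> J" "i \<noteq> j" "j \<noteq> k" "i \<noteq> k" and v: "v \<in> H"
    and "\<mu> i v = br z (p i)" "\<mu> j v = br z (p j)" "\<mu> k v = br z (p k)"
  shows "v \<in> range \<Phi>"
proof -
  have "v - \<Phi> z = 0"
    by (rule \<mu>_0[OF assms(1-6)]) (use assms \<Phi>_H H_diff in \<open>auto simp: \<mu>_diff \<mu>_\<Phi>\<close>)
  thus ?thesis
    by simp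
qed

text \<open>Three collinear points would give a single \<open>z\<close> with
  \<open>\<mu> j v = br z (p j)\<close> at all three, putting \<open>v\<close> into
  \<open>range \<Phi>\<close>. The point (0, 0, 1), dual to the line at infinity, raises the size
  from at least \<open>m\<close> to more than \<open>m\<close>.\<close>

lemma vec_arc_of_vector:
  assumes v: "v \<in> H" "v \<notin> range \<Phi>"
  defines "g \<equiv> \<lambda>j. vector [fst (p j), snd (p j), \<mu> j v] :: 'b ^ 3"
  shows "vec_arc (insert (vector [0, 0, 1]) (g ` J))" "m < card (insert (vector [0, 0, 1]) (g ` J))"
proof -
  have inj: "inj_on g J"
  proof (rule inj_onI)
    fix i j assume ij: "i \<in> J" "j \<in> J" "g i = g j"
    hence "p i = p j"
      by (simp add: g_def vec3_eq_iff prod_eq_iff)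
    hence "br (p i) (p j) = 0"
      by simp
    thus "i = j"
      using br_p ij by blast
  qed
  have "vector [0, 0, 1] \<noteq> g j" for j
  proof
    assume "vector [0, 0, 1] = g j"
    hence "p j = (0, 0)"
      by (simp add: g_def vec3_eq_iff prod_eq_iff)
    thus False
      using pt_neq_0 by blast
  qed
  hence "vector [0, 0, 1] \<notin> g ` J"
    by blast
  thus "m < card (insert (vector [0, 0, 1]) (g ` J))"
    using card_J fin_J card_image[OF inj] by simp
  show "vec_arc (insert (vector [0, 0, 1]) (g ` J))"
  proof (rule vec_arc_insert)
    show "vec_arc (g ` J)"
      unfolding vec_arc_def
    proof (intro ballI impI)
      fix x y w assume *: "x \<in> g ` J" "y \<in> g ` J" "w \<in> g ` J" "x \<noteq> y \<and> y \<noteq> w \<and> x \<noteq> w"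
      then obtain i j k where ijk: "i \<in> J" "j \<in> J" "k \<in> J" "x = g i" "y = g j" "w = g k"
        by blast
      hence ne: "i \<noteq> j" "j \<noteq> k" "i \<noteq> k"
        using * by blast+
      have det: "det3 x y w = \<mu> i v * br (p j) (p k) - \<mu> j v * br (p i) (p k) + \<mu> k v * br (p i) (p j)"
        by (simp add: ijk g_def det3_def br_def algebra_simps)
      \<comment> \<open>\<open>z\<close> is fitted to the first two values; a vanishing determinant
        says that it fits the third one too.\<close>
      obtain z where z: "br z (p i) = \<mu> i v" "br z (p j) = \<mu> j v"
        using br_solve[OF br_p[OF ijk(1,2) ne(1)]] by blast
      show "det3 x y w \<noteq> 0"
      proof
        assume "det3 x y w = 0"
        hence "\<mu> k v * br (p i) (p j) = br z (p j) * br (p i) (p k) - br z (p i) * br (p j) (p k)"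
          using det z by (simp add: algebra_simps eq_diff_eq)
        also have "\<dots> = br z (p k) * br (p i) (p j)"
          by (simp add: br_def algebra_simps)
        finally have "\<mu> k v = br z (p k)"
          using br_p[OF ijk(1,2) ne(1)] by simp
        thus False
          using mem_range_\<Phi>[OF ijk(1-3) ne v(1), of z] z v(2) by simp
      qed
    qed
    fix x y assume "x \<in> g ` J" "y \<in> g ` J" "x \<noteq> y"
    then obtain i j where "i \<in> J" "j \<in> J" "i \<noteq> j" "x = g i" "y = g j"
      by blast
    thus "det3 (vector [0, 0, 1]) x y \<noteq> 0"
      using br_p[of i j] by (simp add: g_def det3_def br_def)
  qed
qed

definition conic_of :: "'v \<Rightarrow> 'b \<times> 'b \<Rightarrow> 'b ^ 3 \<Rightarrow> bool" where
  "conic_of v w Q \<longleftrightarrow> w \<noteq> (0, 0) \<and> (\<forall>j\<in>J. \<mu> j v * br (p j) w = qf Q (p j))"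

lemma conic_ofD: "conic_of v w Q \<Longrightarrow> j \<in> J \<Longrightarrow> qf Q (p j) = \<mu> j v * br (p j) w"
  by (simp add: conic_of_def)

text \<open>For \<open>v = \<Phi> z\<close> the conic degenerates into two lines: both sides of its
  equation contain the factor \<open>br x w\<close>, so every direction \<open>w\<close> is
  possible.\<close>

lemma conic_of_\<Phi>:
  assumes "w \<noteq> (0, 0)"
  shows "\<exists>Q. conic_of (\<Phi> z) w Q \<and> qf Q w = 0"
proof -
  obtain Q where "\<And>x. qf Q x = br x z * br x w"
    using qf_product by blast
  hence "qf ((-1) *s Q) x = br z x * br x w" for x
    by (simp only: qf_scale) (simp add: br_def algebra_simps)
  thus ?thesis
    unfolding conic_of_def using assms by (intro exI[of _ "(-1) *s Q"]) (simp add: \<mu>_\<Phi>)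
qed

text \<open>A zero of \<open>Q\<close> at \<open>w\<close> lets the factor \<open>br x w\<close>
  cancel, leaving \<open>\<mu> j v = br u (p j)\<close> for all \<open>j\<close> with
  \<open>p j\<close> not proportional to \<open>w\<close>. At most one \<open>j\<close> is lost, so
  three remain and \<open>v\<close> would lie in \<open>range \<Phi>\<close>.\<close>

lemma conic_of_nondegenerate:
  assumes v: "v \<in> H" "v \<notin> range \<Phi>" and Q: "conic_of v w Q"
  shows "qf Q w \<noteq> 0"
proof
  have w: "w \<noteq> (0, 0)"
    using Q by (simp add: conic_of_def)
  assume "qf Q w = 0"
  then obtain u where u: "\<And>x. qf Q x = br x w * br u x"
    using qf_root_factor w by blast
  let ?J = "{j \<in> J. br (p j) w \<noteq> 0}"
  have \<mu>: "\<mu> j v = br u (p j)" if "j \<in> ?J" for j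
    using Q u[of "p j"] that by (auto simp: conic_of_def)
  have "card (J - ?J) \<le> 1"
  proof (rule ccontr)
    assume "\<not> card (J - ?J) \<le> 1"
    then obtain i j where "i \<in> J - ?J" "j \<in> J - ?J" "i \<noteq> j"
      using card_le_Suc0_iff_eq[of "J - ?J"] fin_J by auto
    hence ij: "i \<in> J" "j \<in> J" "i \<noteq> j" "br (p i) w = 0" "br (p j) w = 0"
      by auto
    then obtain k l where "p i = (k * fst w, k * snd w)" "p j = (l * fst w, l * snd w)"
      using br_eq_0_iff[OF w] by metis
    hence "br (p i) (p j) = 0"
      by (simp add: br_def)
    thus False
      using br_p ij by blast
  qed
  moreover have "card (J - ?J) = card J - card ?J"
    by (rule card_Diff_subset) (use fin_J in auto)
  ultimately have "3 \<le> card ?J"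
    using J5 by simp
  then obtain i j k where "i \<in> ?J" "j \<in> ?J" "k \<in> ?J" "i \<noteq> j" "j \<noteq> k" "i \<noteq> k"
    by (rule obtain_three)
  hence "v \<in> range \<Phi>"
    using mem_range_\<Phi>[of i j k v u] \<mu> v(1) by blast
  thus False
    using v by blast
qed

lemma conic_of_exists:
  assumes v: "v \<in> H"
  shows "\<exists>w Q. conic_of v w Q"
proof (cases "v \<in> range \<Phi>")
  case True
  then obtain z where "v = \<Phi> z"
    by blast
  moreover have "(1, 0) \<noteq> (0 :: 'b, 0 :: 'b)"
    by simp
  ultimately show ?thesis
    using conic_of_\<Phi> by blast
next
  case False
  define g where "g = (\<lambda>j. vector [fst (p j), snd (p j), \<mu> j v] :: 'b ^ 3)"
  obtain f where f: "quadratic_form f" "\<exists>x. f x \<noteq> 0" "\<forall>x\<in>insert (vector [0, 0, 1]) (g ` J). f x = 0"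
    using conic_of_large_arc[OF odd m2 vec_arc_of_vector[OF v False]] unfolding g_def by blast
  obtain a b c d e h where f': "\<And>x. f x =
     a * x$1 * x$1 + b * x$2 * x$2 + c * x$3 * x$3 + d * x$1 * x$2 + e * x$1 * x$3 + h * x$2 * x$3"
    using f(1) unfolding quadratic_form_def by blast
  have "f (vector [0, 0, 1]) = 0"
    using f(3) by blast
  hence c: "c = 0"
    by (simp add: f')
  \<comment> \<open>As \<open>c = 0\<close>, the equation is linear in the third coordinate: its
    coefficient is \<open>br x w\<close>, and the terms free of it are the negative of
    \<open>Q\<close>.\<close>
  define w where "w = (- h, e)"
  define Q where "Q = (vector [- a, - d, - b] :: 'b ^ 3)"
  have Q: "\<mu> j v * br (p j) w = qf Q (p j)" if "j \<in> J" for j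
  proof -
    have "f (g j) = 0"
      using f(3) that by blast
    moreover have "f (g j) = \<mu> j v * br (p j) w - qf Q (p j)"
      by (simp add: f' c g_def w_def Q_def br_def qf_def power2_eq_square algebra_simps)
    ultimately show ?thesis
      by simp
  qed
  \<comment> \<open>Without \<open>w\<close> the form \<open>Q\<close> would vanish at all
    parameters of \<open>J\<close>, so all coefficients of \<open>f\<close> would be zero.\<close>
  have "w \<noteq> (0, 0)"
  proof
    assume "w = (0, 0)"
    hence "qf Q (pt t) = qf 0 (pt t)" if "t \<in> \<tau> ` J" for t
      using Q that by (auto simp: br_def qf_def)
    hence "Q = 0"
      using J5 card_\<tau>_J by (intro qf_pt_eqI[of "\<tau> ` J"]) auto
    hence "a = 0" "b = 0" "d = 0" "e = 0" "h = 0"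
      using \<open>w = (0, 0)\<close> by (simp_all add: Q_def w_def vec3_eq_iff)
    thus False
      using f(2) by (simp add: f' c)
  qed
  thus ?thesis
    using Q unfolding conic_of_def by blast
qed

text \<open>Clearing denominators in \<open>\<mu> j (v + v') = \<mu> j v + \<mu> j v'\<close> gives
  the quartic form \<open>?F\<close>, which has at least five zeros and so vanishes. At
  \<open>w\<close> and at \<open>w'\<close> just one term is left, and nondegeneracy makes
  \<open>w''\<close> proportional to both of them.\<close>

lemma conic_of_parallel:
  assumes v: "v \<in> H" "v \<notin> range \<Phi>" "conic_of v w Q" and v': "v' \<in> H" "v' \<notin> range \<Phi>" "conic_of v' w' Q'"
  shows "br w w' = 0"
proof (rule ccontr)
  assume ne: "br w w' \<noteq> 0"
  obtain w'' Q'' where v'': "conic_of (v + v') w'' Q''"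
    using conic_of_exists[OF H_add[OF v(1) v'(1)]] by blast
  let ?F = "\<lambda>x. qf Q x * br x w' * br x w'' + qf Q' x * br x w * br x w'' - qf Q'' x * br x w * br x w'"
  have quartic: "quartic_form ?F"
    by (intro quartic_form_add quartic_form_product)
  have roots: "?F (pt t) = 0" if "t \<in> \<tau> ` J" for t
  proof -
    from that obtain j where j: "j \<in> J" "t = \<tau> j"
      by blast
    have "qf Q (p j) = \<mu> j v * br (p j) w" "qf Q' (p j) = \<mu> j v' * br (p j) w'"
      "qf Q'' (p j) = (\<mu> j v + \<mu> j v') * br (p j) w''"
      by (simp_all add: conic_ofD[OF v(3) j(1)] conic_ofD[OF v'(3) j(1)] conic_ofD[OF v'' j(1)]
          \<mu>_add[OF j(1) v(1) v'(1)])
    thus ?thesis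
      by (simp add: j(2) algebra_simps)
  qed
  have F: "?F x = 0" for x
    by (rule quartic_form_eq_0[OF quartic, of "\<tau> ` J"]) (use J5 card_\<tau>_J roots in auto)
  have "qf Q w \<noteq> 0" "qf Q' w' \<noteq> 0"
    using conic_of_nondegenerate v v' by blast+
  moreover have "br w' w \<noteq> 0"
    using ne br_swap[of w w'] by simp
  ultimately have "br w w'' = 0" "br w' w'' = 0"
    using F[of w] F[of w'] ne by simp_all
  moreover have "w'' \<noteq> (0, 0)"
    using v'' by (simp add: conic_of_def)
  ultimately obtain k l where "w = (k * fst w'', k * snd w'')" "w' = (l * fst w'', l * snd w'')"
    using br_eq_0_iff by metis
  hence "br w w' = 0"
    by (simp add: br_def)
  thus False
    using ne by simp
qed

text \<open>The direction is taken from one fixed vector outside \<open>range \<Phi>\<close>. All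
  other such vectors have a parallel one, and inside \<open>range \<Phi>\<close> the direction can
  be chosen freely.\<close>

lemma common_tangent:
  "\<exists>\<tau>0. \<tau>0 \<notin> \<tau> ` J \<and> (\<forall>v\<in>H. \<exists>Q. conic_of v (pt \<tau>0) Q)"
proof -
  obtain v0 where v0: "v0 \<in> H" "v0 \<notin> range \<Phi>"
    using proper \<Phi>_H by blast
  obtain w0 Q0 where Q0: "conic_of v0 w0 Q0"
    using conic_of_exists[OF v0(1)] by blast
  hence w0: "w0 \<noteq> (0, 0)"
    by (simp add: conic_of_def)
  obtain \<tau>0 k0 where \<tau>0: "k0 \<noteq> 0" "w0 = (k0 * fst (pt \<tau>0), k0 * snd (pt \<tau>0))"
    using exists_pt[OF w0] by blast
  have scale: "\<exists>Q. conic_of v (pt \<tau>0) Q"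
    if "conic_of v w Q" "k \<noteq> 0" "w = (k * fst (pt \<tau>0), k * snd (pt \<tau>0))" for v w Q k
  proof -
    have br: "br x w = k * br x (pt \<tau>0)" for x
      unfolding that(3) by (simp add: br_def algebra_simps)
    have "\<mu> j v * br (p j) (pt \<tau>0) = qf (inverse k *s Q) (p j)" if "j \<in> J" for j
    proof -
      have "qf Q (p j) = k * (\<mu> j v * br (p j) (pt \<tau>0))"
        using \<open>conic_of v w Q\<close> that by (simp add: conic_of_def br algebra_simps)
      thus ?thesis
        using \<open>k \<noteq> 0\<close> by (simp add: qf_scale)
    qed
    thus ?thesis
      unfolding conic_of_def using pt_neq_0 by blast
  qed
  \<comment> \<open>If \<open>\<tau>0\<close> were the parameter of some \<open>j\<close>, the
    equation of the conic at \<open>j\<close> would give a zero of \<open>Q\<close> at its own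
    tangent direction.\<close>
  have "\<tau>0 \<notin> \<tau> ` J"
  proof
    assume "\<tau>0 \<in> \<tau> ` J"
    then obtain j where j: "j \<in> J" "\<tau>0 = \<tau> j"
      by blast
    obtain Q where Q: "conic_of v0 (pt \<tau>0) Q"
      using scale[OF Q0 \<tau>0] by blast
    hence "qf Q (pt \<tau>0) = 0"
      using j unfolding conic_of_def by (metis br_self mult_zero_right)
    thus False
      using conic_of_nondegenerate[OF v0 Q] by simp
  qed
  moreover have "\<exists>Q. conic_of v (pt \<tau>0) Q" if v: "v \<in> H" for v
  proof (cases "v \<in> range \<Phi>")
    case True
    thus ?thesis
      using conic_of_\<Phi>[OF pt_neq_0] by blast
  next
    case False
    obtain w Q where Q: "conic_of v w Q"
      using conic_of_exists[OF v] by blast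
    have "br w w0 = 0"
      by (rule conic_of_parallel[OF v False Q v0 Q0])
    then obtain k where k: "w = (k * fst w0, k * snd w0)"
      using br_eq_0_iff[OF w0] by blast
    have "k \<noteq> 0"
      using k Q by (auto simp: conic_of_def)
    thus ?thesis
      using scale[OF Q, of "k * k0"] k \<tau>0 by (simp add: mult.assoc)
  qed
  ultimately show ?thesis
    by blast
qed

text \<open>With the direction fixed, \<open>Q\<close> is determined by its values at the parameters
  of \<open>J\<close>, which are additive in \<open>v\<close>; so \<open>\<Psi>\<close> is additive
  although it is obtained by choice. The parameter \<open>\<tau>0\<close> is the one for the row of
  \<open>range \<Phi>\<close> itself.\<close>

theorem conic_coordinates:
  "\<exists>\<tau>0 \<Psi>. \<tau>0 \<notin> \<tau> ` J \<and> (\<forall>u\<in>H. \<forall>v\<in>H. \<Psi> (u + v) = \<Psi> u + \<Psi> v) \<and>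
     (\<forall>j\<in>J. \<forall>v\<in>H. ev (\<tau> j) (\<Psi> v) = 0 \<longleftrightarrow> \<mu> j v = 0) \<and> (\<forall>z. ev \<tau>0 (\<Psi> (\<Phi> z)) = 0)"
proof -
  obtain \<tau>0 where \<tau>0: "\<tau>0 \<notin> \<tau> ` J" "\<forall>v\<in>H. \<exists>Q. conic_of v (pt \<tau>0) Q"
    using common_tangent by blast
  from bchoice[OF this(2)] obtain \<Psi> where "\<forall>v\<in>H. conic_of v (pt \<tau>0) (\<Psi> v)" ..
  hence \<Psi>: "qf (\<Psi> v) (p j) = \<mu> j v * br (p j) (pt \<tau>0)" if "v \<in> H" "j \<in> J" for v j
    using that by (simp add: conic_of_def)
  have uniq: "Q = Q'" if "\<And>j. j \<in> J \<Longrightarrow> qf Q (p j) = qf Q' (p j)" for Q Q'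
    by (rule qf_pt_eqI[of "\<tau> ` J"]) (use J5 card_\<tau>_J that in auto)
  have "\<Psi> (u + v) = \<Psi> u + \<Psi> v" if "u \<in> H" "v \<in> H" for u v
    by (rule uniq) (simp add: qf_add \<Psi> \<mu>_add H_add that algebra_simps)
  moreover have "ev (\<tau> j) (\<Psi> v) = 0 \<longleftrightarrow> \<mu> j v = 0" if "j \<in> J" "v \<in> H" for j v
    using \<tau>0(1) that by (auto simp: ev_eq_qf \<Psi> br_pt)
  moreover have "ev \<tau>0 (\<Psi> (\<Phi> z)) = 0" for z
  proof -
    obtain Q where Q: "conic_of (\<Phi> z) (pt \<tau>0) Q" "qf Q (pt \<tau>0) = 0"
      using conic_of_\<Phi>[OF pt_neq_0] by blast
    have "\<Psi> (\<Phi> z) = Q"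
      by (rule uniq) (use Q(1) in \<open>simp add: \<Psi> \<Phi>_H conic_of_def\<close>)
    thus ?thesis
      using Q(2) by (simp add: ev_eq_qf)
  qed
  ultimately show ?thesis
    using \<tau>0(1) by blast
qed

end

section \<open>The array of a dual pseudo-arc\<close>

lemma card_span:
  fixes B :: "('a::{field,finite} ^ 'd) set"
  assumes "vec.independent B"
  shows "card (vec.span B) = CARD('a) ^ card B"
proof -
  have "finite B"
    by simp
  thus ?thesis
    using assms
  proof (induction B rule: finite_induct)
    case (insert b B)
    have indep: "vec.independent B" "b \<notin> vec.span B"
      using insert by (auto simp: vec.independent_insert)
    let ?f = "\<lambda>(k, x). k *s b + x"
    have "inj_on ?f (UNIV \<times> vec.span B)"
    proof (rule inj_onI, clarsimp)
      fix k x l y assume *: "x \<in> vec.span B" "y \<in> vec.span B" "k *s b + x = l *s b + y"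
      have "(k - l) *s b = y - x"
        using *(3) by (simp add: vec.scale_left_diff_distrib algebra_simps)
      hence "(k - l) *s b \<in> vec.span B"
        using * by (simp add: vec.span_diff)
      hence "inverse (k - l) *s ((k - l) *s b) \<in> vec.span B"
        by (rule vec.span_scale)
      moreover have "inverse t *s (t *s b) = b" if "t \<noteq> 0" for t
        using that by simp
      ultimately have "k - l = 0"
        using indep(2) by metis
      thus "k = l \<and> x = y"
        using * by simp
    qed
    moreover have "?f ` (UNIV \<times> vec.span B) = vec.span (insert b B)"
    proof -
      have "x \<in> ?f ` (UNIV \<times> vec.span B) \<longleftrightarrow> (\<exists>k. x - k *s b \<in> vec.span B)" for x
      proof
        assume "\<exists>k. x - k *s b \<in> vec.span B"
        then obtain k where "x - k *s b \<in> vec.span B" ..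
        thus "x \<in> ?f ` (UNIV \<times> vec.span B)"
          by (intro image_eqI[of _ _ "(k, x - k *s b)"]) auto
      next
        assume "x \<in> ?f ` (UNIV \<times> vec.span B)"
        then obtain k y where "y \<in> vec.span B" "x = k *s b + y"
          by auto
        thus "\<exists>k. x - k *s b \<in> vec.span B"
          by (intro exI[of _ k]) simp
      qed
      thus ?thesis
        unfolding set_eq_iff vec.span_breakdown_eq by blast
    qed
    ultimately have "card (vec.span (insert b B)) = CARD('a) * card (vec.span B)"
      by (metis card_image card_cartesian_product)
    thus ?case
      using insert indep by simp
  qed simp
qed

lemma card_subspace:
  fixes U :: "('a::{field,finite} ^ 'd) set"
  assumes "vec.subspace U"
  shows "card U = CARD('a) ^ vec.dim U"
proof -
  obtain B where B: "B \<subseteq> U" "vec.independent B" "U \<subseteq> vec.span B" "card B = vec.dim U"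
    using vec.basis_exists by metis
  have "vec.span B = U"
    using B assms vec.span_minimal by blast
  thus ?thesis
    using card_span[OF B(2)] B(4) by simp
qed

lemma hyperplane_complement:
  fixes H :: "('a::field ^ 'd) set"
  assumes H: "vec.subspace H" "CARD('d) = vec.dim H + 1" and h: "h \<notin> H"
  shows "\<exists>k v. v \<in> H \<and> u = k *s h + v"
proof -
  have "vec.dim (insert h H) = vec.dim H + 1"
    using H h by (simp add: vec.dim_insert vec.span_eq_iff[THEN iffD2, OF H(1)])
  hence "vec.dim (UNIV :: ('a ^ 'd) set) \<le> vec.dim (vec.span (insert h H))"
    using H(2) vec_dim_card[where 'a = 'a and 'n = 'd] by simp
  hence "vec.span (insert h H) = UNIV"
    by (intro vec.subspace_dim_equal) (simp_all add: vec.subspace_UNIV)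
  hence "u \<in> vec.span (insert h H)"
    by simp
  then obtain k where "u - k *s h \<in> vec.span H"
    by (auto simp: vec.span_breakdown_eq)
  hence "u - k *s h \<in> H"
    using H(1) by (simp add: vec.span_eq_iff[THEN iffD2])
  thus ?thesis
    by (intro exI[of _ k] exI[of _ "u - k *s h"]) simp
qed

text \<open>An instance of the modular law, used with \<open>X = {0}\<close> for circles and with
  \<open>X = K j\<close> for the points of the array.\<close>

lemma mem_span_insert_hyperplane:
  assumes H: "vec.subspace H" and X: "vec.subspace X" "X \<subseteq> H" and w: "w \<notin> H"
    and x: "x \<in> H" "x \<in> vec.span (insert w X)"
  shows "x \<in> X"
proof -
  obtain k where k: "x - k *s w \<in> X"
    using x(2) X(1) by (auto simp: vec.span_breakdown_eq vec.span_eq_iff[THEN iffD2])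
  have "k *s w = x - (x - k *s w)"
    by simp
  hence kw: "k *s w \<in> H"
    using H x(1) k X(2) vec.subspace_diff by (metis subsetD)
  have "k = 0"
  proof (rule ccontr)
    assume "k \<noteq> 0"
    hence "w = inverse k *s (k *s w)"
      by simp
    thus False
      using w H kw vec.subspace_scale by metis
  qed
  thus ?thesis
    using k by simp
qed

text \<open>Fix \<open>h\<close> outside \<open>H\<close>. A circle is the span of
  \<open>h + v\<close> for a unique \<open>v\<close> in \<open>H\<close>, and its point on the line
  \<open>K j\<close> is spanned by \<open>h + v\<close> and \<open>K j\<close>. This point depends
  only on the coset of \<open>v\<close> modulo \<open>K j\<close>, hence only on
  \<open>ev (\<tau> j) (\<Psi> v)\<close>.\<close>

lemma G_array_coordinates:
  fixes H :: "('a::{field,finite} ^ 'd) set" and \<Psi> :: "'a ^ 'd \<Rightarrow> 'b::{field,finite} ^ 3"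
  assumes n: "1 \<le> n" and d: "CARD('d) = 3 * n + 1" and H: "H \<in> proj_subspaces (3 * n - 1)"
    and K: "\<And>j. j \<in> {1..s} \<Longrightarrow> K j \<in> proj_subspaces (2 * n - 1)"
    and lab: "\<And>i. i \<in> {1..s} \<Longrightarrow> bij_betw (lab i) (G_line_points n H (K ` {1..s}) (K i)) M"
    and \<tau>: "inj_on \<tau> {1..s}" and \<Psi>: "bij_betw \<Psi> H UNIV"
    and \<Psi>_add: "\<And>u v. u \<in> H \<Longrightarrow> v \<in> H \<Longrightarrow> \<Psi> (u + v) = \<Psi> u + \<Psi> v"
    and K_eq: "\<And>j. j \<in> {1..s} \<Longrightarrow> K j = {v \<in> H. ev (\<tau> j) (\<Psi> v) = 0}"
  shows "\<exists>\<theta> l. coordinates s M (G_circles H) (G_array n H s K lab) \<theta> \<tau> l"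
proof -
  have subH: "vec.subspace H" and dimH: "vec.dim H = 3 * n"
    using H n by (auto simp: proj_subspaces_def)
  have subK: "vec.subspace (K j)" and dimK: "vec.dim (K j) = 2 * n" and KH: "K j \<subseteq> H" if "j \<in> {1..s}" for j
    using K[OF that] K_eq[OF that] n by (auto simp: proj_subspaces_def)
  have "H \<noteq> UNIV"
    using dimH d vec_dim_card[where 'a = 'a and 'n = 'd] by auto
  then obtain h where h: "h \<notin> H"
    by blast
  have h_add: "h + v \<notin> H" if "v \<in> H" for v
    using h vec.subspace_diff[OF subH _ that, of "h + v"] by auto
  have \<Psi>_diff: "\<Psi> (u - v) = \<Psi> u - \<Psi> v" if "u \<in> H" "v \<in> H" for u v
    using \<Psi>_add[of "u - v" v] vec.subspace_diff[OF subH that] that by simp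
  have normal: "\<exists>k v. k \<noteq> 0 \<and> v \<in> H \<and> u = k *s (h + v)" if u: "u \<notin> H" for u
  proof -
    obtain k v where kv: "v \<in> H" "u = k *s h + v"
      using hyperplane_complement[OF subH _ h, of u] d dimH by auto
    have "k \<noteq> 0"
      using kv u by auto
    hence "u = k *s (h + inverse k *s v)"
      using kv by (simp add: vec.scale_right_distrib)
    thus ?thesis
      using \<open>k \<noteq> 0\<close> vec.subspace_scale[OF subH kv(1)] by blast
  qed
  define cir where "cir = (\<lambda>v. vec.span {h + v})"
  have cir_bij: "bij_betw cir H (G_circles H)"
    unfolding bij_betw_def
  proof
    show "inj_on cir H"
    proof (rule inj_onI)
      fix u v assume uv: "u \<in> H" "v \<in> H" "cir u = cir v"
      have "h + u \<in> vec.span {h + v}"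
        using uv(3) vec.span_base unfolding cir_def by blast
      moreover have "h + v \<in> vec.span {h + v}"
        by (simp add: vec.span_base)
      ultimately have "(h + u) - (h + v) \<in> vec.span (insert (h + v) {0})"
        using vec.span_diff by (metis insert_commute vec.span_insert_0)
      hence span: "u - v \<in> vec.span (insert (h + v) {0})"
        by simp
      have "vec.subspace {0 :: 'a ^ 'd}" "{0} \<subseteq> H" "u - v \<in> H"
        using uv subH by (simp_all add: vec.subspace_0 vec.subspace_diff vec.subspace_single_0)
      from mem_span_insert_hyperplane[OF subH this(1,2) h_add[OF uv(2)] this(3) span]
      show "u = v"
        by simp
    qed
    show "cir ` H = G_circles H"
    proof
      show "cir ` H \<subseteq> G_circles H"
      proof
        fix c assume "c \<in> cir ` H"
        then obtain v where v: "v \<in> H" "c = vec.span {h + v}"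
          by (auto simp: cir_def)
        have "h + v \<in> c"
          using v by (simp add: vec.span_base)
        moreover have "h + v \<noteq> 0"
          using h_add[OF v(1)] vec.subspace_0[OF subH] by metis
        ultimately show "c \<in> G_circles H"
          using v h_add[OF v(1)] by (auto simp: G_circles_def proj_point_iff)
      qed
      show "G_circles H \<subseteq> cir ` H"
      proof
        fix c assume c: "c \<in> G_circles H"
        then obtain u where u: "u \<noteq> 0" "c = vec.span {u}"
          by (auto simp: G_circles_def proj_point_iff)
        have "u \<notin> H"
        proof
          assume "u \<in> H"
          hence "c \<subseteq> H"
            using u subH by (simp add: vec.span_minimal)
          thus False
            using c by (simp add: G_circles_def)
        qed
        then obtain k v where "k \<noteq> 0" "v \<in> H" "u = k *s (h + v)"
          using normal by blast
        thus "c \<in> cir ` H"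
          using span_singleton_eqI[of u k "h + v"] u(2) by (auto simp: cir_def)
      qed
    qed
  qed
  define vc where "vc = inv_into H cir"
  have vc: "bij_betw vc (G_circles H) H"
    unfolding vc_def by (rule bij_betw_inv_into[OF cir_bij])
  have cir_vc: "c = vec.span {h + vc c}" "vc c \<in> H" if "c \<in> G_circles H" for c
    using bij_betw_inv_into_right[OF cir_bij that] bij_betwE[OF vc] that by (auto simp: cir_def vc_def)
  define P where "P = (\<lambda>j v. vec.span (insert (h + v) (K j)))"
  define L where "L = (\<lambda>j. G_line_points n H (K ` {1..s}) (K j))"
  have P_mem: "P j v \<in> L j" if j: "j \<in> {1..s}" and v: "v \<in> H" for j v
  proof -
    have "h + v \<notin> vec.span (K j)"
      using h_add[OF v] KH[OF j] subK[OF j] by (metis subsetD vec.span_eq_iff)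
    hence "vec.dim (P j v) = 2 * n + 1"
      using dimK[OF j] by (simp add: P_def vec.dim_insert)
    hence "P j v \<in> proj_subspaces (2 * n)"
      by (simp add: P_def proj_subspaces_def)
    moreover have "h + v \<in> P j v" "K j \<subseteq> P j v"
      by (auto simp: P_def intro: vec.span_base)
    ultimately show ?thesis
      using h_add[OF v] j by (auto simp: L_def G_line_points_def G_points_def)
  qed
  have P_unique: "Q = P j v" if j: "j \<in> {1..s}" and v: "v \<in> H" and Q: "Q \<in> L j" "h + v \<in> Q" for j v Q
  proof -
    have "vec.subspace Q" "vec.dim Q = 2 * n + 1" "K j \<subseteq> Q"
      using Q by (auto simp: L_def G_line_points_def G_points_def proj_subspaces_def)
    moreover have "vec.subspace (P j v)" "vec.dim (P j v) = 2 * n + 1"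
      using P_mem[OF j v] by (auto simp: L_def G_line_points_def G_points_def proj_subspaces_def)
    moreover have "P j v \<subseteq> Q"
      unfolding P_def by (rule vec.span_minimal) (use Q calculation in auto)
    ultimately show ?thesis
      using vec.subspace_dim_equal[of "P j v" Q] by simp
  qed
  have P_eq: "P j u = P j v \<longleftrightarrow> ev (\<tau> j) (\<Psi> u) = ev (\<tau> j) (\<Psi> v)"
    if j: "j \<in> {1..s}" and uv: "u \<in> H" "v \<in> H" for j u v
  proof -
    have mem: "x \<in> P j v" if "x = h + v \<or> x \<in> K j" for x
      using that by (auto simp: P_def intro: vec.span_base)
    have "P j u = P j v \<longleftrightarrow> h + u \<in> P j v"
    proof
      assume "P j u = P j v"
      thus "h + u \<in> P j v"
        by (metis P_def insertI1 vec.span_base)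
    next
      assume "h + u \<in> P j v"
      thus "P j u = P j v"
        using P_unique[OF j uv(1) P_mem[OF j uv(2)]] by simp
    qed
    also have "\<dots> \<longleftrightarrow> u - v \<in> P j v"
    proof
      assume "h + u \<in> P j v"
      hence "(h + u) - (h + v) \<in> P j v"
        using mem[of "h + v"] unfolding P_def by (metis vec.span_diff)
      thus "u - v \<in> P j v"
        by simp
    next
      assume "u - v \<in> P j v"
      hence "(h + v) + (u - v) \<in> P j v"
        using mem[of "h + v"] unfolding P_def by (metis vec.span_add)
      thus "h + u \<in> P j v"
        by simp
    qed
    also have "\<dots> \<longleftrightarrow> u - v \<in> K j"
      using mem mem_span_insert_hyperplane[OF subH subK[OF j] KH[OF j] h_add[OF uv(2)], of "u - v"]
        vec.subspace_diff[OF subH uv] by (auto simp: P_def)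
    also have "\<dots> \<longleftrightarrow> ev (\<tau> j) (\<Psi> u) = ev (\<tau> j) (\<Psi> v)"
      using uv vec.subspace_diff[OF subH uv] by (simp add: K_eq[OF j] \<Psi>_diff dot3_diff)
    finally show ?thesis .
  qed
  have P_surj: "\<exists>v\<in>H. Q = P j v" if j: "j \<in> {1..s}" and Q: "Q \<in> L j" for j Q
  proof -
    obtain u where u: "u \<in> Q" "u \<notin> H"
      using Q by (auto simp: L_def G_line_points_def G_points_def)
    obtain k v where kv: "k \<noteq> 0" "v \<in> H" "u = k *s (h + v)"
      using normal[OF u(2)] by blast
    have "vec.subspace Q"
      using Q by (auto simp: L_def G_line_points_def G_points_def proj_subspaces_def)
    hence "inverse k *s u \<in> Q"
      using u vec.subspace_scale by blast
    hence "h + v \<in> Q"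
      using kv by simp
    thus ?thesis
      using P_unique[OF j kv(2) Q] kv(2) by blast
  qed
  have array: "G_array n H s K lab j c = lab j (P j (vc c))" if j: "j \<in> {1..s}" and c: "c \<in> G_circles H" for j c
  proof -
    have sub: "c \<subseteq> Q \<longleftrightarrow> h + vc c \<in> Q" if "vec.subspace Q" for Q
      using cir_vc(1)[OF c] that vec.span_minimal[of "{h + vc c}" Q] vec.span_base[of "h + vc c" "{h + vc c}"]
      by auto
    have subQ: "vec.subspace Q" if "Q \<in> L j" for Q
      using that by (auto simp: L_def G_line_points_def G_points_def proj_subspaces_def)
    have "(THE Q. Q \<in> L j \<and> c \<subseteq> Q) = P j (vc c)"
    proof (rule the_equality)
      have "h + vc c \<in> P j (vc c)"
        by (simp add: P_def vec.span_base)
      thus "P j (vc c) \<in> L j \<and> c \<subseteq> P j (vc c)"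
        using P_mem[OF j cir_vc(2)[OF c]] sub subQ by blast
      show "Q = P j (vc c)" if "Q \<in> L j \<and> c \<subseteq> Q" for Q
        using that sub subQ P_unique[OF j cir_vc(2)[OF c]] by blast
    qed
    thus ?thesis
      by (simp add: G_array_def L_def)
  qed
  \<comment> \<open>A representative in \<open>H\<close> of each value of the evaluation, so that
    the points of the line \<open>K j\<close> can be named by field elements.\<close>
  define vy where "vy = (\<lambda>j y. inv_into H \<Psi> (SOME w. ev (\<tau> j) w = y))"
  have vy: "vy j y \<in> H" "ev (\<tau> j) (\<Psi> (vy j y)) = y" for j y
  proof -
    have "card {w. ev (\<tau> j) w = y} = CARD('b) ^ 2"
      by (rule card_plane[OF veronese_neq_0])
    hence "{w. ev (\<tau> j) w = y} \<noteq> {}"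
      by (metis card.empty power_not_zero zero_less_card_finite less_numeral_extra(3))
    hence "ev (\<tau> j) (SOME w. ev (\<tau> j) w = y) = y"
      by (metis (mono_tags, lifting) empty_Collect_eq someI_ex)
    thus "ev (\<tau> j) (\<Psi> (vy j y)) = y"
      unfolding vy_def using bij_betw_inv_into_right[OF \<Psi>] by simp
    show "vy j y \<in> H"
      unfolding vy_def using bij_betw_inv_into[OF \<Psi>] by (auto simp: bij_betw_def)
  qed
  define l where "l = (\<lambda>j y. lab j (P j (vy j y)))"
  have "bij_betw (l j) UNIV M" if j: "j \<in> {1..s}" for j
  proof -
    have "bij_betw (\<lambda>y. P j (vy j y)) UNIV (L j)"
      unfolding bij_betw_def
    proof
      show "inj (\<lambda>y. P j (vy j y))"
        using P_eq[OF j] vy by (auto intro!: injI)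
      show "range (\<lambda>y. P j (vy j y)) = L j"
      proof
        show "L j \<subseteq> range (\<lambda>y. P j (vy j y))"
        proof
          fix Q assume "Q \<in> L j"
          then obtain v where v: "v \<in> H" "Q = P j v"
            using P_surj[OF j] by blast
          have "Q = P j (vy j (ev (\<tau> j) (\<Psi> v)))"
            using v P_eq[OF j v(1) vy(1)] vy(2) by simp
          thus "Q \<in> range (\<lambda>y. P j (vy j y))"
            by blast
        qed
      qed (use P_mem[OF j] vy in auto)
    qed
    from bij_betw_trans[OF this] lab[OF j] show ?thesis
      unfolding l_def L_def by (simp add: o_def)
  qed
  moreover have "G_array n H s K lab j c = l j (ev (\<tau> j) (\<Psi> (vc c)))"
    if j: "j \<in> {1..s}" and c: "c \<in> G_circles H" for j c
  proof -
    have "P j (vc c) = P j (vy j (ev (\<tau> j) (\<Psi> (vc c))))"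
      using P_eq[OF j cir_vc(2)[OF c] vy(1)] vy(2) by simp
    thus ?thesis
      using array[OF that] by (simp add: l_def)
  qed
  moreover have "bij_betw (\<Psi> \<circ> vc) (G_circles H) UNIV"
    by (rule bij_betw_trans[OF vc \<Psi>])
  ultimately have "coordinates s M (G_circles H) (G_array n H s K lab) (\<Psi> \<circ> vc) \<tau> l"
    using \<tau> by (simp add: coordinates_def)
  thus ?thesis
    by blast
qed

section \<open>From the Desarguesian spread to coordinates of \<open>H\<close>\<close>

lemma spread_element:
  fixes \<phi> :: "'b::field ^ 2 \<Rightarrow> 'v"
  assumes L: "L \<in> proj_subspaces 0" and inj: "inj \<phi>"
  defines "\<Phi> \<equiv> \<lambda>z. \<phi> (vector [fst z, snd z])"
  shows "\<exists>t. \<forall>z. \<Phi> z \<in> \<phi> ` L \<longleftrightarrow> br z (pt t) = 0"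
proof -
  obtain u where u: "u \<noteq> 0" "L = vec.span {u}"
    using L by (auto simp: proj_point_iff)
  have nz: "(u$1, u$2) \<noteq> (0, 0)"
    using u(1) by (auto simp: vec_eq_iff forall_2)
  then obtain t k where t: "k \<noteq> 0" "(u$1, u$2) = (k * fst (pt t), k * snd (pt t))"
    using exists_pt by blast
  have "\<Phi> z \<in> \<phi> ` L \<longleftrightarrow> br z (pt t) = 0" for z
  proof -
    have "\<Phi> z \<in> \<phi> ` L \<longleftrightarrow> vector [fst z, snd z] \<in> L"
      unfolding \<Phi>_def using inj by (simp add: inj_image_mem_iff)
    also have "\<dots> \<longleftrightarrow> (\<exists>k. z = (k * u$1, k * u$2))"
      by (auto simp: u(2) vec.span_singleton image_iff vec_eq_iff forall_2 prod_eq_iff)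
    also have "\<dots> \<longleftrightarrow> br z (u$1, u$2) = 0"
      using br_eq_0_iff[OF nz] by simp
    also have "\<dots> \<longleftrightarrow> br z (pt t) = 0"
      unfolding t(2) using t(1) by (auto simp: br_def algebra_simps)
    finally show ?thesis .
  qed
  thus ?thesis
    by blast
qed

lemma dual_pseudo_arc_coordinates:
  fixes H :: "('a::{field,finite} ^ 'd) set" and \<iota> :: "'a \<Rightarrow> 'b::{field,finite}"
  assumes n: "1 \<le> n" and card: "CARD('b) = CARD('a) ^ n" and odd: "odd CARD('b)"
    and H: "H \<in> proj_subspaces (3 * n - 1)"
    and inj_K: "inj_on K {1..s}" and arc: "dual_pseudo_arc n H (K ` {1..s})"
    and m: "is_m2' TYPE('b) m" "m < s"
    and i0: "i0 \<in> {1..s}" and spread: "desarguesian_spread \<iota> (K i0) \<D>"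
    and subset: "{K j \<inter> K i0 | j. j \<in> {1..s} \<and> j \<noteq> i0} \<subseteq> \<D>"
  shows "\<exists>\<tau> (\<Psi> :: 'a ^ 'd \<Rightarrow> 'b ^ 3). inj_on \<tau> {1..s} \<and> bij_betw \<Psi> H UNIV \<and>
    (\<forall>u\<in>H. \<forall>v\<in>H. \<Psi> (u + v) = \<Psi> u + \<Psi> v) \<and> (\<forall>j\<in>{1..s}. K j = {v \<in> H. ev (\<tau> j) (\<Psi> v) = 0})"
proof -
  define J where "J = {1..s} - {i0}"
  have pow: "CARD('b) ^ k = CARD('a) ^ (k * n)" for k
    by (simp add: card mult.commute flip: power_mult)
  have subH: "vec.subspace H" and cardH: "card H = CARD('b) ^ 3"
    using H n card_subspace[of H] by (auto simp: proj_subspaces_def pow)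
  have subK: "vec.subspace (K j)" and cardK: "card (K j) = CARD('b) ^ 2" and KH: "K j \<subseteq> H"
    if "j \<in> {1..s}" for j
  proof -
    have "K j \<in> proj_subspaces (2 * n - 1)" "K j \<subseteq> H"
      using arc that by (auto simp: dual_pseudo_arc_def)
    thus "vec.subspace (K j)" "card (K j) = CARD('b) ^ 2" "K j \<subseteq> H"
      using n card_subspace[of "K j"] by (auto simp: proj_subspaces_def pow)
  qed
  have triple: "v = 0" if "i \<in> {1..s}" "j \<in> {1..s}" "k \<in> {1..s}" "i \<noteq> j" "j \<noteq> k" "i \<noteq> k"
    "v \<in> K i" "v \<in> K j" "v \<in> K k" for i j k v
  proof -
    have "K i \<noteq> K j" "K j \<noteq> K k" "K i \<noteq> K k"
      using inj_K that by (auto dest: inj_onD)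
    hence "K i \<inter> K j \<inter> K k = {0}"
      using arc that by (auto simp: dual_pseudo_arc_def)
    thus ?thesis
      using that by blast
  qed
  obtain \<phi> :: "'b ^ 2 \<Rightarrow> 'a ^ 'd" where \<phi>: "\<And>x y. \<phi> (x + y) = \<phi> x + \<phi> y" "bij_betw \<phi> UNIV (K i0)"
      "\<D> = (\<lambda>L. \<phi> ` L) ` proj_subspaces 0"
    using spread unfolding desarguesian_spread_def by blast
  have inj_\<phi>: "inj \<phi>"
    using \<phi>(2) by (simp add: bij_betw_def)
  define \<Phi> where "\<Phi> = (\<lambda>z. \<phi> (vector [fst z, snd z]))"
  have \<Phi>_add: "\<Phi> (y + z) = \<Phi> y + \<Phi> z" for y z
  proof -
    have "(vector [fst (y + z), snd (y + z)] :: 'b ^ 2) = vector [fst y, snd y] + vector [fst z, snd z]"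
      by (simp add: vec_eq_iff forall_2)
    thus ?thesis
      by (simp add: \<Phi>_def \<phi>(1))
  qed
  have \<Phi>_0: "\<Phi> 0 = 0"
    using \<Phi>_add[of 0 0] by simp
  have \<Phi>_diff: "\<Phi> (y - z) = \<Phi> y - \<Phi> z" for y z
    using \<Phi>_add[of "y - z" z] by simp
  have inj_\<Phi>: "inj \<Phi>"
  proof (rule injI)
    fix y z assume "\<Phi> y = \<Phi> z"
    hence "(vector [fst y, snd y] :: 'b ^ 2) = vector [fst z, snd z]"
      using inj_\<phi> by (simp add: \<Phi>_def inj_eq)
    thus "y = z"
      by (simp add: vec_eq_iff forall_2 prod_eq_iff)
  qed
  have range_\<Phi>: "range \<Phi> = K i0"
  proof -
    have "\<phi> u = \<Phi> (u$1, u$2)" for u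
    proof -
      have "u = vector [u$1, u$2]"
        by (simp add: vec_eq_iff forall_2)
      thus ?thesis
        by (simp add: \<Phi>_def)
    qed
    hence "range \<phi> \<subseteq> range \<Phi>"
      by auto
    thus ?thesis
      using \<phi>(2) by (auto simp: bij_betw_def \<Phi>_def)
  qed
  have J: "j \<in> {1..s}" "j \<noteq> i0" if "j \<in> J" for j
    using that by (auto simp: J_def)
  have "\<forall>j\<in>J. \<exists>t. \<forall>z. \<Phi> z \<in> K j \<longleftrightarrow> br z (pt t) = 0"
  proof
    fix j assume j: "j \<in> J"
    hence "K j \<inter> K i0 \<in> \<D>"
      using subset J by blast
    then obtain L where L: "L \<in> proj_subspaces 0" "K j \<inter> K i0 = \<phi> ` L"
      using \<phi>(3) by blast
    have "\<Phi> z \<in> K j \<longleftrightarrow> \<Phi> z \<in> \<phi> ` L" for z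
      using range_\<Phi> by (auto simp flip: L(2))
    thus "\<exists>t. \<forall>z. \<Phi> z \<in> K j \<longleftrightarrow> br z (pt t) = 0"
      using spread_element[OF L(1) inj_\<phi>] by (simp add: \<Phi>_def)
  qed
  from bchoice[OF this] obtain \<tau> where "\<forall>j\<in>J. \<forall>z. \<Phi> z \<in> K j \<longleftrightarrow> br z (pt (\<tau> j)) = 0" ..
  hence \<Phi>_K: "\<Phi> z \<in> K j \<longleftrightarrow> br z (pt (\<tau> j)) = 0" if "j \<in> J" for j z
    using that by blast
  have decomp: "\<exists>z. v - \<Phi> z \<in> K j" if j: "j \<in> J" and v: "v \<in> H" for j v
  proof -
    obtain w where w: "br w (pt (\<tau> j)) \<noteq> 0"
    proof -
      have "br (0, 1) (pt (\<tau> j)) \<noteq> 0 \<or> br (1, 0) (pt (\<tau> j)) \<noteq> 0"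
        by (cases "\<tau> j") (auto simp: pt_def br_def)
      thus ?thesis
        using that by blast
    qed
    \<comment> \<open>The image under \<open>\<Phi>\<close> of the multiples of \<open>w\<close> is
      a complement of \<open>K j\<close>: the sums are distinct, and their number r^2 * r is the
      size of \<open>H\<close>.\<close>
    define f where "f = (\<lambda>(x, t). x + \<Phi> (t * fst w, t * snd w))"
    have "inj_on f (K j \<times> UNIV)"
    proof (rule inj_onI)
      fix a b assume ab: "a \<in> K j \<times> UNIV" "b \<in> K j \<times> UNIV" "f a = f b"
      obtain x t y t' where xy: "a = (x, t)" "b = (y, t')"
        by (metis surj_pair)
      let ?z = "((t - t') * fst w, (t - t') * snd w)"
      have "?z = (t * fst w, t * snd w) - (t' * fst w, t' * snd w)"
        by (simp add: prod_eq_iff algebra_simps)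
      hence "\<Phi> ?z = \<Phi> (t * fst w, t * snd w) - \<Phi> (t' * fst w, t' * snd w)"
        by (simp only: \<Phi>_diff)
      also have "\<dots> = y - x"
        using ab(3) by (simp add: f_def xy algebra_simps)
      finally have "\<Phi> ?z \<in> K j"
        using ab xy vec.subspace_diff[OF subK[OF J(1)[OF j]]] by simp
      hence "br ?z (pt (\<tau> j)) = 0"
        using \<Phi>_K[OF j] by blast
      moreover have "br ?z (pt (\<tau> j)) = (t - t') * br w (pt (\<tau> j))"
        by (simp add: br_def algebra_simps)
      ultimately have "t = t'"
        using w by simp
      thus "a = b"
        using ab(3) by (simp add: xy f_def)
    qed
    hence "card (f ` (K j \<times> UNIV)) = card H"
      using cardK[OF J(1)[OF j]] cardH
      by (simp add: card_image card_cartesian_product power2_eq_square power3_eq_cube)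
    moreover have "\<Phi> z \<in> H" for z
      using KH[OF i0] range_\<Phi> by auto
    hence "f ` (K j \<times> UNIV) \<subseteq> H"
      using KH[OF J(1)[OF j]] vec.subspace_add[OF subH] by (auto simp: f_def)
    ultimately have "v \<in> f ` (K j \<times> UNIV)"
      using v card_subset_eq[of H "f ` (K j \<times> UNIV)"] by simp
    then obtain x t where "x \<in> K j" "v = x + \<Phi> (t * fst w, t * snd w)"
      by (auto simp: f_def)
    hence "v - \<Phi> (t * fst w, t * snd w) \<in> K j"
      by simp
    thus ?thesis ..
  qed
  \<comment> \<open>The quotient of \<open>H\<close> by \<open>K j\<close> is identified with the
    field by way of \<open>K i0\<close>; \<open>\<mu>_eq\<close> shows that the bracket does not
    depend on the choice of \<open>z\<close>.\<close>
  define \<mu> where "\<mu> = (\<lambda>j v. br (SOME z. v - \<Phi> z \<in> K j) (pt (\<tau> j)))"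
  have \<mu>_eq: "\<mu> j v = br z (pt (\<tau> j))" if j: "j \<in> J" and z: "v - \<Phi> z \<in> K j" for j v z
  proof -
    have "v - \<Phi> (SOME z. v - \<Phi> z \<in> K j) \<in> K j"
      using z by (rule someI)
    hence "(v - \<Phi> z) - (v - \<Phi> (SOME z. v - \<Phi> z \<in> K j)) \<in> K j"
      using z vec.subspace_diff[OF subK[OF J(1)[OF j]]] by blast
    hence "\<Phi> ((SOME z. v - \<Phi> z \<in> K j) - z) \<in> K j"
      by (simp add: \<Phi>_diff)
    hence "br ((SOME z. v - \<Phi> z \<in> K j) - z) (pt (\<tau> j)) = 0"
      using \<Phi>_K[OF j] by blast
    thus ?thesis
      by (simp add: \<mu>_def br_diff_left)
  qed
  have \<mu>_add: "\<mu> j (u + v) = \<mu> j u + \<mu> j v" if j: "j \<in> J" and uv: "u \<in> H" "v \<in> H" for j u v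
  proof -
    obtain y z where yz: "u - \<Phi> y \<in> K j" "v - \<Phi> z \<in> K j"
      using decomp[OF j] uv by metis
    hence "(u - \<Phi> y) + (v - \<Phi> z) \<in> K j"
      using vec.subspace_add[OF subK[OF J(1)[OF j]]] by blast
    hence "(u + v) - \<Phi> (y + z) \<in> K j"
      by (simp add: \<Phi>_add algebra_simps)
    thus ?thesis
      using \<mu>_eq[OF j] yz by (simp add: br_add_left)
  qed
  have \<mu>_iff: "\<mu> j v = 0 \<longleftrightarrow> v \<in> K j" if j: "j \<in> J" and v: "v \<in> H" for j v
  proof
    assume *: "\<mu> j v = 0"
    obtain z where z: "v - \<Phi> z \<in> K j"
      using decomp[OF j v] ..
    hence "\<Phi> z \<in> K j"
      using * \<mu>_eq[OF j z] \<Phi>_K[OF j] by simp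
    hence "(v - \<Phi> z) + \<Phi> z \<in> K j"
      using z vec.subspace_add[OF subK[OF J(1)[OF j]]] by blast
    thus "v \<in> K j"
      by simp
  next
    assume "v \<in> K j"
    hence "v - \<Phi> 0 \<in> K j"
      by (simp add: \<Phi>_0)
    from \<mu>_eq[OF j this] show "\<mu> j v = 0"
      by (simp add: br_def)
  qed
  have inj_\<tau>: "inj_on \<tau> J"
  proof (rule inj_onI, rule ccontr)
    fix j k assume jk: "j \<in> J" "k \<in> J" "\<tau> j = \<tau> k" "j \<noteq> k"
    have "\<Phi> (pt (\<tau> j)) \<in> K j" "\<Phi> (pt (\<tau> j)) \<in> K k" "\<Phi> (pt (\<tau> j)) \<in> K i0"
      using \<Phi>_K[OF jk(1)] \<Phi>_K[OF jk(2)] jk(3) range_\<Phi> by auto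
    hence "\<Phi> (pt (\<tau> j)) = \<Phi> 0"
      using triple[of j k i0] jk J i0 \<Phi>_0 by metis
    hence "pt (\<tau> j) = (0, 0)"
      using inj_\<Phi> by (simp add: inj_eq zero_prod_def)
    thus False
      using pt_neq_0 by blast
  qed
  have card_J: "card J = s - 1"
    using i0 by (simp add: J_def card_Diff_singleton)
  have gt1: "1 < CARD('b)"
    using two_le_card_field[where 'b = 'b] by simp
  interpret field_reduction H \<Phi> J \<tau> \<mu> m
  proof
    show "range \<Phi> \<noteq> H"
    proof
      assume "range \<Phi> = H"
      hence "CARD('b) ^ 2 = CARD('b) ^ 3"
        using cardH cardK[OF i0] range_\<Phi> by simp
      thus False
        using gt1 power_inject_exp[of "CARD('b)" 2 3] by simp
    qed
    show "\<Phi> z \<in> H" for z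
      using KH[OF i0] range_\<Phi> by auto
    show "\<mu> j (\<Phi> z) = br z (pt (\<tau> j))" if "j \<in> J" for j z
      using \<mu>_eq[OF that, of "\<Phi> z" z] vec.subspace_0[OF subK[OF J(1)[OF that]]] by simp
    show "v = 0" if "i \<in> J" "j \<in> J" "k \<in> J" "i \<noteq> j" "j \<noteq> k" "i \<noteq> k" "v \<in> H"
      "\<mu> i v = 0" "\<mu> j v = 0" "\<mu> k v = 0" for i j k v
      using triple[of i j k v] that J \<mu>_iff by metis
    show "u + v \<in> H" "u - v \<in> H" if "u \<in> H" "v \<in> H" for u v
      using that vec.subspace_add[OF subH] vec.subspace_diff[OF subH] by blast+
  qed (use odd m card_J \<mu>_add inj_\<tau> in auto)
  obtain \<tau>0 \<Psi> where \<tau>0: "\<tau>0 \<notin> \<tau> ` J" and \<Psi>: "\<forall>u\<in>H. \<forall>v\<in>H. \<Psi> (u + v) = \<Psi> u + \<Psi> v"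
      "\<forall>j\<in>J. \<forall>v\<in>H. ev (\<tau> j) (\<Psi> v) = 0 \<longleftrightarrow> \<mu> j v = 0" "\<forall>z. ev \<tau>0 (\<Psi> (\<Phi> z)) = 0"
    using conic_coordinates by blast
  have \<Psi>_diff: "\<Psi> (u - v) = \<Psi> u - \<Psi> v" if "u \<in> H" "v \<in> H" for u v
    using \<Psi>(1) vec.subspace_diff[OF subH that] that by (metis add_diff_cancel diff_add_cancel)
  define \<tau>' where "\<tau>' = \<tau>(i0 := \<tau>0)"
  have "inj_on \<tau>' {1..s}"
  proof -
    have "{1..s} = insert i0 J"
      using i0 by (auto simp: J_def)
    moreover have "inj_on \<tau>' J"
      using inj_\<tau> by (subst inj_on_cong[of _ \<tau>' \<tau>]) (auto simp: \<tau>'_def J_def)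
    moreover have "\<tau>' ` (J - {i0}) \<subseteq> \<tau> ` J" "\<tau>' i0 = \<tau>0"
      by (auto simp: \<tau>'_def)
    hence "\<tau>' i0 \<notin> \<tau>' ` (J - {i0})"
      using \<tau>0 by auto
    ultimately show ?thesis
      by (simp add: inj_on_insert)
  qed
  moreover have bij: "bij_betw \<Psi> H UNIV"
  proof -
    have "inj_on \<Psi> H"
    proof (rule inj_onI)
      fix u v assume uv: "u \<in> H" "v \<in> H" "\<Psi> u = \<Psi> v"
      have uvH: "u - v \<in> H"
        using uv H_diff by blast
      have "ev (\<tau> j) (\<Psi> (u - v)) = 0" for j
        using \<Psi>_diff uv by (simp add: dot3_def)
      hence mem: "u - v \<in> K j" if "j \<in> J" for j
        using \<Psi>(2) that uvH \<mu>_iff by blast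
      have "3 \<le> card J"
        using J5 by simp
      from obtain_three[OF this] obtain i j k where "i \<in> J" "j \<in> J" "k \<in> J" "i \<noteq> j" "j \<noteq> k" "i \<noteq> k"
        by blast
      hence "u - v = 0"
        using triple[of i j k "u - v"] J mem by blast
      thus "u = v"
        by simp
    qed
    moreover from this have "\<Psi> ` H = UNIV"
      by (intro card_subset_eq) (auto simp: card_image cardH)
    ultimately show ?thesis
      by (simp add: bij_betw_def)
  qed
  moreover have "K j = {v \<in> H. ev (\<tau>' j) (\<Psi> v) = 0}" if j: "j \<in> {1..s}" for j
  proof (cases "j = i0")
    case True
    \<comment> \<open>For \<open>i0\<close> one inclusion is part of
      \<open>conic_coordinates\<close>; equality follows because both sets have r^2
      elements.\<close>
    have "\<Psi> ` {v \<in> H. ev \<tau>0 (\<Psi> v) = 0} = {c. ev \<tau>0 c = 0}"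
    proof
      show "{c. ev \<tau>0 c = 0} \<subseteq> \<Psi> ` {v \<in> H. ev \<tau>0 (\<Psi> v) = 0}"
      proof
        fix c assume c: "c \<in> {c. ev \<tau>0 c = 0}"
        obtain v where "v \<in> H" "c = \<Psi> v"
          using bij by (metis UNIV_I bij_betw_imp_surj_on imageE)
        thus "c \<in> \<Psi> ` {v \<in> H. ev \<tau>0 (\<Psi> v) = 0}"
          using c by simp
      qed
    qed auto
    moreover have "inj_on \<Psi> {v \<in> H. ev \<tau>0 (\<Psi> v) = 0}"
      using bij by (auto simp: bij_betw_def intro: inj_on_subset)
    ultimately have "bij_betw \<Psi> {v \<in> H. ev \<tau>0 (\<Psi> v) = 0} {c. ev \<tau>0 c = 0}"
      by (simp add: bij_betw_def)
    from bij_betw_same_card[OF this] have "card {v \<in> H. ev \<tau>0 (\<Psi> v) = 0} = CARD('b) ^ 2"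
      by (simp add: card_plane veronese_neq_0)
    moreover have "K i0 \<subseteq> {v \<in> H. ev \<tau>0 (\<Psi> v) = 0}"
    proof
      fix v assume v: "v \<in> K i0"
      then obtain z where "v = \<Phi> z"
        using range_\<Phi> by blast
      thus "v \<in> {v \<in> H. ev \<tau>0 (\<Psi> v) = 0}"
        using KH[OF i0] \<Psi>(3) v by blast
    qed
    ultimately show ?thesis
      using cardK[OF i0] True by (simp add: \<tau>'_def card_subset_eq)
  next
    case False
    hence "j \<in> J"
      using j by (simp add: J_def)
    thus ?thesis
      using \<Psi>(2) \<mu>_iff KH[OF j] False by (auto simp: \<tau>'_def)
  qed
  ultimately show ?thesis
    using \<Psi>(1) by blast
qed

theorem theorem7p2:
  fixes q n s m :: nat
    and \<iota> :: "'a::{field,finite} \<Rightarrow> 'b::{field,finite}"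
    and H :: "('a ^ 'd) set"
    and K :: "nat \<Rightarrow> ('a ^ 'd) set"
    and lab :: "nat \<Rightarrow> ('a ^ 'd) set \<Rightarrow> 'm"
    and M :: "'m set"
  assumes "CARD('a) = q" and "odd q" and "n \<ge> 1"
    and "CARD('b) = q ^ n" and "field_embedding \<iota>"
    and "CARD('d) = 3 * n + 1" and "H \<in> proj_subspaces (3 * n - 1)"
    and "inj_on K {1..s}" and "dual_pseudo_arc n H (K ` {1..s})"
    and "is_m2' TYPE('b) m" and "s > m"
    and "\<And>i. i \<in> {1..s} \<Longrightarrow> bij_betw (lab i) (G_line_points n H (K ` {1..s}) (K i)) M"
    and "\<exists>i\<in>{1..s}. \<exists>\<D>. desarguesian_spread \<iota> (K i) \<D> \<and>
           {K j \<inter> K i | j. j \<in> {1..s} \<and> j \<noteq> i} \<subseteq> \<D>"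
  defines "is_extension \<equiv> \<lambda>A.
      orthogonal_array 3 (q ^ n) (q ^ n + 1) 1 M (G_circles H) A \<and>
      extends_array (G_circles H) s (G_array n H s K lab) (q ^ n + 1) A"
  shows "(\<exists>A. is_extension A) \<and>
         (\<forall>A A'. is_extension A \<and> is_extension A' \<longrightarrow>
            same_extension M (G_circles H) s (q ^ n + 1) A A') \<and>
         (\<forall>A. is_extension A \<longrightarrow>
            forms_miquelian_laguerre_plane (q ^ n + 1) M (G_circles H) A)"
proof -
  let ?Cols = "G_circles H" and ?A = "G_array n H s K lab" and ?k = "CARD('b) + 1"
  have odd: "odd CARD('b)"
    using assms(2,4) by simp
  have card: "CARD('b) = CARD('a) ^ n"
    using assms(1,4) by simp
  obtain i0 \<D> where i0: "i0 \<in> {1..s}" "desarguesian_spread \<iota> (K i0) \<D>"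
      "{K j \<inter> K i0 | j. j \<in> {1..s} \<and> j \<noteq> i0} \<subseteq> \<D>"
    using assms(13) by blast
  obtain \<tau> and \<Psi> :: "'a ^ 'd \<Rightarrow> 'b ^ 3" where \<tau>: "inj_on \<tau> {1..s}" and \<Psi>: "bij_betw \<Psi> H UNIV"
      "\<forall>u\<in>H. \<forall>v\<in>H. \<Psi> (u + v) = \<Psi> u + \<Psi> v" "\<forall>j\<in>{1..s}. K j = {v \<in> H. ev (\<tau> j) (\<Psi> v) = 0}"
    using dual_pseudo_arc_coordinates[OF assms(3) card odd assms(7-11) i0] by blast
  have "K j \<in> proj_subspaces (2 * n - 1)" if "j \<in> {1..s}" for j
    using assms(9) that by (auto simp: dual_pseudo_arc_def)
  from G_array_coordinates[OF assms(3,6,7) this assms(12) \<tau> \<Psi>(1)] \<Psi>(2,3)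
  obtain \<theta> :: "('a ^ 'd) set \<Rightarrow> 'b ^ 3" and l where coord: "coordinates s M ?Cols ?A \<theta> \<tau> l"
    by blast
  have m: "5 \<le> m"
    by (rule is_m2'_ge_5[OF odd assms(10)])
  have sk: "s \<le> ?k"
    using coordinates_extend(1)[OF coord] m assms(11) by simp
  \<comment> \<open>This follows from \<open>5 \<le> m < s\<close> and
    \<open>s \<le> CARD('b) + 1\<close>.\<close>
  have three: "3 \<le> CARD('b)"
    using sk m assms(11) by simp
  have secant: "\<exists>a\<in>\<tau> ` {1..s}. \<exists>b\<in>\<tau> ` {1..s}. a \<noteq> b \<and> u \<in> vec.span {veronese a, veronese b}"
    if "u \<noteq> 0" "\<And>\<tau> k. u \<noteq> k *s veronese \<tau>" for u :: "'b ^ 3"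
    by (rule mem_secant_of_large_arc[OF odd assms(10) _ that]) (use \<tau> assms(11) in \<open>simp add: card_image\<close>)
  have ext: "is_extension A \<longleftrightarrow> orthogonal_array 3 CARD('b) ?k 1 M ?Cols A \<and>
      (\<forall>i\<in>{1..s}. \<forall>c\<in>?Cols. A i c = ?A i c)" for A
    using sk by (simp add: is_extension_def extends_array_def assms(4))
  \<comment> \<open>Every extension has coordinates over the same \<open>\<theta>\<close> as the
    given rows. Both uniqueness and the Miquelian property of an arbitrary extension thereby become
    statements about coordinates.\<close>
  have extension: "\<exists>\<tau>' l'. coordinates ?k M ?Cols A \<theta> \<tau>' l' \<and> (\<forall>i\<in>{1..s}. \<tau>' i = \<tau> i)"
    if A: "is_extension A" for A
  proof (rule extension_coordinates[OF three _ _ sk _ secant])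
    show "coordinates s M ?Cols A \<theta> \<tau> l"
      using coord A by (simp add: coordinates_def ext)
    show "orthogonal_array 3 CARD('b) ?k 1 M ?Cols A"
      using A by (simp add: ext)
  qed (use three in auto)
  have "\<exists>A. is_extension A"
  proof -
    obtain A \<tau>' l' where A: "coordinates ?k M ?Cols A \<theta> \<tau>' l'"
        "\<forall>i\<in>{1..s}. \<forall>c\<in>?Cols. A i c = ?A i c"
      using coordinates_extend(2)[OF coord] m assms(11) by auto
    thus ?thesis
      using coordinates_orthogonal_array[OF A(1)] ext by auto
  qed
  moreover have "same_extension M ?Cols s (q ^ n + 1) A A'" if A: "is_extension A" "is_extension A'" for A A'
  proof -
    obtain \<tau>1 l1 where 1: "coordinates ?k M ?Cols A \<theta> \<tau>1 l1" "\<forall>i\<in>{1..s}. \<tau>1 i = \<tau> i"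
      using extension[OF A(1)] by blast
    obtain \<tau>2 l2 where 2: "coordinates ?k M ?Cols A' \<theta> \<tau>2 l2" "\<forall>i\<in>{1..s}. \<tau>2 i = \<tau> i"
      using extension[OF A(2)] by blast
    show ?thesis
      unfolding assms(4)[symmetric]
      by (rule coordinates_same_extension[OF 1(1) 2(1) sk]) (use 1(2) 2(2) A in \<open>simp_all add: ext\<close>)
  qed
  moreover have "forms_miquelian_laguerre_plane (q ^ n + 1) M ?Cols A" if A: "is_extension A" for A
  proof -
    obtain \<tau>' l' where "coordinates ?k M ?Cols A \<theta> \<tau>' l'"
      using extension[OF A] by blast
    moreover have "orthogonal_array 3 CARD('b) ?k 1 M ?Cols A"
      using A by (simp add: ext)
    ultimately show ?thesis
      unfolding forms_miquelian_laguerre_plane_def assms(4)[symmetric]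
      using coordinates_miquelian orthogonal_array_laguerre_plane three by fastforce
  qed
  ultimately show ?thesis
    by blast
qed

end
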